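(* Let $\delta:\mathbb{R}^n\to(0,n)$, let $p(\cdot),q(\cdot),r(\cdot)\in\mathcal{P}^{\log}(\mathbb{R}^n)$ and let $\beta\in(1,p_-)$ satisfy: (i) $\delta_->0$, $(r\delta)_+<n$ and $r_\infty\,\delta_+<n$; (ii) $p(x)\ge p_\infty$ for a.e. $x\in\mathbb{R}^n$, and $\frac1\beta+\frac{1}{(p')_+}>1$; (iii) $\frac{1}{r(x)}-\frac{1}{q(x)}=\frac{\delta(x)}{n}=\frac1\beta-\frac{1}{p(x)}$ for $x\in\mathbb{R}^n$. Let $b$ be a real-valued locally integrable function on $\mathbb{R}^n$. Then $b\in\mathbb{L}(\delta(\cdot))$ and $b\ge 0$ if and only if the commutator $[b,\mathcal{M}^\sharp]$ is bounded from $L^{r(\cdot)}(\mathbb{R}^n)$ to $L^{q(\cdot)}(\mathbb{R}^n)$.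
   Context: For a real function $g$ on $\mathbb{R}^n$ put $g_-:=\inf_{x\in\mathbb{R}^n}g(x)$ and $g_+:=\sup_{x\in\mathbb{R}^n}g(x)$; e.g. $(r\delta)_+=\sup_x r(x)\delta(x)$. $\mathcal{P}(\mathbb{R}^n)$ is the set of measurable $p(\cdot):\mathbb{R}^n\to(1,\infty)$ with $1<p_-\le p_+<\infty$. The conjugate exponent $p'(\cdot)$ is defined by $1/p(\cdot)+1/p'(\cdot)=1$. $\mathcal{P}^{\log}(\mathbb{R}^n)$ is the set of $p(\cdot)\in\mathcal{P}(\mathbb{R}^n)$ for which there exist $C_{\log}(p),C_\infty\in(0,\infty)$ and $p_\infty\in\mathbb{R}$ with $|p(x)-p(y)|\le \frac{C_{\log}(p)}{\ln(e+1/|x-y|)}$ and $|p(x)-p_\infty|\le\frac{C_\infty}{\ln(e+|x|)}$ for all $x,y\in\mathbb{R}^n$. Thus $p_\infty=\lim_{|x|\to\infty}p(x)$, and similarly for $r_\infty$. For $p(\cdot)\in\mathcal{P}(\mathbb{R}^n)$, $L^{p(\cdot)}(\mathbb{R}^n)$ is the space of measurable $f$ with $\int_{\mathbb{R}^n}(|f(x)|/\lambda)^{p(x)}dx<\infty$ for some $\lambda>0$, with norm $\|f\|_{L^{p(\cdot)}(\mathbb{R}^n)}=\inf\{\lambda>0:\int_{\mathbb{R}^n}(|f(x)|/\lambda)^{p(x)}dx\le1\}$. Variable Lipschitz space: $b\in\mathbb{L}(\delta(\cdot))$ if there is a constant $C$ with $|b(x)-b(y)|\le C|x-y|^{\delta(x)}$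 for all $x,y\in\mathbb{R}^n$. Functions equal almost everywhere are identified (so $b\in\mathbb{L}(\delta(\cdot))$ and $b\ge0$ are understood after possibly changing $b$ on a null set). Cubes $Q\subset\mathbb{R}^n$ have sides parallel to the coordinate axes, $|Q|$ is Lebesgue measure, and $f_Q:=|Q|^{-1}\int_Qf(x)\,dx$. The sharp maximal function is $\mathcal{M}^\sharp f(x):=\sup_{Q\ni x}\frac1{|Q|}\int_Q|f(y)-f_Q|\,dy$, the supremum being over all cubes containing $x$. The commutator is $[b,\mathcal{M}^\sharp](f):=b\,\mathcal{M}^\sharp(f)-\mathcal{M}^\sharp(bf)$. An operator $T$ (possibly nonlinear) is bounded from $L^{r(\cdot)}(\mathbb{R}^n)$ to $L^{q(\cdot)}(\mathbb{R}^n)$ if there is a constant $C$ such that, for all $f\in L^{r(\cdot)}(\mathbb{R}^n)$, $Tf$ is well defined a.e. and $\|Tf\|_{L^{q(\cdot)}(\mathbb{R}^n)}\le C\|f\|_{L^{r(\cdot)}(\mathbb{R}^n)}$. *)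

theory Defs
  imports "HOL-Analysis.Analysis"
begin

text \<open>
  The infimum and supremum \<open>g\<^sub>-\<close>, \<open>g\<^sub>+\<close> are written with the real-valued \<open>INF\<close>/\<open>SUP\<close>, which
  carry information only for bounded functions; the class below therefore demands
  \<open>bdd_above (range p)\<close> to express \<open>p\<^sub>+ < \<infinity>\<close> (boundedness below follows from \<open>1 < p x\<close>).
\<close>

definition var_exponents :: "(real^'n \<Rightarrow> real) set" where
  "var_exponents = {p. p \<in> borel_measurable lebesgue \<and> (\<forall>x. 1 < p x) \<and>
     1 < (INF x. p x) \<and> bdd_above (range p)}"

definition conjugate_exponent :: "(real^'n \<Rightarrow> real) \<Rightarrow> real^'n \<Rightarrow> real" where
  "conjugate_exponent p x = 1 / (1 - 1 / p x)"

text \<open>For \<open>x = y\<close> the first estimate reads \<open>0 \<le> C1 / ln (exp 1)\<close>, because \<open>1 / 0 = 0\<close>.\<close>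

definition log_hoelder_exponents :: "(real^'n \<Rightarrow> real) set" where
  "log_hoelder_exponents = {p \<in> var_exponents. \<exists>C1 C2 p_infty. 0 < C1 \<and> 0 < C2 \<and>
     (\<forall>x y. \<bar>p x - p y\<bar> \<le> C1 / ln (exp 1 + 1 / norm (x - y))) \<and>
     (\<forall>x. \<bar>p x - p_infty\<bar> \<le> C2 / ln (exp 1 + norm x))}"

definition exponent_at_infinity :: "(real^'n \<Rightarrow> real) \<Rightarrow> real" where
  "exponent_at_infinity p = Lim at_infinity p"

definition var_modular :: "(real^'n \<Rightarrow> real) \<Rightarrow> (real^'n \<Rightarrow> real) \<Rightarrow> ennreal" where
  "var_modular p f = (\<integral>\<^sup>+x. ennreal (\<bar>f x\<bar> powr p x) \<partial>lebesgue)"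

definition var_Lp :: "(real^'n \<Rightarrow> real) \<Rightarrow> (real^'n \<Rightarrow> real) set" where
  "var_Lp p = {f \<in> borel_measurable lebesgue.
     \<exists>l>0. var_modular p (\<lambda>x. \<bar>f x\<bar> / l) < \<infinity>}"

text \<open>Meaningful on \<^term>\<open>var_Lp p\<close> only: elsewhere the infimum may be one of the empty set.\<close>

definition var_Lp_norm :: "(real^'n \<Rightarrow> real) \<Rightarrow> (real^'n \<Rightarrow> real) \<Rightarrow> real" where
  "var_Lp_norm p f = Inf {l. 0 < l \<and> var_modular p (\<lambda>x. \<bar>f x\<bar> / l) \<le> 1}"

definition var_lipschitz :: "(real^'n \<Rightarrow> real) \<Rightarrow> (real^'n \<Rightarrow> real) set" where
  "var_lipschitz \<delta> = {b. \<exists>C. \<forall>x y. \<bar>b x - b y\<bar> \<le> C * norm (x - y) powr \<delta> x}"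

definition locally_integrable :: "(real^'n \<Rightarrow> real) \<Rightarrow> bool" where
  "locally_integrable f \<longleftrightarrow> (\<forall>K. compact K \<longrightarrow> set_integrable lebesgue K f)"

definition cubes :: "(real^'n) set set" where
  "cubes = {cbox a (\<chi> i. a $ i + s) | a s. 0 < s}"

definition cube_average :: "(real^'n) set \<Rightarrow> (real^'n \<Rightarrow> real) \<Rightarrow> real" where
  "cube_average Q f = set_lebesgue_integral lebesgue Q f / measure lebesgue Q"

definition sharp_maximal :: "(real^'n \<Rightarrow> real) \<Rightarrow> real^'n \<Rightarrow> ennreal" where
  "sharp_maximal f x = (SUP Q\<in>{Q \<in> cubes. x \<in> Q}.
     (\<integral>\<^sup>+y\<in>Q. ennreal \<bar>f y - cube_average Q f\<bar> \<partial>lebesgue) / emeasure lebesgue Q)"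

text \<open>
  The commutator is a real-valued function wherever both maximal functions are finite, and
  \<^const>\<open>enn2real\<close> is harmless there. Well-definedness of the commutator is the predicate
  \<open>sharp_commutator_defined\<close>: the averages over all cubes containing \<open>x\<close> have to exist for \<open>f\<close>
  and for \<open>b f\<close>, and both suprema have to be finite.
\<close>

definition sharp_maximal_defined :: "(real^'n \<Rightarrow> real) \<Rightarrow> real^'n \<Rightarrow> bool" where
  "sharp_maximal_defined f x \<longleftrightarrow>
     (\<forall>Q\<in>cubes. x \<in> Q \<longrightarrow> set_integrable lebesgue Q f) \<and> sharp_maximal f x < \<infinity>"

definition sharp_commutator ::
    "(real^'n \<Rightarrow> real) \<Rightarrow> (real^'n \<Rightarrow> real) \<Rightarrow> real^'n \<Rightarrow> real" where
  "sharp_commutator b f x =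
     b x * enn2real (sharp_maximal f x) - enn2real (sharp_maximal (\<lambda>y. b y * f y) x)"

definition sharp_commutator_defined ::
    "(real^'n \<Rightarrow> real) \<Rightarrow> (real^'n \<Rightarrow> real) \<Rightarrow> real^'n \<Rightarrow> bool" where
  "sharp_commutator_defined b f x \<longleftrightarrow>
     sharp_maximal_defined f x \<and> sharp_maximal_defined (\<lambda>y. b y * f y) x"

text \<open>
  \<open>D f x\<close> says that the value \<open>T f x\<close> is well defined. Membership of \<open>T f\<close> in the target space
  is explicit, since the real-valued norm cannot express \<open>\<infinity>\<close>.
\<close>

definition bounded_operator ::
    "((real^'n \<Rightarrow> real) \<Rightarrow> real^'n \<Rightarrow> bool) \<Rightarrow> ((real^'n \<Rightarrow> real) \<Rightarrow> real^'n \<Rightarrow> real) \<Rightarrow>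
     (real^'n \<Rightarrow> real) \<Rightarrow> (real^'n \<Rightarrow> real) \<Rightarrow> bool" where
  "bounded_operator D T r q \<longleftrightarrow> (\<exists>C. \<forall>f\<in>var_Lp r.
     (AE x in lebesgue. D f x) \<and> T f \<in> var_Lp q \<and> var_Lp_norm q (T f) \<le> C * var_Lp_norm r f)"

end

theory Submission
  imports Defs "HOL-Library.Nat_Bijection"
begin

text \<open>
  If \<open>b \<ge> 0\<close> is variable Lipschitz, then pointwise \<open>|[b, M\<^sup>#] f (x)|\<close> is at most a constant times the
  supremum of \<open>\<rho>\<^bsup>\<delta>(x)\<^esup>\<close> times the average of \<open>|f|\<close> over the balls of radius \<open>\<rho>\<close> containing \<open>x\<close>. For
  \<open>f\<close> in the unit ball of \<open>L\<^bsup>r(\<cdot>)\<^esup>\<close> log-Hoelder continuity bounds \<open>(avg f)\<^bsup>r(x)\<^esup>\<close> by \<open>(M F)(x)\<^sup>c\<close>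
  plus a power of \<open>e + |x|\<close>, where \<open>c = inf r > 1\<close> and \<open>F = f\<^bsup>r(\<cdot>)/c\<^esup>\<close> plus a similar power, so that the
  classical maximal theorem on \<open>L\<^sup>c\<close> applies; the factor \<open>\<rho>\<^bsup>\<delta>(x)\<^esup>\<close> is absorbed as in Hedberg's
  inequality, very large radii being harmless because \<open>r\<^sub>\<infinity> \<delta>\<^sub>+ < n\<close>.

  Conversely, \<open>M\<^sup># \<chi>\<^sub>Q = 1/2\<close> and \<open>M\<^sup># (b \<chi>\<^sub>Q) \<ge> |b\<^sub>Q| / 2\<close> on a cube \<open>Q\<close>, hence
  \<open>|b\<^sub>Q| \<le> b - 2 [b, M\<^sup>#] \<chi>\<^sub>Q\<close> on \<open>Q\<close>. The norm bound makes the average of the commutator over \<open>Q\<close>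
  at most a constant times \<open>s\<^bsup>\<delta>(x)\<^esup>\<close> for small side length \<open>s\<close> and \<open>s\<^bsup>\<delta>(\<infinity>)\<^esup>\<close> for large \<open>s\<close>, where
  \<open>\<delta>(\<infinity>) \<le> \<delta>(x)\<close> because \<open>p \<ge> p\<^sub>\<infinity>\<close>. This controls both the mean oscillation of \<open>b\<close>, whence a
  continuous representative in the Lipschitz class by Campanato's argument, and \<open>|b\<^sub>Q| - b\<^sub>Q\<close>,
  whence its sign.
\<close>

subsection \<open>Weights and log-Hoelder exponents\<close>

text \<open>With one constant exponent, Hoelder, Jensen and scaling would suffice; here each
  estimate has to move an exponent from one point to another. Every such move has the form
  \<open>t powr a \<le> exp K * t powr b\<close> and costs a bound on
  \<open>\<bar>a - b\<bar> * \<bar>ln t\<bar>\<close>. Log-Hoelder continuity pays for it in two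
  situations: a and b belong to points at distance comparable to some \<rho> \<le> 1 and |ln t| is
  at most a constant plus a multiple of ln (1/\<rho>); or one of them is the value at infinity and
  |ln t| is at most a multiple of ln (e + |x|), as for t between \<open>decay x\<close> and 1.
  Smaller t are not moved at all but absorbed into an integrable error. This forces two regimes:
  lengths up to 1 see the exponent at x, lengths beyond 1 see the exponent at infinity. For the same
  reason the converse first yields the gauge s^\<delta>(x) for s \<le> 1 and s^\<delta>(\<infinity>)
  for s > 1, and only a comparison of \<delta>(\<infinity>) with \<delta>(x) turns it into one power
  of |x - y|.\<close>

text \<open>Integrated with a suitable \<open>\<mu>\<close>, which may depend on the point, this replaces the Hoelder and
  Jensen inequalities for variable exponents.\<close>

lemma le_plus_powr:
  fixes a \<mu> \<sigma> :: real
  assumes "0 \<le> a" "0 < \<mu>" "1 \<le> \<sigma>"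
  shows "a \<le> \<mu> + \<mu> powr (1 - \<sigma>) * a powr \<sigma>"
proof (cases "a \<le> \<mu>")
  case True
  then show ?thesis by (simp add: add_increasing2)
next
  case False
  then have a: "\<mu> < a" "0 < a" using assms by auto
  have "a = \<mu> powr (1 - \<sigma>) * a * \<mu> powr (\<sigma> - 1)"
    using assms by (simp add: powr_diff)
  also have "\<dots> \<le> \<mu> powr (1 - \<sigma>) * a * a powr (\<sigma> - 1)"
    using a assms by (intro mult_left_mono powr_mono2) auto
  also have "\<dots> = \<mu> powr (1 - \<sigma>) * a powr \<sigma>"
    using a by (simp add: powr_diff)
  finally show ?thesis using assms by linarith
qed

text \<open>The error term of the estimates below. The exponent n + 1 makes it integrable, while its
  logarithm is only a multiple of ln (e + |x|), the quantity that the condition at infinity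
  controls.\<close>

definition decay :: "real^'n \<Rightarrow> real" where
  "decay x = (exp 1 + norm x) powr - (real CARD('n) + 1)"

lemma exp1_plus_norm_ge: "exp 1 \<le> exp 1 + norm x" "1 < exp 1 + norm x" "0 < exp 1 + norm x"
proof -
  have "(1::real) < exp 1" by simp
  then show "exp 1 \<le> exp 1 + norm x" "1 < exp 1 + norm x" "0 < exp 1 + norm x"
    using norm_ge_zero[of x] by linarith+
qed

lemma ln_exp1_plus_norm_ge: "1 \<le> ln (exp 1 + norm x)"
  using exp1_plus_norm_ge(1)[of x] exp1_plus_norm_ge(3)[of x] by (subst ln_ge_iff) auto

lemma decay_pos: "0 < decay x"
  using exp1_plus_norm_ge(2)[of x] unfolding decay_def by simp

lemma decay_le_1: "decay (x::real^'a) \<le> 1"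
  using exp1_plus_norm_ge(2)[of x] unfolding decay_def
  using powr_mono[of "- (real CARD('a) + 1)" 0 "exp 1 + norm x"] by simp

lemma ln_decay: "ln (decay (x::real^'n)) = - (real CARD('n) + 1) * ln (exp 1 + norm x)"
  using exp1_plus_norm_ge(2)[of x] unfolding decay_def by (simp add: ln_powr)

lemma decay_measurable [measurable]: "decay \<in> borel_measurable borel"
  unfolding decay_def by measurable

text \<open>\<open>C\<close> and \<open>sinf\<close> are parameters because the constants below are
  given by formulas in them. One \<open>C\<close> serves both moduli.\<close>

definition log_hoelder_with :: "real \<Rightarrow> real \<Rightarrow> (real^'n \<Rightarrow> real) \<Rightarrow> bool" where
  "log_hoelder_with C sinf s \<longleftrightarrow> 0 \<le> C \<and>
     (\<forall>x y. \<bar>s x - s y\<bar> \<le> C / ln (exp 1 + 1 / norm (x - y))) \<and>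
     (\<forall>x. \<bar>s x - sinf\<bar> \<le> C / ln (exp 1 + norm x))"

text \<open>Passing from |x - y| to t costs at most ln \<kappa> in the logarithm. Since the
  logarithmic denominator is at least 1, this additive loss becomes the factor 1 + ln
  \<kappa>.\<close>

lemma log_hoelder_with_local:
  assumes s: "log_hoelder_with C sinf s" and t: "0 < t" "t \<le> 1" and \<kappa>: "1 \<le> \<kappa>" "norm (x - y) \<le> \<kappa> * t"
  shows "\<bar>s x - s y\<bar> * ln (1 / t) \<le> C * (1 + ln \<kappa>)"
proof (cases "x = y")
  case True
  then show ?thesis using s \<kappa> by (auto simp: log_hoelder_with_def)
next
  case False
  define L where "L = ln (exp 1 + 1 / norm (x - y))"
  have C: "0 \<le> C" and le: "\<bar>s x - s y\<bar> \<le> C / L"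
    using s unfolding log_hoelder_with_def L_def by auto
  have n: "0 < norm (x - y)" using False by simp
  have L1: "1 \<le> L"
    unfolding L_def using n by (subst ln_ge_iff) (auto simp: add_pos_nonneg)
  have "1 / (\<kappa> * t) \<le> 1 / norm (x - y)"
    using n \<kappa> t by (intro divide_left_mono) auto
  also have "\<dots> \<le> exp 1 + 1 / norm (x - y)" by simp
  finally have "ln (1 / (\<kappa> * t)) \<le> L"
    unfolding L_def using \<kappa> t by (subst ln_le_cancel_iff) (auto intro: add_pos_nonneg)
  then have "ln (1 / t) \<le> L + ln \<kappa>"
    using \<kappa> t by (simp add: ln_div ln_mult)
  also have "\<dots> \<le> L * (1 + ln \<kappa>)"
    using L1 \<kappa> mult_right_mono[of 1 L "ln \<kappa>"] by (simp add: algebra_simps)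
  finally have *: "ln (1 / t) \<le> L * (1 + ln \<kappa>)" .
  have "\<bar>s x - s y\<bar> * ln (1 / t) \<le> \<bar>s x - s y\<bar> * (L * (1 + ln \<kappa>))"
    by (intro mult_left_mono *) auto
  also have "\<dots> \<le> C / L * (L * (1 + ln \<kappa>))"
    using L1 \<kappa> by (intro mult_right_mono le mult_nonneg_nonneg add_nonneg_nonneg) auto
  finally show ?thesis using L1 by simp
qed

lemma log_hoelder_with_infinity:
  assumes s: "log_hoelder_with C sinf s"
  shows "\<bar>s x - sinf\<bar> * ln (exp 1 + norm x) \<le> C"
proof -
  have "\<bar>s x - sinf\<bar> \<le> C / ln (exp 1 + norm x)"
    using s unfolding log_hoelder_with_def by blast
  moreover have "0 < ln (exp 1 + norm x)" using ln_exp1_plus_norm_ge[of x] by linarith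
  ultimately show ?thesis by (simp add: pos_le_divide_eq)
qed

lemma powr_le_exp_mult_powr:
  fixes t a b :: real
  assumes "0 < t" "\<bar>a - b\<bar> * \<bar>ln t\<bar> \<le> K"
  shows "t powr a \<le> exp K * t powr b"
proof -
  have "(a - b) * ln t \<le> \<bar>(a - b) * ln t\<bar>" by simp
  also have "\<dots> \<le> K" using assms by (simp add: abs_mult)
  finally have "a * ln t \<le> K + b * ln t" by (simp add: algebra_simps)
  then show ?thesis using assms by (simp add: powr_def exp_add[symmetric])
qed

text \<open>For t between \<open>decay x\<close> and 1, |ln t| is at most (n + 1) ln (e + |x|),
  which cancels the denominator in the condition at infinity. The resulting bound is uniform in
  x.\<close>

lemma decay_powr_change:
  fixes s :: "real^'n \<Rightarrow> real"
  assumes s: "log_hoelder_with C sinf s" and t: "decay x \<le> t" "t \<le> 1"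
  shows "\<bar>s x - sinf\<bar> * \<bar>ln t\<bar> \<le> (real CARD('n) + 1) * C"
proof -
  have "0 < t" using t decay_pos[of x] by linarith
  have "- ln t \<le> - ln (decay x)"
    using t decay_pos[of x] by (simp add: ln_mono)
  then have "\<bar>ln t\<bar> \<le> (real CARD('n) + 1) * ln (exp 1 + norm x)"
    using t \<open>0 < t\<close> ln_decay[of x] by (simp add: algebra_simps)
  then have "\<bar>s x - sinf\<bar> * \<bar>ln t\<bar> \<le> \<bar>s x - sinf\<bar> * ((real CARD('n) + 1) * ln (exp 1 + norm x))"
    by (intro mult_left_mono) auto
  also have "\<dots> \<le> (real CARD('n) + 1) * C"
    using log_hoelder_with_infinity[OF s, of x] by (simp add: mult.left_commute)
  finally show ?thesis .
qed

text \<open>Above \<open>decay x\<close> this is \<open>decay_powr_change\<close>; below it both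
  powers are at most t itself, since the exponents are at least 1 and t \<le> 1.\<close>

lemma powr_exponent_infinity:
  fixes s :: "real^'n \<Rightarrow> real"
  assumes s: "log_hoelder_with C sinf s" and t: "0 \<le> t" "t \<le> 1" and ge: "1 \<le> s x" "1 \<le> sinf"
  shows "t powr s x \<le> exp ((real CARD('n) + 1) * C) * t powr sinf + decay x"
    and "t powr sinf \<le> exp ((real CARD('n) + 1) * C) * t powr s x + decay x"
proof -
  have small: "t powr \<sigma> \<le> decay x" if "t < decay x" "1 \<le> \<sigma>" for \<sigma>
  proof -
    have "t powr \<sigma> \<le> t powr 1" by (rule powr_mono') (use t that in auto)
    then show ?thesis using that t by simp
  qed
  have pos: "0 < t" if "\<not> t < decay x" using that decay_pos[of x] by linarith
  show "t powr s x \<le> exp ((real CARD('n) + 1) * C) * t powr sinf + decay x"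
  proof (cases "t < decay x")
    case True
    then show ?thesis using small ge by (simp add: add_increasing)
  next
    case False
    then have "t powr s x \<le> exp ((real CARD('n) + 1) * C) * t powr sinf"
      using decay_powr_change[OF s, of x t] t pos by (intro powr_le_exp_mult_powr) (simp_all add: not_less)
    then show ?thesis using decay_pos[of x] by linarith
  qed
  show "t powr sinf \<le> exp ((real CARD('n) + 1) * C) * t powr s x + decay x"
  proof (cases "t < decay x")
    case True
    then show ?thesis using small ge by (simp add: add_increasing)
  next
    case False
    then have "t powr sinf \<le> exp ((real CARD('n) + 1) * C) * t powr s x"
      using decay_powr_change[OF s, of x t] t pos by (intro powr_le_exp_mult_powr) (simp_all add: abs_minus_commute not_less)
    then show ?thesis using decay_pos[of x] by linarith
  qed
qed

section \<open>Volume of balls and integrability of the decay weight\<close>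

lemma emeasure_ball_lebesgue:
  "emeasure lebesgue (ball (a::real^'n) \<rho>) = ennreal (unit_ball_vol (real CARD('n)) * \<rho> ^ CARD('n))"
  if "0 \<le> \<rho>"
  using emeasure_ball[OF that, of a] by simp

text \<open>Where e + |x| lies between 2^j and 2^(j+1), the weight is at most 2^(-j(n+1)) and the
  point lies in a ball of volume comparable to 2^(jn). The exponent n + 1 leaves a geometric series
  in 2^(-j).\<close>

lemma nn_integral_decay_finite: "\<exists>K>0. (\<integral>\<^sup>+x. ennreal (decay (x::real^'n)) \<partial>lebesgue) \<le> ennreal K"
proof -
  define n where "n = CARD('n)"
  define V where "V = unit_ball_vol (real n)"
  have V: "0 < V" by (simp add: V_def)
  define g :: "nat \<Rightarrow> real^'n \<Rightarrow> ennreal" where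
    "g k x = ennreal ((1/2) ^ (k * (n+1))) * indicator (ball 0 (2 ^ (k+2))) x" for k x
  have "ennreal (decay x) \<le> (\<Sum>k. g k x)" for x :: "real^'n"
  proof -
    define N where "N = exp 1 + norm x"
    have N: "1 < N" using exp1_plus_norm_ge[of x] by (simp add: N_def)
    have "\<exists>k. N < 2 ^ k" using real_arch_pow[of 2 N] by auto
    then obtain k where k: "N < 2 ^ k" "\<And>j. j < k \<Longrightarrow> \<not> N < 2 ^ j"
      using exists_least_iff[of "\<lambda>k. N < 2 ^ k"] by auto
    have "k \<noteq> 0" using k(1) N by (cases k) auto
    then obtain j where j: "k = Suc j" by (cases k) auto
    have le: "2 ^ j \<le> N" using k(2)[of j] j by simp
    have "decay x \<le> (1/2) ^ (j * (n+1))"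
    proof -
      have "decay x = N powr - (real (n + 1))" by (simp add: decay_def N_def n_def add_ac)
      also have "\<dots> = inverse (N ^ (n+1))"
        using N by (subst powr_minus, subst powr_realpow) auto
      also have "\<dots> \<le> inverse ((2^j) ^ (n+1))"
        using le by (intro le_imp_inverse_le power_mono) auto
      also have "\<dots> = (1/2) ^ (j * (n+1))" by (simp only: power_mult[symmetric] power_one_over inverse_eq_divide)
      finally show ?thesis .
    qed
    moreover have "x \<in> ball 0 (2 ^ (j+2))"
      using k(1) j unfolding N_def by (simp add: add_strict_increasing2 less_trans[of "norm x" "2 * 2 ^ j"])
       (smt (verit, best) exp_gt_zero zero_less_power)
    ultimately have "ennreal (decay x) \<le> g j x" by (simp add: g_def ennreal_leI)
    also have "\<dots> \<le> (\<Sum>k. g k x)"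
      using sum_le_suminf[of "\<lambda>k. g k x" "{j}"] by simp
    finally show ?thesis .
  qed
  then have "(\<integral>\<^sup>+x. ennreal (decay (x::real^'n)) \<partial>lebesgue) \<le> (\<integral>\<^sup>+x. (\<Sum>k. g k x) \<partial>lebesgue)"
    by (intro nn_integral_mono) auto
  also have "\<dots> = (\<Sum>k. \<integral>\<^sup>+x. g k x \<partial>lebesgue)"
    unfolding g_def by (intro nn_integral_suminf borel_measurable_times_ennreal borel_measurable_indicator) auto
  also have "\<dots> = (\<Sum>k. ennreal (V * 4 ^ n * (1/2) ^ k))"
  proof (intro suminf_cong)
    fix k
    have "(\<integral>\<^sup>+x. g k x \<partial>lebesgue) = ennreal ((1/2) ^ (k * (n+1))) * emeasure lebesgue (ball (0::real^'n) (2^(k+2)))"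
      unfolding g_def by (subst nn_integral_cmult_indicator) auto
    also have "\<dots> = ennreal ((1/2) ^ (k * (n+1)) * (V * (2 ^ (k+2)) ^ n))"
      by (subst emeasure_ball_lebesgue) (auto simp: ennreal_mult' V_def n_def)
    also have "(1/2) ^ (k * (n+1)) * (V * (2 ^ (k+2)) ^ n) = V * 4 ^ n * (1/2::real) ^ k"
      by (simp add: power_add power_mult power_mult_distrib power_divide power2_eq_square field_simps)
    finally show "(\<integral>\<^sup>+x. g k x \<partial>lebesgue) = ennreal (V * 4 ^ n * (1/2) ^ k)" .
  qed
  also have "\<dots> = ennreal (\<Sum>k. V * 4 ^ n * (1/2) ^ k)"
    using V by (intro suminf_ennreal2 summable_mult summable_geometric) auto
  finally show ?thesis
    using V by (intro exI[of _ "max 1 (\<Sum>k. V * 4 ^ n * (1/2) ^ k)"])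
      (auto elim!: order_trans intro!: ennreal_leI)
qed

subsection \<open>The Hardy--Littlewood maximal function\<close>

definition ball_average :: "(real^'n \<Rightarrow> ennreal) \<Rightarrow> real^'n \<Rightarrow> real \<Rightarrow> ennreal" where
  "ball_average F a \<rho> = (\<integral>\<^sup>+y\<in>ball a \<rho>. F y \<partial>lebesgue) / emeasure lebesgue (ball a \<rho>)"

text \<open>Uncentred and over open balls, so that each superlevel set is a union of open balls and
  hence open for arbitrary \<open>F\<close>.\<close>

definition hl_maximal :: "(real^'n \<Rightarrow> ennreal) \<Rightarrow> real^'n \<Rightarrow> ennreal" where
  "hl_maximal F x = (SUP (a, \<rho>)\<in>{(a, \<rho>). 0 < \<rho> \<and> x \<in> ball a \<rho>}. ball_average F a \<rho>)"

lemma ball_average_le_hl_maximal: "0 < \<rho> \<Longrightarrow> x \<in> ball a \<rho> \<Longrightarrow> ball_average F a \<rho> \<le> hl_maximal F x"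
  unfolding hl_maximal_def by (rule SUP_upper2[of "(a, \<rho>)"]) auto

lemma hl_maximal_superlevel:
  "{x. t < hl_maximal F x} = (\<Union>(a, \<rho>)\<in>{(a, \<rho>). 0 < \<rho> \<and> t < ball_average F a \<rho>}. ball a \<rho>)"
  unfolding hl_maximal_def by (auto simp: less_SUP_iff) blast

lemma hl_maximal_measurable_borel: "hl_maximal F \<in> borel_measurable borel"
proof (rule borel_measurableI_greater)
  fix t
  have "open {x. t < hl_maximal F x}"
    unfolding hl_maximal_superlevel by auto
  then show "{x \<in> space borel. t < hl_maximal F x} \<in> sets borel"
    by simp
qed

lemma hl_maximal_measurable [measurable]: "hl_maximal F \<in> borel_measurable lebesgue"
  by (intro measurable_completion) (simp add: hl_maximal_measurable_borel)

lemma hl_maximal_superlevel_sets: "{x. t < hl_maximal F x} \<in> sets lebesgue"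
  using measurable_sets[OF hl_maximal_measurable, of "{t<..}" F] by (simp add: vimage_def)

text \<open>Vitali: among the balls on which the average exceeds t, a countable disjoint subfamily
  has fivefold dilates covering the superlevel set. Its total volume is at most 1/t times the
  integral of \<open>F\<close>, and the dilation costs 5^n.\<close>

lemma hl_maximal_weak_type:
  fixes F :: "real^'n \<Rightarrow> ennreal"
  assumes F: "F \<in> borel_measurable lebesgue" and fin: "(\<integral>\<^sup>+x. F x \<partial>lebesgue) < \<infinity>" and t: "0 < t"
  shows "emeasure lebesgue {x. ennreal t < hl_maximal F x} \<le> ennreal (5 ^ CARD('n) / t) * (\<integral>\<^sup>+x. F x \<partial>lebesgue)"
proof -
  define n where "n = CARD('n)"
  define V where "V = unit_ball_vol (real n)"
  have V: "0 < V" by (simp add: V_def)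
  have n: "0 < n" by (simp add: n_def)
  \<comment> \<open>The measure with density \<open>F\<close> turns the sum of integrals over
    disjoint balls into one application of countable additivity.\<close>
  define D where "D = density lebesgue F"
  have D: "emeasure D A = (\<integral>\<^sup>+y\<in>A. F y \<partial>lebesgue)" if "A \<in> sets lebesgue" for A
    unfolding D_def using F that by (subst emeasure_density) (auto intro!: nn_integral_cong)
  have D_le: "(\<integral>\<^sup>+y\<in>A. F y \<partial>lebesgue) \<le> (\<integral>\<^sup>+x. F x \<partial>lebesgue)" for A
    by (intro nn_integral_mono) (auto simp: indicator_def)
  define K where "K = {(a::real^'n, \<rho>). 0 < \<rho> \<and> ennreal t < ball_average F a \<rho>}"
  define I where "I = enn2real (\<integral>\<^sup>+x. F x \<partial>lebesgue)"
  have I: "(\<integral>\<^sup>+x. F x \<partial>lebesgue) = ennreal I" "0 \<le> I"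
    using fin by (auto simp: I_def less_top)
  have vol: "emeasure lebesgue (ball a \<rho>) = ennreal (V * \<rho> ^ n)" if "0 < \<rho>" for a :: "real^'n" and \<rho>
    using emeasure_ball_lebesgue[of \<rho> a] that by (simp add: V_def n_def)
  have key: "ennreal (t * (V * \<rho> ^ n)) \<le> emeasure D (ball a \<rho>)" if "(a, \<rho>) \<in> K" for a \<rho>
  proof -
    have \<rho>: "0 < \<rho>" and less: "ennreal t < emeasure D (ball a \<rho>) / ennreal (V * \<rho> ^ n)"
      using that vol[of \<rho> a] by (auto simp: K_def ball_average_def D)
    define i where "i = enn2real (emeasure D (ball a \<rho>))"
    have "emeasure D (ball a \<rho>) < top"
      using D_le[of "ball a \<rho>"] fin by (auto simp: D intro: le_less_trans)
    then have i: "emeasure D (ball a \<rho>) = ennreal i" "0 \<le> i"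
      by (auto simp: i_def)
    have "ennreal t < ennreal (i / (V * \<rho> ^ n))"
      using less V \<rho> i by (simp add: divide_ennreal)
    then have "t < i / (V * \<rho> ^ n)"
      using t by (simp add: ennreal_less_iff)
    then have "t * (V * \<rho> ^ n) \<le> i"
      using V \<rho> by (simp add: pos_less_divide_eq)
    then show ?thesis using i by (simp add: ennreal_leI)
  qed
  \<comment> \<open>The covering lemma needs bounded radii. A ball of \<open>K\<close> has volume V
    \<rho>^n at most I / t, and \<rho> \<le> \<rho>^n once \<rho> > 1.\<close>
  have bound: "0 < snd i \<and> snd i \<le> max 1 (I / (t * V))" if "i \<in> K" for i
  proof -
    obtain a \<rho> where i: "i = (a, \<rho>)" by force
    have \<rho>: "0 < \<rho>" using that by (auto simp: K_def i)
    have "ennreal (t * (V * \<rho> ^ n)) \<le> emeasure D (ball a \<rho>)"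
      using key that by (simp add: i)
    also have "\<dots> \<le> ennreal I"
      using D_le[of "ball a \<rho>"] by (simp add: D I(1))
    finally have "ennreal (t * (V * \<rho> ^ n)) \<le> ennreal I" .
    then have *: "t * (V * \<rho> ^ n) \<le> I" using I by simp
    have "\<rho> \<le> I / (t * V)" if "1 < \<rho>"
    proof -
      have "\<rho> ^ 1 \<le> \<rho> ^ n" using that n by (intro power_increasing) auto
      then have "\<rho> * (t * V) \<le> \<rho> ^ n * (t * V)" using t V by (intro mult_right_mono) auto
      also have "\<dots> \<le> I" using * by (simp add: mult_ac)
      finally show ?thesis using t V by (simp add: pos_le_divide_eq)
    qed
    then show ?thesis using \<rho> by (cases "1 < \<rho>") (auto simp: i)
  qed
  have cover: "{x. ennreal t < hl_maximal F x} \<subseteq> (\<Union>i\<in>K. ball (fst i) (snd i))"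
    unfolding hl_maximal_superlevel K_def by fastforce
  obtain C where C: "countable C" "C \<subseteq> K"
     "pairwise (\<lambda>i j. disjnt (ball (fst i) (snd i)) (ball (fst j) (snd j))) C"
     "{x. ennreal t < hl_maximal F x} \<subseteq> (\<Union>i\<in>C. ball (fst i) (5 * snd i))"
    by (rule Vitali_covering_lemma_balls[OF cover bound])
  define Y where "Y k = (if k \<in> to_nat_on C ` C then ball (fst (from_nat_into C k)) (snd (from_nat_into C k)) else {})" for k
  define X where "X k = (if k \<in> to_nat_on C ` C then ball (fst (from_nat_into C k)) (5 * snd (from_nat_into C k)) else {})" for k
  have inC: "from_nat_into C k \<in> C" if "k \<in> to_nat_on C ` C" for k
    using that C(1) by auto
  have Y_sets: "Y k \<in> sets D" for k by (simp add: Y_def D_def)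
  have "disjoint_family Y"
    unfolding disjoint_family_on_def
  proof (intro ballI impI)
    fix k l :: nat assume "k \<noteq> l"
    show "Y k \<inter> Y l = {}"
    proof (cases "k \<in> to_nat_on C ` C \<and> l \<in> to_nat_on C ` C")
      case True
      then have "from_nat_into C k \<noteq> from_nat_into C l"
        using C(1) \<open>k \<noteq> l\<close> by auto
      then show ?thesis
        using C(3) True inC unfolding pairwise_def Y_def disjnt_def by simp
    qed (auto simp: Y_def)
  qed
  have XY: "emeasure lebesgue (X k) \<le> ennreal (5 ^ n / t) * emeasure D (Y k)" for k
  proof (cases "k \<in> to_nat_on C ` C")
    case True
    obtain a \<rho> where i: "from_nat_into C k = (a, \<rho>)" by force
    have iK: "(a, \<rho>) \<in> K" using inC[OF True] C(2) i by auto
    then have \<rho>: "0 < \<rho>" by (auto simp: K_def)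
    have "emeasure lebesgue (X k) = ennreal (5 ^ n / t) * ennreal (t * (V * \<rho> ^ n))"
      using True \<rho> i t V
      by (simp add: X_def vol ennreal_mult[symmetric] power_mult_distrib mult.left_commute del: emeasure_completion)
    also have "\<dots> \<le> ennreal (5 ^ n / t) * emeasure D (Y k)"
      using key[OF iK] True i by (intro mult_left_mono) (auto simp: Y_def)
    finally show ?thesis .
  qed (auto simp: X_def)
  have "{x. ennreal t < hl_maximal F x} \<subseteq> (\<Union>k. X k)"
  proof
    fix x assume "x \<in> {x. ennreal t < hl_maximal F x}"
    then obtain i where "i \<in> C" "x \<in> ball (fst i) (5 * snd i)" using C(4) by blast
    then have "x \<in> X (to_nat_on C i)" using C(1) by (simp add: X_def)
    then show "x \<in> (\<Union>k. X k)" by blast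
  qed
  then have "emeasure lebesgue {x. ennreal t < hl_maximal F x} \<le> emeasure lebesgue (\<Union>k. X k)"
    by (rule emeasure_mono) (intro sets.countable_UN' , auto simp: X_def)
  also have "\<dots> \<le> (\<Sum>k. emeasure lebesgue (X k))"
    by (intro emeasure_subadditive_countably) (auto simp: X_def)
  also have "\<dots> \<le> (\<Sum>k. ennreal (5 ^ n / t) * emeasure D (Y k))"
    by (intro suminf_le XY) auto
  also have "\<dots> = ennreal (5 ^ n / t) * (\<Sum>k. emeasure D (Y k))"
    by (rule ennreal_suminf_cmult)
  also have "(\<Sum>k. emeasure D (Y k)) = emeasure D (\<Union>k. Y k)"
    using \<open>disjoint_family Y\<close> Y_sets by (intro suminf_emeasure) auto
  also have "\<dots> \<le> (\<integral>\<^sup>+x. F x \<partial>lebesgue)"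
    using Y_sets by (subst D) (auto simp: D_def intro!: D_le)
  finally show ?thesis by (simp add: n_def mult_left_mono)
qed

text \<open>Sums over all dyadic levels \<open>2\<^sup>k\<close>, \<open>k\<close> an integer, are written as series through \<^const>\<open>int_decode\<close>.\<close>

lemma suminf_dyadic_le:
  fixes a y :: real
  assumes "0 < a" "0 \<le> y"
  shows "(\<Sum>j. ennreal (if 2 powr real_of_int (int_decode j) < y then 2 powr (a * real_of_int (int_decode j)) else 0))
    \<le> ennreal (y powr a / (1 - 2 powr - a))"
proof (cases "y = 0")
  case True
  then have "\<not> 2 powr real_of_int (int_decode j) < y" for j by (simp add: not_less)
  then show ?thesis by simp
next
  case False
  then have y: "0 < y" using assms by simp
  define k\<^sub>0 where "k\<^sub>0 = \<lceil>log 2 y\<rceil> - 1"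
  \<comment> \<open>\<open>k\<^sub>0\<close> is the largest integer strictly below log 2 y. It is
    the ceiling minus one and not the floor, because the level itself has to stay strictly below
    y.\<close>
  have iff: "2 powr real_of_int k < y \<longleftrightarrow> k \<le> k\<^sub>0" for k
  proof -
    have "2 powr real_of_int k < y \<longleftrightarrow> real_of_int k < log 2 y"
      using y by (simp add: less_log_iff)
    then show ?thesis unfolding k\<^sub>0_def by (simp add: le_diff_eq less_ceiling_iff[symmetric] add1_zle_eq)
  qed
  define g where "g k = ennreal (2 powr (a * real_of_int k))" for k
  have q: "2 powr - a < 1" "0 < 2 powr - a" using assms by (auto simp: powr_less_one)
  have "(\<Sum>j. ennreal (if 2 powr real_of_int (int_decode j) < y then 2 powr (a * real_of_int (int_decode j)) else 0))
      = (\<Sum>j. g (int_decode j) * indicator {..k\<^sub>0} (int_decode j))"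
    by (intro suminf_cong) (auto simp: iff g_def indicator_def)
  also have "\<dots> = (\<integral>\<^sup>+j. g (int_decode j) * indicator {..k\<^sub>0} (int_decode j) \<partial>count_space UNIV)"
    by (rule nn_integral_count_space_nat[symmetric])
  also have "\<dots> = (\<integral>\<^sup>+k. g k * indicator {..k\<^sub>0} k \<partial>count_space UNIV)"
    using bij_int_decode by (rule nn_integral_bij_count_space)
  also have "\<dots> = (\<integral>\<^sup>+k. g k \<partial>count_space {..k\<^sub>0})"
    by (subst nn_integral_count_space_indicator) auto
  \<comment> \<open>Counting down from the top level gives a geometric series with ratio
    2^(-a).\<close>
  also have "\<dots> = (\<integral>\<^sup>+i. g (k\<^sub>0 - int i) \<partial>count_space UNIV)"
    by (rule nn_integral_bij_count_space[symmetric], rule bij_betwI[where g="\<lambda>k. nat (k\<^sub>0 - k)"]) auto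
  also have "\<dots> = (\<Sum>i. g (k\<^sub>0 - int i))"
    by (rule nn_integral_count_space_nat)
  also have "\<dots> = (\<Sum>i. ennreal (2 powr (a * real_of_int k\<^sub>0) * (2 powr - a) ^ i))"
    by (intro suminf_cong)
      (simp add: g_def powr_realpow[symmetric] powr_powr powr_add[symmetric] algebra_simps)
  also have "\<dots> = ennreal (\<Sum>i. 2 powr (a * real_of_int k\<^sub>0) * (2 powr - a) ^ i)"
    using q by (intro suminf_ennreal2 summable_mult summable_geometric) auto
  also have "(\<Sum>i. 2 powr (a * real_of_int k\<^sub>0) * (2 powr - a) ^ i) = 2 powr (a * real_of_int k\<^sub>0) / (1 - 2 powr - a)"
    using q by (subst suminf_mult) (auto simp: suminf_geometric)
  finally have eq: "(\<Sum>j. ennreal (if 2 powr real_of_int (int_decode j) < y then 2 powr (a * real_of_int (int_decode j)) else 0))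
      = ennreal (2 powr (a * real_of_int k\<^sub>0) / (1 - 2 powr - a))" .
  have "2 powr (a * real_of_int k\<^sub>0) \<le> y powr a"
  proof -
    have "2 powr real_of_int k\<^sub>0 < y" using iff by simp
    then have "(2 powr real_of_int k\<^sub>0) powr a \<le> y powr a" using assms by (intro powr_mono2) auto
    then show ?thesis by (simp add: powr_powr mult.commute)
  qed
  then show ?thesis unfolding eq using q by (intro ennreal_leI divide_right_mono) auto
qed

text \<open>A single term suffices, namely the level k with 2^k < w \<le> 2^(k+1). Paired with
  \<open>suminf_dyadic_le\<close>, it is a discrete form of the layer-cake formula.\<close>

lemma powr_le_suminf_dyadic:
  fixes w p :: real
  assumes "0 \<le> w" "0 < p"
  shows "ennreal (w powr p) \<le> (\<Sum>j. ennreal (if 2 powr real_of_int (int_decode j) < w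
    then 2 powr (p * (real_of_int (int_decode j) + 1)) else 0))"
proof (cases "w = 0")
  case True
  then have "ennreal (w powr p) = 0" by simp
  then show ?thesis by (simp only: zero_le)
next
  case False
  then have w: "0 < w" using assms by simp
  define k where "k = \<lceil>log 2 w\<rceil> - 1"
  have k: "real_of_int k < log 2 w" "log 2 w \<le> real_of_int k + 1"
    unfolding k_def by linarith+
  have less: "2 powr real_of_int k < w" using k w by (simp add: less_log_iff)
  have "w \<le> 2 powr (real_of_int k + 1)" using k w by (simp add: log_le_iff)
  then have "w powr p \<le> (2 powr (real_of_int k + 1)) powr p"
    using assms by (intro powr_mono2) auto
  then have "w powr p \<le> 2 powr (p * (real_of_int k + 1))" by (simp add: powr_powr mult.commute)
  define f where "f j = ennreal (if 2 powr real_of_int (int_decode j) < w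
    then 2 powr (p * (real_of_int (int_decode j) + 1)) else 0)" for j
  have "ennreal (w powr p) \<le> f (int_encode k)"
    using less \<open>w powr p \<le> 2 powr (p * (real_of_int k + 1))\<close> by (simp add: f_def ennreal_leI)
  also have "\<dots> \<le> (\<Sum>j. f j)"
    using sum_le_suminf[of f "{int_encode k}"] by simp
  finally show ?thesis by (simp only: f_def)
qed

text \<open>The part of F up to \<theta>/2 contributes at most \<theta>/2 to every average, so the
  part above has to supply the other half when the maximal function exceeds \<theta>. The weak type
  bound at level \<theta>/2 gives the factor 2.\<close>

lemma hl_maximal_truncation:
  fixes F :: "real^'n \<Rightarrow> real"
  assumes F: "F \<in> borel_measurable lebesgue" "\<And>x. 0 \<le> F x" and \<theta>: "0 < \<theta>"
    and fin: "(\<integral>\<^sup>+x. ennreal (F x) * indicator {x. \<theta> / 2 < F x} x \<partial>lebesgue) < \<infinity>"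
  shows "emeasure lebesgue {x. ennreal \<theta> < hl_maximal (\<lambda>x. ennreal (F x)) x} \<le>
     ennreal (5 ^ CARD('n) * 2 / \<theta>) * (\<integral>\<^sup>+x. ennreal (F x) * indicator {x. \<theta> / 2 < F x} x \<partial>lebesgue)"
proof -
  define G where "G x = ennreal (F x) * indicator {x. \<theta> / 2 < F x} x" for x
  have G: "G \<in> borel_measurable lebesgue"
    unfolding G_def using F by measurable
  have avg: "ball_average (\<lambda>x. ennreal (F x)) a \<rho> \<le> ennreal (\<theta> / 2) + ball_average G a \<rho>" if "0 < \<rho>" for a \<rho>
  proof -
    have E: "emeasure lebesgue (ball a \<rho>) \<noteq> 0" "emeasure lebesgue (ball a \<rho>) \<noteq> top"
      using that emeasure_ball_lebesgue[of \<rho> a] unit_ball_vol_pos[of "real CARD('n)"]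
      by (simp_all del: emeasure_completion unit_ball_vol_pos add: ennreal_eq_0_iff mult_le_0_iff not_le)
    have "(\<integral>\<^sup>+y\<in>ball a \<rho>. ennreal (F y) \<partial>lebesgue)
        \<le> (\<integral>\<^sup>+y. ennreal (\<theta> / 2) * indicator (ball a \<rho>) y + G y * indicator (ball a \<rho>) y \<partial>lebesgue)"
      using \<theta> by (intro nn_integral_mono) (auto simp: G_def indicator_def intro!: ennreal_leI)
    also have "\<dots> = ennreal (\<theta> / 2) * emeasure lebesgue (ball a \<rho>) + (\<integral>\<^sup>+y\<in>ball a \<rho>. G y \<partial>lebesgue)"
      using G by (subst nn_integral_add)
        (auto simp: nn_integral_cmult_indicator intro!: borel_measurable_times_ennreal borel_measurable_indicator)
    finally show ?thesis
      unfolding ball_average_def using E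
      by (simp add: add_divide_distrib_ennreal divide_right_mono_ennreal ennreal_mult_divide_eq order_trans[OF divide_right_mono_ennreal])
  qed
  have le: "hl_maximal (\<lambda>x. ennreal (F x)) x \<le> ennreal (\<theta> / 2) + hl_maximal G x" for x
    unfolding hl_maximal_def[of "\<lambda>x. ennreal (F x)"]
    by (intro SUP_least) (auto intro!: order_trans[OF avg] add_left_mono ball_average_le_hl_maximal)
  have half: "ennreal (\<theta> / 2) + z \<le> ennreal \<theta>" if "z \<le> ennreal (\<theta> / 2)" for z
  proof -
    have "ennreal (\<theta> / 2) + z \<le> ennreal (\<theta> / 2) + ennreal (\<theta> / 2)" by (intro add_left_mono that)
    also have "\<dots> = ennreal \<theta>" using \<theta> by (subst ennreal_plus[symmetric]) auto
    finally show ?thesis .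
  qed
  have "{x. ennreal \<theta> < hl_maximal (\<lambda>x. ennreal (F x)) x} \<subseteq> {x. ennreal (\<theta> / 2) < hl_maximal G x}"
  proof (rule Collect_mono, rule impI, rule ccontr)
    fix x assume less: "ennreal \<theta> < hl_maximal (\<lambda>x. ennreal (F x)) x" and "\<not> ennreal (\<theta> / 2) < hl_maximal G x"
    then have "hl_maximal G x \<le> ennreal (\<theta> / 2)" by (simp add: not_less)
    then have "hl_maximal (\<lambda>x. ennreal (F x)) x \<le> ennreal \<theta>"
      by (rule order_trans[OF le half])
    then show False using less by simp
  qed
  then have "emeasure lebesgue {x. ennreal \<theta> < hl_maximal (\<lambda>x. ennreal (F x)) x}
      \<le> emeasure lebesgue {x. ennreal (\<theta> / 2) < hl_maximal G x}"
    by (rule emeasure_mono) (rule hl_maximal_superlevel_sets)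
  also have "\<dots> \<le> ennreal (5 ^ CARD('n) / (\<theta> / 2)) * (\<integral>\<^sup>+x. G x \<partial>lebesgue)"
    using fin \<theta> G by (intro hl_maximal_weak_type) (auto simp: G_def)
  finally show ?thesis by (simp add: G_def)
qed

text \<open>Marcinkiewicz interpolation over dyadic levels. The constant collects 2^p from rounding
  up to a level, 2 times 5^n from the truncated weak type bound, and 2^(p-1) / (1 - 2^(1-p)) from
  summing the levels below 2 F(x). Finiteness almost everywhere is stated separately because
  \<open>enn2real\<close> turns \<infinity> into 0.\<close>

lemma hl_maximal_strong_type:
  fixes F :: "real^'n \<Rightarrow> real"
  assumes p: "1 < p" and F: "F \<in> borel_measurable lebesgue" "\<And>x. 0 \<le> F x"
    and fin: "(\<integral>\<^sup>+x. ennreal (F x powr p) \<partial>lebesgue) < \<infinity>"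
  shows "AE x in lebesgue. hl_maximal (\<lambda>x. ennreal (F x)) x < \<infinity>"
    and "(\<integral>\<^sup>+x. ennreal (enn2real (hl_maximal (\<lambda>x. ennreal (F x)) x) powr p) \<partial>lebesgue) \<le>
      ennreal (5 ^ CARD('n) * 4 powr p / (1 - 2 powr (1 - p))) * (\<integral>\<^sup>+x. ennreal (F x powr p) \<partial>lebesgue)"
proof -
  define J where "J = (\<integral>\<^sup>+x. ennreal (F x powr p) \<partial>lebesgue)"
  define M where "M = hl_maximal (\<lambda>x. ennreal (F x))"
  have M[measurable]: "M \<in> borel_measurable lebesgue" unfolding M_def by (rule hl_maximal_measurable)
  note F(1)[measurable]
  have superlevel: "{x. t < M x} \<in> sets lebesgue" for t :: ennreal
    using measurable_sets[OF M, of "{t<..}"] by (simp add: vimage_def)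
  define T where "T \<theta> = (\<integral>\<^sup>+x. ennreal (F x) * indicator {x. \<theta> / 2 < F x} x \<partial>lebesgue)" for \<theta> :: real
  \<comment> \<open>F itself need not be integrable, only F^p is. Above the level \<theta>/2 the
    negative power F^(1-p) is bounded, which makes the truncation integrable.\<close>
  have T: "T \<theta> \<le> ennreal ((\<theta> / 2) powr (1 - p)) * J" if "0 < \<theta>" for \<theta>
  proof -
    have "T \<theta> \<le> (\<integral>\<^sup>+x. ennreal ((\<theta> / 2) powr (1 - p)) * ennreal (F x powr p) \<partial>lebesgue)"
      unfolding T_def
    proof (intro nn_integral_mono)
      fix x
      have "F x \<le> (\<theta> / 2) powr (1 - p) * F x powr p" if "\<theta> / 2 < F x"
      proof -
        have pos: "0 < F x" using that \<open>0 < \<theta>\<close> by simp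
        have "F x powr (1 - p) \<le> (\<theta> / 2) powr (1 - p)"
          using that \<open>0 < \<theta>\<close> p by (intro powr_mono2') auto
        then have "F x powr (1 - p) * F x powr p \<le> (\<theta> / 2) powr (1 - p) * F x powr p"
          by (intro mult_right_mono) auto
        then show ?thesis using pos by (simp add: powr_add[symmetric])
      qed
      then show "ennreal (F x) * indicator {x. \<theta> / 2 < F x} x \<le> ennreal ((\<theta> / 2) powr (1 - p)) * ennreal (F x powr p)"
        by (auto simp: indicator_def ennreal_mult[symmetric] intro!: ennreal_leI)
    qed
    also have "\<dots> = ennreal ((\<theta> / 2) powr (1 - p)) * J"
      unfolding J_def by (intro nn_integral_cmult) measurable
    finally show ?thesis .
  qed
  have Tfin: "T \<theta> < \<infinity>" if "0 < \<theta>" for \<theta>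
    using T[OF that] fin unfolding J_def by (auto simp: ennreal_mult_less_top elim!: le_less_trans)
  have level: "emeasure lebesgue {x. ennreal \<theta> < M x} \<le> ennreal (5 ^ CARD('n) * 2 / \<theta>) * T \<theta>" if "0 < \<theta>" for \<theta>
    unfolding M_def T_def using F that Tfin[OF that] by (intro hl_maximal_truncation) (auto simp: T_def)
  define j where "j = enn2real J"
  have j: "J = ennreal j" "0 \<le> j" using fin by (auto simp: j_def J_def less_top)
  show "AE x in lebesgue. hl_maximal (\<lambda>x. ennreal (F x)) x < \<infinity>"
  proof -
    have le: "emeasure lebesgue {x. M x = \<infinity>} \<le> ennreal (5 ^ CARD('n) * 2 * j * inverse (real (Suc N)))" for N
    proof -
      \<comment> \<open>With \<theta>/2 \<ge> 1 the factor (\<theta>/2)^(1-p) is at most 1, so the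
        measure of the superlevel set decays like 1/\<theta>.\<close>
      define \<theta> where "\<theta> = 2 * real (Suc N)"
      have \<theta>: "0 < \<theta>" "2 \<le> \<theta>" by (auto simp: \<theta>_def)
      have "emeasure lebesgue {x. M x = \<infinity>} \<le> emeasure lebesgue {x. ennreal \<theta> < M x}"
        using superlevel by (intro emeasure_mono) auto
      also have "\<dots> \<le> ennreal (5 ^ CARD('n) * 2 / \<theta>) * (ennreal ((\<theta> / 2) powr (1 - p)) * J)"
        by (intro order_trans[OF level] mult_left_mono T \<theta>) auto
      also have "\<dots> \<le> ennreal (5 ^ CARD('n) * 2 / \<theta>) * (ennreal 1 * J)"
        using \<theta> p powr_mono[of "1 - p" 0 "\<theta> / 2"] by (intro mult_left_mono mult_right_mono ennreal_leI) auto
      also have "\<dots> = ennreal (5 ^ CARD('n) * 2 / \<theta> * j)"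
        using j \<theta> by (simp add: ennreal_mult[symmetric])
      also have "\<dots> \<le> ennreal (5 ^ CARD('n) * 2 * j * inverse (real (Suc N)))"
        using j by (intro ennreal_leI) (simp add: \<theta>_def field_simps)
      finally show ?thesis .
    qed
    have "(\<lambda>N. ennreal (5 ^ CARD('n) * 2 * j * inverse (real (Suc N)))) \<longlonglongrightarrow> ennreal (5 ^ CARD('n) * 2 * j * 0)"
      by (intro tendsto_ennrealI tendsto_mult tendsto_const LIMSEQ_inverse_real_of_nat)
    then have "emeasure lebesgue {x. M x = \<infinity>} \<le> 0"
      using le by (intro LIMSEQ_le_const) auto
    moreover have "{x. M x = \<infinity>} \<in> sets lebesgue"
      using measurable_sets[OF M, of "{\<infinity>}"] by (simp add: vimage_def)
    ultimately have "{x. M x = \<infinity>} \<in> null_sets lebesgue"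
      by (auto simp: null_sets_def)
    then show ?thesis
      by (rule AE_I') (auto simp: M_def less_top[symmetric])
  qed
  define \<theta> where "\<theta> i = 2 powr real_of_int (int_decode i)" for i
  have \<theta>: "0 < \<theta> i" for i by (simp add: \<theta>_def)
  have pw: "2 powr (p * (real_of_int (int_decode i) + 1)) = 2 powr p * \<theta> i powr p" for i
    by (simp add: \<theta>_def powr_powr powr_add[symmetric] algebra_simps)
  have "(\<integral>\<^sup>+x. ennreal (enn2real (M x) powr p) \<partial>lebesgue)
      \<le> (\<integral>\<^sup>+x. (\<Sum>i. ennreal (2 powr p * \<theta> i powr p) * indicator {x. ennreal (\<theta> i) < M x} x) \<partial>lebesgue)"
  proof (intro nn_integral_mono)
    fix x
    have "ennreal (enn2real (M x) powr p) \<le> (\<Sum>i. ennreal (if \<theta> i < enn2real (M x) then 2 powr p * \<theta> i powr p else 0))"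
    proof -
      have "0 \<le> enn2real (M x)" "0 < p" using p by auto
      from powr_le_suminf_dyadic[OF this] show ?thesis by (simp only: pw \<theta>_def)
    qed
    also have "\<dots> \<le> (\<Sum>i. ennreal (2 powr p * \<theta> i powr p) * indicator {x. ennreal (\<theta> i) < M x} x)"
    proof (intro suminf_le)
      fix i
      have "ennreal (\<theta> i) < M x" if "\<theta> i < enn2real (M x)"
        using that \<theta>[of i] by (cases "M x") (auto simp: ennreal_less_iff)
      then show "ennreal (if \<theta> i < enn2real (M x) then 2 powr p * \<theta> i powr p else 0)
          \<le> ennreal (2 powr p * \<theta> i powr p) * indicator {x. ennreal (\<theta> i) < M x} x"
        by auto
    qed auto
    finally show "ennreal (enn2real (M x) powr p) \<le> (\<Sum>i. ennreal (2 powr p * \<theta> i powr p) * indicator {x. ennreal (\<theta> i) < M x} x)" .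
  qed
  also have "\<dots> = (\<Sum>i. ennreal (2 powr p * \<theta> i powr p) * emeasure lebesgue {x. ennreal (\<theta> i) < M x})"
    using superlevel by (subst nn_integral_suminf) (auto simp: nn_integral_cmult_indicator)
  also have "\<dots> \<le> (\<Sum>i. \<integral>\<^sup>+x. ennreal (5 ^ CARD('n) * 2 * 2 powr p) * (ennreal (F x) *
      ennreal (if \<theta> i < 2 * F x then 2 powr ((p - 1) * real_of_int (int_decode i)) else 0)) \<partial>lebesgue)"
  proof (intro suminf_le)
    fix i
    define c where "c = 5 ^ CARD('n) * 2 * 2 powr p * \<theta> i powr (p - 1)"
    have c: "2 powr p * \<theta> i powr p * (5 ^ CARD('n) * 2 / \<theta> i) = c"
      using \<theta>[of i] by (simp add: c_def powr_diff)
    have "ennreal (2 powr p * \<theta> i powr p) * emeasure lebesgue {x. ennreal (\<theta> i) < M x}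
        \<le> ennreal (2 powr p * \<theta> i powr p) * (ennreal (5 ^ CARD('n) * 2 / \<theta> i) * T (\<theta> i))"
      by (intro mult_left_mono level \<theta>) auto
    also have "\<dots> = ennreal c * T (\<theta> i)"
    proof -
      have "ennreal (2 powr p * \<theta> i powr p) * ennreal (5 ^ CARD('n) * 2 / \<theta> i) = ennreal c"
        using \<theta>[of i] by (subst ennreal_mult[symmetric]) (auto simp only: c, auto)
      then show ?thesis by (simp only: mult.assoc[symmetric])
    qed
    also have "\<dots> = (\<integral>\<^sup>+x. ennreal c * (ennreal (F x) * indicator {x. \<theta> i / 2 < F x} x) \<partial>lebesgue)"
      unfolding T_def by (intro nn_integral_cmult[symmetric]) measurable
    also have "\<dots> = (\<integral>\<^sup>+x. ennreal (5 ^ CARD('n) * 2 * 2 powr p) * (ennreal (F x) *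
      ennreal (if \<theta> i < 2 * F x then 2 powr ((p - 1) * real_of_int (int_decode i)) else 0)) \<partial>lebesgue)"
      by (intro nn_integral_cong)
        (auto simp: indicator_def c_def ennreal_mult[symmetric] F \<theta>_def powr_powr mult_ac)
    finally show "ennreal (2 powr p * \<theta> i powr p) * emeasure lebesgue {x. ennreal (\<theta> i) < M x}
        \<le> (\<integral>\<^sup>+x. ennreal (5 ^ CARD('n) * 2 * 2 powr p) * (ennreal (F x) *
      ennreal (if \<theta> i < 2 * F x then 2 powr ((p - 1) * real_of_int (int_decode i)) else 0)) \<partial>lebesgue)" .
  qed auto
  \<comment> \<open>After exchanging sum and integral only the levels below 2 F(x) remain at each x;
    \<open>suminf_dyadic_le\<close> sums them with exponent p - 1.\<close>
  also have "\<dots> = (\<integral>\<^sup>+x. (\<Sum>i. ennreal (5 ^ CARD('n) * 2 * 2 powr p) * (ennreal (F x) *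
      ennreal (if \<theta> i < 2 * F x then 2 powr ((p - 1) * real_of_int (int_decode i)) else 0))) \<partial>lebesgue)"
    by (intro nn_integral_suminf[symmetric]) measurable
  also have "\<dots> \<le> (\<integral>\<^sup>+x. ennreal (5 ^ CARD('n) * 4 powr p / (1 - 2 powr (1 - p))) * ennreal (F x powr p) \<partial>lebesgue)"
  proof (intro nn_integral_mono)
    fix x
    have q: "0 < 1 - 2 powr (1 - p)" using p by (simp add: powr_less_one)
    have "(\<Sum>i. ennreal (5 ^ CARD('n) * 2 * 2 powr p) * (ennreal (F x) *
      ennreal (if \<theta> i < 2 * F x then 2 powr ((p - 1) * real_of_int (int_decode i)) else 0)))
      = ennreal (5 ^ CARD('n) * 2 * 2 powr p) * (ennreal (F x) *
        (\<Sum>i. ennreal (if \<theta> i < 2 * F x then 2 powr ((p - 1) * real_of_int (int_decode i)) else 0)))"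
      by simp
    also have "\<dots> \<le> ennreal (5 ^ CARD('n) * 2 * 2 powr p) * (ennreal (F x) *
        ennreal ((2 * F x) powr (p - 1) / (1 - 2 powr - (p - 1))))"
      using p F unfolding \<theta>_def by (intro mult_left_mono suminf_dyadic_le) auto
    also have "\<dots> = ennreal (5 ^ CARD('n) * 4 powr p / (1 - 2 powr (1 - p)) * F x powr p)"
    proof (cases "F x = 0")
      case False
      then have "0 < F x" using F(2)[of x] by simp
      have "(4::real) powr p = 2 powr p * 2 powr p" using powr_mult[of 2 2 p] by simp
      then have "5 ^ CARD('n) * 2 * 2 powr p * (F x * ((2 * F x) powr (p - 1) / (1 - 2 powr - (p - 1)))) =
         5 ^ CARD('n) * 4 powr p / (1 - 2 powr (1 - p)) * F x powr p"
      proof -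
        have e: "- (p - 1) = 1 - p" by simp
        have "(2 * F x) powr (p - 1) = 2 powr p * F x powr p / (2 * F x)"
          using \<open>0 < F x\<close> by (simp add: powr_mult powr_diff)
        then have "F x * ((2 * F x) powr (p - 1)) = 2 powr p * F x powr p / 2"
          using \<open>0 < F x\<close> by simp
        then have "5 ^ CARD('n) * 2 * 2 powr p * (F x * ((2 * F x) powr (p - 1))) / c =
            5 ^ CARD('n) * (2 powr p * 2 powr p) * F x powr p / c" for c
          by simp
        from this[of "1 - 2 powr (1 - p)"] show ?thesis
          unfolding \<open>4 powr p = 2 powr p * 2 powr p\<close> e by (simp only: times_divide_eq_right times_divide_eq_left)
      qed
      then show ?thesis using \<open>0 < F x\<close> q by (simp add: ennreal_mult[symmetric])
    qed simp
    also have "\<dots> = ennreal (5 ^ CARD('n) * 4 powr p / (1 - 2 powr (1 - p))) * ennreal (F x powr p)"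
      using q by (intro ennreal_mult) auto
    finally show "(\<Sum>i. ennreal (5 ^ CARD('n) * 2 * 2 powr p) * (ennreal (F x) *
      ennreal (if \<theta> i < 2 * F x then 2 powr ((p - 1) * real_of_int (int_decode i)) else 0)))
      \<le> ennreal (5 ^ CARD('n) * 4 powr p / (1 - 2 powr (1 - p))) * ennreal (F x powr p)" .
  qed
  also have "\<dots> = ennreal (5 ^ CARD('n) * 4 powr p / (1 - 2 powr (1 - p))) * (\<integral>\<^sup>+x. ennreal (F x powr p) \<partial>lebesgue)"
    by (intro nn_integral_cmult) measurable
  finally show "(\<integral>\<^sup>+x. ennreal (enn2real (hl_maximal (\<lambda>x. ennreal (F x)) x) powr p) \<partial>lebesgue) \<le>
      ennreal (5 ^ CARD('n) * 4 powr p / (1 - 2 powr (1 - p))) * (\<integral>\<^sup>+x. ennreal (F x powr p) \<partial>lebesgue)"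
    by (simp add: M_def)
qed

subsection \<open>Averages under a modular bound\<close>

lemma decay_measurable_lebesgue [measurable]: "decay \<in> borel_measurable lebesgue"
  by (intro measurable_completion) simp

text \<open>The aim in each use is a \<open>\<mu>\<close> of small integral over \<open>S\<close>
  for which the weight \<mu>^(1-s) stays below one constant \<open>c\<close> on
  \<open>S\<close>.\<close>

lemma nn_integral_le_powr:
  fixes f \<mu> s :: "real^'n \<Rightarrow> real"
  assumes S: "S \<in> sets lebesgue"
    and meas: "f \<in> borel_measurable lebesgue" "\<mu> \<in> borel_measurable lebesgue" "s \<in> borel_measurable lebesgue"
    and f: "\<And>y. 0 \<le> f y" and \<mu>: "\<And>y. 0 < \<mu> y" and s: "\<And>y. 1 \<le> s y"
    and c: "0 \<le> c" "\<And>y. y \<in> S \<Longrightarrow> \<mu> y powr (1 - s y) \<le> c"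
  shows "(\<integral>\<^sup>+y\<in>S. ennreal (f y) \<partial>lebesgue) \<le>
    (\<integral>\<^sup>+y\<in>S. ennreal (\<mu> y) \<partial>lebesgue) + ennreal c * (\<integral>\<^sup>+y\<in>S. ennreal (f y powr s y) \<partial>lebesgue)"
proof -
  note meas[measurable] S[measurable]
  have "(\<integral>\<^sup>+y\<in>S. ennreal (f y) \<partial>lebesgue) \<le>
      (\<integral>\<^sup>+y. ennreal (\<mu> y) * indicator S y + ennreal c * (ennreal (f y powr s y) * indicator S y) \<partial>lebesgue)"
  proof (intro nn_integral_mono)
    fix y
    have "f y \<le> \<mu> y + c * f y powr s y" if "y \<in> S"
      using le_plus_powr[OF f \<mu> s, of y y y] mult_right_mono[OF c(2)[OF that], of "f y powr s y"] by simp
    then show "ennreal (f y) * indicator S y \<le>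
        ennreal (\<mu> y) * indicator S y + ennreal c * (ennreal (f y powr s y) * indicator S y)"
      using c(1) \<mu>[of y] by (auto simp: indicator_def ennreal_mult[symmetric] ennreal_plus[symmetric] less_imp_le
        simp del: ennreal_plus intro!: ennreal_leI)
  qed
  also have "\<dots> = (\<integral>\<^sup>+y\<in>S. ennreal (\<mu> y) \<partial>lebesgue) + ennreal c * (\<integral>\<^sup>+y\<in>S. ennreal (f y powr s y) \<partial>lebesgue)"
    by (subst nn_integral_add) (auto simp: nn_integral_cmult)
  finally show ?thesis .
qed

lemma log_hoelder_with_tendsto:
  fixes s :: "real^'n \<Rightarrow> real"
  assumes s: "log_hoelder_with C sinf s"
  shows "(s \<longlongrightarrow> sinf) at_infinity"
proof -
  have lim: "((\<lambda>x::real^'n. C / ln (exp 1 + norm x)) \<longlongrightarrow> 0) at_infinity"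
  proof (rule real_tendsto_divide_at_top[OF tendsto_const])
    have "filterlim (\<lambda>x::real^'n. exp 1 + norm x) at_top at_infinity"
      by (intro filterlim_tendsto_add_at_top[OF tendsto_const] filterlim_norm_at_top)
    then show "filterlim (\<lambda>x::real^'n. ln (exp 1 + norm x)) at_top at_infinity"
      by (rule filterlim_compose[OF ln_at_top])
  qed
  have "((\<lambda>x. s x - sinf) \<longlongrightarrow> 0) at_infinity"
    using s by (intro Lim_null_comparison[OF _ lim]) (auto simp: log_hoelder_with_def)
  then show ?thesis by (rule Lim_null[THEN iffD2])
qed

lemma log_hoelder_with_infinity_ge:
  fixes s :: "real^'n \<Rightarrow> real"
  assumes "log_hoelder_with C sinf s" "\<And>x. c \<le> s x"
  shows "c \<le> sinf"
  using log_hoelder_with_tendsto[OF assms(1)] assms(2)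
  by (intro tendsto_lowerbound[of s sinf at_infinity]) (auto simp: trivial_limit_at_infinity)

text \<open>Raising t to at least \<open>decay y\<close> puts it in the range where s(y) may be
  exchanged for \<open>sinf\<close>. Since 1 - sinf \<le> 0, the maximum can afterwards be replaced
  by t again.\<close>

lemma max_decay_powr_le:
  fixes s :: "real^'n \<Rightarrow> real"
  assumes s: "log_hoelder_with C sinf s" and sinf: "1 \<le> sinf" and t: "0 < t" "t \<le> 1"
  shows "max t (decay y) powr (1 - s y) \<le> exp ((real CARD('n) + 1) * C) * t powr (1 - sinf)"
proof -
  let ?m = "max t (decay y)"
  have m: "decay y \<le> ?m" "?m \<le> 1" "0 < ?m" using t decay_le_1[of y] by auto
  have "?m powr (1 - s y) \<le> exp ((real CARD('n) + 1) * C) * ?m powr (1 - sinf)"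
    using decay_powr_change[OF s m(1,2)] m by (intro powr_le_exp_mult_powr) (simp_all add: abs_minus_commute)
  also have "\<dots> \<le> exp ((real CARD('n) + 1) * C) * t powr (1 - sinf)"
    using t sinf by (intro mult_left_mono powr_mono2') auto
  finally show ?thesis .
qed

text \<open>The substitute for the Hoelder bound |S|^(1-1/s) under a unit modular. The weight
  \<rho>^(-n/s(x)) balances the two terms of \<open>nn_integral_le_powr\<close>: both become
  multiples of \<rho>^(n-n/s(x)) once s(y) is exchanged for s(x) at the cost of an exponential
  factor.\<close>

lemma nn_integral_unit_modular_small:
  fixes s f :: "real^'n \<Rightarrow> real"
  assumes s: "log_hoelder_with C sinf s" "s \<in> borel_measurable lebesgue" "\<And>y. 1 \<le> s y"
    and f: "f \<in> borel_measurable lebesgue" "\<And>y. 0 \<le> f y"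
    and S: "S \<in> sets lebesgue" "\<And>y. y \<in> S \<Longrightarrow> norm (x - y) \<le> \<kappa> * \<rho>" "emeasure lebesgue S \<le> ennreal (\<kappa> * \<rho> ^ CARD('n))"
    and \<kappa>: "1 \<le> \<kappa>" and \<rho>: "0 < \<rho>" "\<rho> \<le> 1"
    and mod: "(\<integral>\<^sup>+y\<in>S. ennreal (f y powr s y) \<partial>lebesgue) \<le> 1"
  shows "(\<integral>\<^sup>+y\<in>S. ennreal (f y) \<partial>lebesgue) \<le>
    ennreal ((\<kappa> + exp (real CARD('n) * (C * (1 + ln \<kappa>)))) * \<rho> powr (real CARD('n) - real CARD('n) / s x))"
proof -
  define n where "n = real CARD('n)"
  have n: "0 < n" by (simp add: n_def)
  define E where "E = exp (n * (C * (1 + ln \<kappa>)))"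
  define \<mu> where "\<mu> = \<rho> powr (- n / s x)"
  have sx: "1 \<le> s x" using s(3) .
  have \<mu>: "0 < \<mu>" using \<rho> by (simp add: \<mu>_def)
  define R where "R = \<rho> powr (n - n / s x)"
  have R: "R = \<rho> ^ CARD('n) * \<mu>" using \<rho> by (simp add: R_def \<mu>_def powr_add[symmetric] powr_realpow[symmetric] n_def)
  have c: "\<mu> powr (1 - s y) \<le> E * R" if "y \<in> S" for y
  proof -
    have "\<bar>n / s x * (s y - 1) - (n - n / s x)\<bar> = \<bar>s x - s y\<bar> * (n / s x)"
    proof -
      have "n / s x * (s y - 1) - (n - n / s x) = (s y - s x) * (n / s x)"
        using sx by (simp add: field_simps)
      then show ?thesis using n sx by (simp add: abs_mult abs_minus_commute)
    qed
    moreover have "\<bar>ln \<rho>\<bar> = ln (1 / \<rho>)" using \<rho> by (simp add: ln_div)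
    ultimately have "\<bar>n / s x * (s y - 1) - (n - n / s x)\<bar> * \<bar>ln \<rho>\<bar> = (\<bar>s x - s y\<bar> * ln (1 / \<rho>)) * (n / s x)"
      by simp
    also have "\<dots> \<le> (C * (1 + ln \<kappa>)) * (n / 1)"
    proof (rule mult_mono[OF log_hoelder_with_local[OF s(1) \<rho> \<kappa> S(2)[OF that]]])
      show "n / s x \<le> n / 1" using n sx by (intro divide_left_mono) auto
      show "0 \<le> C * (1 + ln \<kappa>)" using s(1) \<kappa> by (simp add: log_hoelder_with_def)
    qed (use n sx in auto)
    also have "\<dots> = n * (C * (1 + ln \<kappa>))" by simp
    finally have "\<rho> powr (n / s x * (s y - 1)) \<le> E * \<rho> powr (n - n / s x)"
      unfolding E_def using \<rho> by (intro powr_le_exp_mult_powr) auto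
    moreover have "- n / s x * (1 - s y) = n / s x * (s y - 1)" using sx by (simp add: field_simps)
    ultimately show ?thesis
      by (simp only: \<mu>_def R_def powr_powr)
  qed
  have "(\<integral>\<^sup>+y\<in>S. ennreal (f y) \<partial>lebesgue) \<le>
     (\<integral>\<^sup>+y\<in>S. ennreal \<mu> \<partial>lebesgue) + ennreal (E * R) * (\<integral>\<^sup>+y\<in>S. ennreal (f y powr s y) \<partial>lebesgue)"
    by (rule nn_integral_le_powr) (use S f s \<mu> c in \<open>auto simp: E_def R_def\<close>)
  also have "\<dots> \<le> ennreal \<mu> * ennreal (\<kappa> * \<rho> ^ CARD('n)) + ennreal (E * R) * 1"
    using S mod by (intro add_mono mult_left_mono) (auto simp: nn_integral_cmult_indicator intro!: mult_left_mono)
  also have "\<dots> = ennreal ((\<kappa> + E) * R)"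
    using \<mu> \<kappa> \<rho> by (simp add: R E_def ennreal_mult[symmetric] ennreal_plus[symmetric] algebra_simps del: ennreal_plus)
  finally show ?thesis by (simp add: E_def R_def n_def)
qed

text \<open>On scales beyond 1 the balancing weight uses the exponent at infinity, and it is raised
  to \<open>decay y\<close> where it would be too small for the exchange of exponents. The extra
  mass \<open>K\<close> is absorbed because \<rho>^(n-n/sinf) \<ge> 1.\<close>

lemma nn_integral_unit_modular_large:
  fixes s f :: "real^'n \<Rightarrow> real"
  assumes s: "log_hoelder_with C sinf s" "s \<in> borel_measurable lebesgue" "\<And>y. 1 \<le> s y"
    and f: "f \<in> borel_measurable lebesgue" "\<And>y. 0 \<le> f y"
    and S: "S \<in> sets lebesgue" "emeasure lebesgue S \<le> ennreal (\<kappa> * \<rho> ^ CARD('n))"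
    and \<kappa>: "1 \<le> \<kappa>" and \<rho>: "1 \<le> \<rho>"
    and K: "(\<integral>\<^sup>+y. ennreal (decay (y::real^'n)) \<partial>lebesgue) \<le> ennreal K" "0 \<le> K"
    and mod: "(\<integral>\<^sup>+y\<in>S. ennreal (f y powr s y) \<partial>lebesgue) \<le> 1"
  shows "(\<integral>\<^sup>+y\<in>S. ennreal (f y) \<partial>lebesgue) \<le>
    ennreal ((\<kappa> + K + exp ((real CARD('n) + 1) * C)) * \<rho> powr (real CARD('n) - real CARD('n) / sinf))"
proof -
  define n where "n = real CARD('n)"
  have n: "0 < n" by (simp add: n_def)
  have sinf: "1 \<le> sinf" using log_hoelder_with_infinity_ge[OF s(1,3)] .
  define E where "E = exp ((n + 1) * C)"
  define t where "t = \<rho> powr (- n / sinf)"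
  have t: "0 < t" "t \<le> 1" using \<rho> sinf n powr_mono[of "- n / sinf" 0 \<rho>] by (auto simp: t_def)
  define R where "R = \<rho> powr (n - n / sinf)"
  have R: "R = \<rho> ^ CARD('n) * t" using \<rho> by (simp add: R_def t_def powr_add[symmetric] powr_realpow[symmetric] n_def)
  have "n / sinf \<le> n / 1" using sinf n by (intro divide_left_mono) auto
  then have R1: "1 \<le> R" using \<rho> unfolding R_def by (intro ge_one_powr_ge_zero) auto
  have tR: "t powr (1 - sinf) = R"
  proof -
    have "- n / sinf * (1 - sinf) = n - n / sinf" using sinf by (simp add: field_simps)
    then show ?thesis by (simp add: t_def R_def powr_powr)
  qed
  have "(\<integral>\<^sup>+y\<in>S. ennreal (f y) \<partial>lebesgue) \<le>
     (\<integral>\<^sup>+y\<in>S. ennreal (max t (decay y)) \<partial>lebesgue) + ennreal (E * R) * (\<integral>\<^sup>+y\<in>S. ennreal (f y powr s y) \<partial>lebesgue)"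
  proof (rule nn_integral_le_powr)
    show "(\<lambda>y::real^'n. max t (decay y)) \<in> borel_measurable lebesgue"
      by (intro measurable_completion) simp
    show "max t (decay y) powr (1 - s y) \<le> E * R" for y
      using max_decay_powr_le[OF s(1) sinf t, of y] by (simp add: tR E_def n_def)
  qed (use S f s t in \<open>auto simp: E_def R_def less_max_iff_disj\<close>)
  also have "(\<integral>\<^sup>+y\<in>S. ennreal (max t (decay y)) \<partial>lebesgue) \<le> ennreal t * ennreal (\<kappa> * \<rho> ^ CARD('n)) + ennreal K"
  proof -
    have "(\<integral>\<^sup>+y\<in>S. ennreal (max t (decay y)) \<partial>lebesgue) \<le> (\<integral>\<^sup>+y. ennreal t * indicator S y + ennreal (decay y) \<partial>lebesgue)"
      using t less_imp_le[OF decay_pos] by (intro nn_integral_mono)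
       (auto simp: indicator_def max_def add_increasing add_increasing2)
    also have "\<dots> = ennreal t * emeasure lebesgue S + (\<integral>\<^sup>+y. ennreal (decay (y::real^'n)) \<partial>lebesgue)"
      using S by (subst nn_integral_add) (auto simp: nn_integral_cmult_indicator)
    also have "\<dots> \<le> ennreal t * ennreal (\<kappa> * \<rho> ^ CARD('n)) + ennreal K"
      using S K by (intro add_mono mult_left_mono) auto
    finally show ?thesis .
  qed
  also have "ennreal (E * R) * (\<integral>\<^sup>+y\<in>S. ennreal (f y powr s y) \<partial>lebesgue) \<le> ennreal (E * R) * 1"
    using mod by (intro mult_left_mono) auto
  also have "ennreal t * ennreal (\<kappa> * \<rho> ^ CARD('n)) + ennreal K + ennreal (E * R) * 1 = ennreal (\<kappa> * R + K + E * R)"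
    using t \<kappa> \<rho> K R1 by (simp add: R E_def ennreal_mult[symmetric] ennreal_plus[symmetric] algebra_simps del: ennreal_plus)
  also have "\<dots> \<le> ennreal ((\<kappa> + K + E) * R)"
    using mult_left_mono[OF R1 K(2)] by (intro ennreal_leI) (simp add: algebra_simps)
  finally show ?thesis by (simp add: E_def R_def n_def add_mono mult_left_mono)
qed

text \<open>A substitute for Jensen's inequality. The weight t = (A + decay x)^(1/s(x)) balances the
  two terms of \<open>nn_integral_le_powr\<close>. For t \<le> 1 the exponent moves from s(y) to
  \<open>sinf\<close> and on to s(x), whence the squared exponential. For t > 1 the a priori bound
  on \<open>A\<close>, which a unit modular provides, keeps ln t below a constant plus n ln
  (1/\<rho>), so that local continuity applies.\<close>

lemma ball_average_pointwise:
  fixes s f :: "real^'n \<Rightarrow> real" and a :: "real^'n"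
  assumes s: "log_hoelder_with C sinf s" "s \<in> borel_measurable lebesgue" "\<And>y. 1 \<le> s y" "\<And>y. s y \<le> \<sigma>"
    and f: "f \<in> borel_measurable lebesgue" "\<And>y. 0 \<le> f y"
    and \<rho>: "0 < \<rho>" and x: "x \<in> ball a \<rho>" and v: "v = unit_ball_vol (real CARD('n)) * \<rho> ^ CARD('n)"
    and avg: "(\<integral>\<^sup>+y\<in>ball a \<rho>. ennreal (f y powr s y + decay y) \<partial>lebesgue) \<le> ennreal (A * v)"
    and A: "0 \<le> A" "A \<le> k * (1 + 1 / \<rho> ^ CARD('n))" "0 \<le> k"
  shows "(\<integral>\<^sup>+y\<in>ball a \<rho>. ennreal (f y) \<partial>lebesgue) \<le>
     ennreal ((2 + exp ((real CARD('n) + 1) * C) ^ 2 + exp (\<sigma> * ln (2 * k + 1) + real CARD('n) * (C * (1 + ln 2)))) * v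
       * (A + decay x) powr (1 / s x))"
proof -
  define n where "n = real CARD('n)"
  have n: "0 < n" by (simp add: n_def)
  have C: "0 \<le> C" using s(1) by (simp add: log_hoelder_with_def)
  have sinf: "1 \<le> sinf" using log_hoelder_with_infinity_ge[OF s(1,3)] .
  define E where "E = exp ((n + 1) * C)"
  define E2 where "E2 = exp (\<sigma> * ln (2 * k + 1) + n * (C * (1 + ln 2)))"
  have E: "0 < E" "0 < E2" by (auto simp: E_def E2_def)
  have v_pos: "0 < v" using \<rho> v by simp
  define \<Lambda> where "\<Lambda> = A + decay x"
  define t where "t = \<Lambda> powr (1 / s x)"
  have sx: "1 \<le> s x" using s(3) .
  have \<Lambda>: "0 < \<Lambda>" using A decay_pos[of x] by (simp add: \<Lambda>_def)
  have t: "0 < t" using \<Lambda> by (simp add: t_def)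
  have ts: "t powr s x = \<Lambda>" using \<Lambda> sx by (simp add: t_def powr_powr)
  let ?B = "ball a \<rho>"
  have B: "?B \<in> sets lebesgue" by simp
  have vol: "emeasure lebesgue ?B = ennreal v" using emeasure_ball_lebesgue[of \<rho> a] \<rho> v by simp
  have f_le: "(\<integral>\<^sup>+y\<in>?B. ennreal (f y powr s y) \<partial>lebesgue) \<le> ennreal (A * v)"
    using less_imp_le[OF decay_pos]
    by (intro order_trans[OF nn_integral_mono avg]) (auto simp: indicator_def simp del: ennreal_plus intro!: ennreal_leI)
  have d_le: "(\<integral>\<^sup>+y\<in>?B. ennreal (decay y) \<partial>lebesgue) \<le> ennreal (A * v)"
    by (intro order_trans[OF nn_integral_mono avg]) (auto simp: indicator_def simp del: ennreal_plus intro!: ennreal_leI)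
  have A_le: "A \<le> \<Lambda>" using decay_pos[of x] by (simp add: \<Lambda>_def)
  have t1s: "t powr (1 - s x) * \<Lambda> = t" using t \<Lambda> ts by (simp add: powr_diff)
  show ?thesis
  proof (cases "t \<le> 1")
    case True
    have "\<Lambda> \<le> 1"
    proof (rule ccontr)
      assume "\<not> \<Lambda> \<le> 1"
      then have "1 < t" using sx by (simp add: t_def gr_one_powr)
      then show False using True by simp
    qed
    \<comment> \<open>A root of a number up to 1 is at least that number, so t dominates both
      \<open>A\<close> and \<open>decay x\<close>; the latter is what
      \<open>decay_powr_change\<close> asks for.\<close>
    then have \<Lambda>t: "\<Lambda> \<le> t" unfolding t_def
      using powr_mono'[of "1 / s x" 1 \<Lambda>] \<Lambda> sx by simp
    then have dt: "decay x \<le> t" using A by (simp add: \<Lambda>_def)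
    have c: "max t (decay y) powr (1 - s y) \<le> E * (E * t powr (1 - s x))" for y
    proof -
      have "max t (decay y) powr (1 - s y) \<le> E * t powr (1 - sinf)"
        using max_decay_powr_le[OF s(1) sinf t True, of y] by (simp add: E_def n_def)
      also have "t powr (1 - sinf) \<le> E * t powr (1 - s x)"
        unfolding E_def n_def using decay_powr_change[OF s(1) dt True] t by (intro powr_le_exp_mult_powr) auto
      finally show ?thesis using E by simp
    qed
    have "(\<integral>\<^sup>+y\<in>?B. ennreal (f y) \<partial>lebesgue) \<le>
     (\<integral>\<^sup>+y\<in>?B. ennreal (max t (decay y)) \<partial>lebesgue) + ennreal (E * (E * t powr (1 - s x))) * (\<integral>\<^sup>+y\<in>?B. ennreal (f y powr s y) \<partial>lebesgue)"
    proof (rule nn_integral_le_powr)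
      show "(\<lambda>y::real^'n. max t (decay y)) \<in> borel_measurable lebesgue"
        by (intro measurable_completion) simp
    qed (use B f s t c E in \<open>auto simp: less_max_iff_disj\<close>)
    also have "(\<integral>\<^sup>+y\<in>?B. ennreal (max t (decay y)) \<partial>lebesgue) \<le> ennreal t * ennreal v + ennreal (A * v)"
    proof -
      have "(\<integral>\<^sup>+y\<in>?B. ennreal (max t (decay y)) \<partial>lebesgue) \<le>
          (\<integral>\<^sup>+y. ennreal t * indicator ?B y + ennreal (decay y) * indicator ?B y \<partial>lebesgue)"
        using t less_imp_le[OF decay_pos] by (intro nn_integral_mono)
         (auto simp: indicator_def max_def add_increasing add_increasing2)
      also have "\<dots> = ennreal t * emeasure lebesgue ?B + (\<integral>\<^sup>+y\<in>?B. ennreal (decay y) \<partial>lebesgue)"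
        using B by (subst nn_integral_add) (auto simp: nn_integral_cmult_indicator
          intro!: borel_measurable_times_ennreal borel_measurable_indicator)
      also have "\<dots> \<le> ennreal t * ennreal v + ennreal (A * v)"
        using d_le vol by (intro add_mono mult_left_mono) auto
      finally show ?thesis .
    qed
    also have "ennreal (E * (E * t powr (1 - s x))) * (\<integral>\<^sup>+y\<in>?B. ennreal (f y powr s y) \<partial>lebesgue)
        \<le> ennreal (E * (E * t powr (1 - s x))) * ennreal (A * v)"
      using f_le by (intro mult_left_mono) auto
    also have "ennreal t * ennreal v + ennreal (A * v) + ennreal (E * (E * t powr (1 - s x))) * ennreal (A * v)
        = ennreal (t * v + A * v + E * (E * t powr (1 - s x)) * (A * v))"
      using t v_pos A E by (simp add: ennreal_mult[symmetric] ennreal_plus[symmetric] del: ennreal_plus)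
    also have "t * v + A * v + E * (E * t powr (1 - s x)) * (A * v) \<le> t * v + t * v + E * (E * t powr (1 - s x)) * (\<Lambda> * v)"
      using A_le \<Lambda>t v_pos E by (intro add_mono mult_left_mono mult_right_mono) auto
    also have "\<dots> = (2 + E^2) * v * t"
      using t1s by (simp add: algebra_simps power2_eq_square)
    also have "\<dots> \<le> (2 + E^2 + E2) * v * t"
      using v_pos t E by (intro mult_right_mono) auto
    finally show ?thesis
      by (simp add: E_def E2_def n_def t_def \<Lambda>_def add_mono mult_left_mono ennreal_leI)
  next
    case False
    have \<Lambda>1: "1 < \<Lambda>"
    proof (rule ccontr)
      assume "\<not> 1 < \<Lambda>"
      then have "t \<le> 1 powr (1 / s x)" unfolding t_def using \<Lambda> sx by (intro powr_mono2) auto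
      then show False using False by simp
    qed
    have t\<Lambda>: "t \<le> \<Lambda>" unfolding t_def
      using powr_mono[of "1 / s x" 1 \<Lambda>] \<Lambda>1 sx by simp
    \<comment> \<open>For \<rho> \<le> 1, ln \<Lambda> is at most ln (2k+1) + n ln (1/\<rho>). The
      first part is paid by |s(x) - s(y)| \<le> \<sigma>, the second by local log-Hoelder continuity
      with \<kappa> = 2. For \<rho> > 1 only the first part remains.\<close>
    have osc: "\<bar>s x - s y\<bar> * \<bar>ln t\<bar> \<le> \<sigma> * ln (2 * k + 1) + n * (C * (1 + ln 2))" if y: "y \<in> ?B" for y
    proof -
      have lnk: "0 \<le> ln (2 * k + 1)" using A(3) by simp
      have s_le: "\<bar>s x - s y\<bar> \<le> \<sigma>" using s(3)[of x] s(3)[of y] s(4)[of x] s(4)[of y] by linarith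
      have \<sigma>: "1 \<le> \<sigma>" using s(3)[of x] s(4)[of x] by linarith
      have ln_t: "\<bar>ln t\<bar> \<le> ln \<Lambda>" using False t\<Lambda> \<Lambda> t by simp
      have \<Lambda>_le: "\<Lambda> \<le> k * (1 + 1 / \<rho> ^ CARD('n)) + 1"
        using A decay_le_1[of x] by (simp add: \<Lambda>_def)
      show ?thesis
      proof (cases "\<rho> \<le> 1")
        case True
        have one: "1 \<le> 1 / \<rho> ^ CARD('n)" using True \<rho> by (simp add: power_le_one)
        then have "k * (1 + 1 / \<rho> ^ CARD('n)) + 1 \<le> k * (1 / \<rho> ^ CARD('n) + 1 / \<rho> ^ CARD('n)) + 1 / \<rho> ^ CARD('n)"
          using A(3) by (intro add_mono mult_left_mono) auto
        then have "\<Lambda> \<le> (2 * k + 1) * (1 / \<rho>) ^ CARD('n)"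
          using \<Lambda>_le by (simp add: algebra_simps power_one_over)
        then have "ln \<Lambda> \<le> ln ((2 * k + 1) * (1 / \<rho>) ^ CARD('n))"
          using \<Lambda> by (intro ln_mono) auto
        also have "\<dots> = ln (2 * k + 1) + n * ln (1 / \<rho>)"
          using A(3) \<rho> by (subst ln_mult) (auto simp: ln_realpow n_def)
        finally have "\<bar>s x - s y\<bar> * \<bar>ln t\<bar> \<le> \<bar>s x - s y\<bar> * (ln (2 * k + 1) + n * ln (1 / \<rho>))"
          using ln_t by (intro mult_left_mono) auto
        also have "\<dots> = \<bar>s x - s y\<bar> * ln (2 * k + 1) + n * (\<bar>s x - s y\<bar> * ln (1 / \<rho>))"
          by (simp add: algebra_simps)
        also have "\<dots> \<le> \<sigma> * ln (2 * k + 1) + n * (C * (1 + ln 2))"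
        proof (intro add_mono mult_right_mono mult_left_mono s_le lnk log_hoelder_with_local[OF s(1) \<rho> True])
          have "norm (x - y) \<le> norm (x - a) + norm (a - y)" using norm_triangle_ineq[of "x - a" "a - y"] by simp
          then show "norm (x - y) \<le> 2 * \<rho>" using x y by (auto simp: dist_norm norm_minus_commute)
        qed (use n in auto)
        finally show ?thesis .
      next
        case False
        then have "1 / \<rho> ^ CARD('n) \<le> 1" using one_le_power[of \<rho> "CARD('n)"] by simp
        then have "k * (1 + 1 / \<rho> ^ CARD('n)) + 1 \<le> k * (1 + 1) + 1"
          using A(3) by (intro add_mono mult_left_mono) auto
        then have "ln \<Lambda> \<le> ln (2 * k + 1)"
          using \<Lambda>_le \<Lambda> by (intro ln_mono) auto
        then have "\<bar>s x - s y\<bar> * \<bar>ln t\<bar> \<le> \<sigma> * ln (2 * k + 1)"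
          using ln_t s_le \<sigma> by (intro mult_mono) auto
        then show ?thesis using C n by (simp add: add_increasing2)
      qed
    qed
    have c: "t powr (1 - s y) \<le> E2 * t powr (1 - s x)" if "y \<in> ?B" for y
      unfolding E2_def using osc[OF that] t by (intro powr_le_exp_mult_powr) auto
    have "(\<integral>\<^sup>+y\<in>?B. ennreal (f y) \<partial>lebesgue) \<le>
      (\<integral>\<^sup>+y\<in>?B. ennreal t \<partial>lebesgue) + ennreal (E2 * t powr (1 - s x)) * (\<integral>\<^sup>+y\<in>?B. ennreal (f y powr s y) \<partial>lebesgue)"
      by (rule nn_integral_le_powr) (use B f s t c E in auto)
    also have "\<dots> \<le> ennreal t * ennreal v + ennreal (E2 * t powr (1 - s x)) * ennreal (A * v)"
      using f_le B vol by (intro add_mono mult_left_mono) (auto simp: nn_integral_cmult_indicator)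
    also have "\<dots> = ennreal (t * v + E2 * t powr (1 - s x) * (A * v))"
      using t v_pos A E by (simp add: ennreal_mult[symmetric] ennreal_plus[symmetric] del: ennreal_plus)
    also have "t * v + E2 * t powr (1 - s x) * (A * v) \<le> t * v + E2 * t powr (1 - s x) * (\<Lambda> * v)"
      using A_le v_pos E by (intro add_mono mult_left_mono mult_right_mono) auto
    also have "\<dots> = (1 + E2) * v * t"
      using t1s by (simp add: algebra_simps)
    also have "\<dots> \<le> (2 + E^2 + E2) * v * t"
      using v_pos t E by (intro mult_right_mono) auto
    finally show ?thesis
      by (simp add: E_def E2_def n_def t_def \<Lambda>_def add_mono mult_left_mono ennreal_leI)
  qed
qed

subsection \<open>The fractional maximal function of variable order\<close>

lemma powr_add_le:
  fixes a b c :: real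
  assumes "0 \<le> a" "0 \<le> b" "0 \<le> c"
  shows "(a + b) powr c \<le> 2 powr c * (a powr c + b powr c)"
proof -
  have "(a + b) powr c \<le> (2 * max a b) powr c"
    using assms by (intro powr_mono2) auto
  also have "\<dots> = 2 powr c * max a b powr c"
    using assms by (simp add: powr_mult)
  also have "max a b powr c \<le> a powr c + b powr c"
    by (auto simp: max_def)
  finally show ?thesis by simp
qed

text \<open>Hedberg's splitting: at x one has q = r + r \<theta> with \<theta> = \<delta> q / n, so
  the left side equals t^r (\<rho>^n t^r)^\<theta> and a bound on \<rho>^n t^r suffices. For \<rho>
  \<le> 1 the bound on t gives it, for moderate \<rho> > 1 it does so after exchanging
  \<open>rinf\<close> for r(x). For huge \<rho> that exchange is too expensive, but there
  \<rho>^\<delta> t \<le> A \<rho>^(-\<epsilon>) is already at most A times the decay.\<close>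

lemma fractional_scaling:
  fixes r q \<delta> :: "real^'n \<Rightarrow> real"
  assumes r: "log_hoelder_with C rinf r" "\<And>y. 1 \<le> r y" "\<And>y. r y \<le> \<sigma>"
    and q: "1 \<le> q x" "q x \<le> \<tau>" and \<delta>: "0 < \<delta> x" "\<delta> x \<le> \<Delta>" "\<delta> x \<le> real CARD('n)"
    and rq: "1 / r x - 1 / q x = \<delta> x / real CARD('n)" and \<epsilon>: "\<epsilon> = real CARD('n) / rinf - \<Delta>" "0 < \<epsilon>"
    and A: "1 \<le> A" and t: "0 \<le> t" and \<rho>: "0 < \<rho>"
    and small: "\<rho> \<le> 1 \<Longrightarrow> t \<le> A * \<rho> powr (- real CARD('n) / r x)"
    and large: "1 \<le> \<rho> \<Longrightarrow> t \<le> A * \<rho> powr (- real CARD('n) / rinf)"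
  shows "(\<rho> powr \<delta> x * t) powr q x \<le>
    (A powr \<sigma> * exp (real CARD('n) * ((real CARD('n) + 1) / \<epsilon> * C))) powr \<tau> * (t powr r x + decay x)"
proof -
  define n where "n = real CARD('n)"
  have n: "0 < n" by (simp add: n_def)
  \<comment> \<open>The threshold between moderate and huge radii is \<rho> = (e + |x|)^\<kappa>;
    this \<kappa> makes \<rho>^(-\<epsilon>) at most \<open>decay x\<close> from there on.\<close>
  define \<kappa> where "\<kappa> = (n + 1) / \<epsilon>"
  have \<kappa>: "0 < \<kappa>" "\<kappa> * \<epsilon> = n + 1" using n \<epsilon> by (auto simp: \<kappa>_def)
  have C: "0 \<le> C" using r(1) by (simp add: log_hoelder_with_def)
  define E where "E = exp (n * (\<kappa> * C))"
  have E: "1 \<le> E" using n \<kappa> C by (simp add: E_def)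
  have \<sigma>: "1 \<le> \<sigma>" using r(2)[of x] r(3)[of x] by linarith
  have A\<sigma>: "1 \<le> A powr \<sigma>" using A \<sigma> by (intro ge_one_powr_ge_zero) auto
  have A\<sigma>E: "1 \<le> A powr \<sigma> * E" using A\<sigma> E mult_mono[of 1 "A powr \<sigma>" 1 E] by simp
  have rinf: "1 \<le> rinf" using log_hoelder_with_infinity_ge[OF r(1,2)] .
  have rx: "1 \<le> r x" "r x \<le> \<sigma>" using r by auto
  have goal: "(\<rho> powr \<delta> x * t) powr q x \<le> (A powr \<sigma> * E) powr \<tau> * (t powr r x + decay x)"
    if le: "\<rho> powr n * t powr r x \<le> A powr \<sigma> * E"
  proof -
    define \<theta> where "\<theta> = \<delta> x * q x / n"
    have \<theta>: "0 \<le> \<theta>" "\<theta> \<le> \<tau>" using \<delta> q n mult_mono[of "\<delta> x / n" 1 "q x" \<tau>] by (auto simp: \<theta>_def n_def)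
    have eq: "r x + r x * \<theta> = q x"
    proof -
      have "q x = r x * (1 + q x * (1 / r x - 1 / q x))" using rx q by (simp add: field_simps)
      then show ?thesis unfolding rq by (simp add: \<theta>_def n_def algebra_simps)
    qed
    have "(\<rho> powr \<delta> x * t) powr q x = \<rho> powr (n * \<theta>) * t powr (r x + r x * \<theta>)"
      using \<rho> t n unfolding eq by (simp add: powr_mult powr_powr \<theta>_def)
    also have "\<dots> = t powr r x * (\<rho> powr n * t powr r x) powr \<theta>"
      using \<rho> t by (simp add: powr_mult powr_powr powr_add)
    also have "\<dots> \<le> t powr r x * (A powr \<sigma> * E) powr \<theta>"
      using le \<theta> \<rho> by (intro mult_left_mono powr_mono2) auto
    also have "\<dots> \<le> t powr r x * (A powr \<sigma> * E) powr \<tau>"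
      using A\<sigma>E \<theta> by (intro mult_left_mono powr_mono) auto
    also have "\<dots> \<le> (A powr \<sigma> * E) powr \<tau> * (t powr r x + decay x)"
      using decay_pos[of x] by (simp add: algebra_simps)
    finally show ?thesis .
  qed
  have A_pow: "A powr r x \<le> A powr \<sigma>" using A rx by (intro powr_mono) auto
  have "(\<rho> powr \<delta> x * t) powr q x \<le> (A powr \<sigma> * E) powr \<tau> * (t powr r x + decay x)"
  proof (cases "\<rho> \<le> 1")
    case True
    have "\<rho> powr n * t powr r x \<le> \<rho> powr n * (A * \<rho> powr (- n / r x)) powr r x"
      using small[OF True] t rx by (intro mult_left_mono powr_mono2) (auto simp: n_def)
    also have "\<dots> = A powr r x"
      using A \<rho> rx by (simp add: powr_mult powr_powr powr_add[symmetric])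
    also have "\<dots> \<le> A powr \<sigma> * E" using A_pow A\<sigma> E mult_mono[of "A powr r x" "A powr \<sigma>" 1 E] by simp
    finally show ?thesis by (rule goal)
  next
    case False
    then have \<rho>1: "1 < \<rho>" and tl: "t \<le> A * \<rho> powr (- n / rinf)" using large by (auto simp: n_def)
    define L where "L = ln (exp 1 + norm x)"
    have L: "1 \<le> L" unfolding L_def by (rule ln_exp1_plus_norm_ge)
    show ?thesis
    proof (cases "ln \<rho> \<le> \<kappa> * L")
      case True
      have "\<rho> powr (- (n / rinf * r x)) \<le> E * \<rho> powr - n"
        unfolding E_def
      proof (rule powr_le_exp_mult_powr[OF \<rho>])
        have "\<bar>- (n / rinf * r x) - - n\<bar> = \<bar>r x - rinf\<bar> * (n / rinf)"
        proof -
          have "- (n / rinf * r x) - - n = - ((r x - rinf) * (n / rinf))"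
            using rinf by (simp add: field_simps)
          then show ?thesis using n rinf by (simp only: abs_minus abs_mult) simp
        qed
        also have "\<dots> \<le> \<bar>r x - rinf\<bar> * (n / 1)"
          using n rinf by (intro mult_left_mono divide_left_mono) auto
        finally have "\<bar>- (n / rinf * r x) - - n\<bar> * \<bar>ln \<rho>\<bar> \<le> (\<bar>r x - rinf\<bar> * n) * (\<kappa> * L)"
          using True \<rho>1 n by (intro mult_mono) auto
        also have "\<dots> = n * (\<kappa> * (\<bar>r x - rinf\<bar> * L))" by (simp add: mult_ac)
        also have "\<dots> \<le> n * (\<kappa> * C)"
          using log_hoelder_with_infinity[OF r(1), of x] n \<kappa> unfolding L_def by (intro mult_left_mono) auto
        finally show "\<bar>- (n / rinf * r x) - - n\<bar> * \<bar>ln \<rho>\<bar> \<le> n * (\<kappa> * C)" .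
      qed
      have "\<rho> powr n * t powr r x \<le> \<rho> powr n * (A * \<rho> powr (- n / rinf)) powr r x"
        using tl t rx by (intro mult_left_mono powr_mono2) auto
      also have "\<dots> = A powr r x * (\<rho> powr n * \<rho> powr (- (n / rinf * r x)))"
        using A \<rho> by (simp add: powr_mult powr_powr)
      also have "\<dots> \<le> A powr \<sigma> * (\<rho> powr n * (E * \<rho> powr - n))"
        using A_pow \<open>\<rho> powr (- (n / rinf * r x)) \<le> E * \<rho> powr - n\<close> by (intro mult_mono) auto
      also have "\<dots> = A powr \<sigma> * E"
        using \<rho> by (simp add: powr_minus)
      finally show ?thesis by (rule goal)
    next
      case False
      have "\<rho> powr \<delta> x * t \<le> \<rho> powr \<Delta> * (A * \<rho> powr (- n / rinf))"
        using \<delta> \<rho>1 tl t by (intro mult_mono powr_mono) auto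
      also have "\<dots> = A * \<rho> powr - \<epsilon>"
        using \<rho> by (simp add: powr_add[symmetric] \<epsilon> n_def)
      also have "\<rho> powr - \<epsilon> \<le> decay x"
      proof -
        have "\<epsilon> * (\<kappa> * L) \<le> \<epsilon> * ln \<rho>"
          using False \<epsilon>(2) by (intro mult_left_mono) auto
        moreover have "\<epsilon> * (\<kappa> * L) = (n + 1) * L"
          unfolding \<kappa>(2)[symmetric] by (simp add: mult_ac)
        ultimately have "(n + 1) * L \<le> \<epsilon> * ln \<rho>" by simp
        then have "- \<epsilon> * ln \<rho> \<le> - (n + 1) * L" by (simp add: algebra_simps)
        then show ?thesis
          using \<rho> exp1_plus_norm_ge(3)[of x] by (simp add: decay_def powr_def n_def L_def)
      qed
      finally have "\<rho> powr \<delta> x * t \<le> A * decay x" using A by simp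
      then have "(\<rho> powr \<delta> x * t) powr q x \<le> (A * decay x) powr q x"
        using t q by (intro powr_mono2) auto
      also have "\<dots> = A powr q x * decay x powr q x"
        using A decay_pos[of x] by (simp add: powr_mult)
      also have "\<dots> \<le> (A powr \<sigma> * E) powr \<tau> * decay x"
      proof (intro mult_mono)
        have "A \<le> A powr \<sigma> * E"
        proof -
          have "A powr 1 \<le> A powr \<sigma>" using A \<sigma> by (intro powr_mono) auto
          then show ?thesis using A E A\<sigma> mult_mono[of A "A powr \<sigma>" 1 E] by simp
        qed
        then have "A powr q x \<le> (A powr \<sigma> * E) powr q x" using A q by (intro powr_mono2) auto
        also have "\<dots> \<le> (A powr \<sigma> * E) powr \<tau>" using A\<sigma>E q by (intro powr_mono) auto
        finally show "A powr q x \<le> (A powr \<sigma> * E) powr \<tau>" .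
        have "decay x powr q x \<le> decay x powr 1"
          using decay_pos[of x] decay_le_1[of x] q by (intro powr_mono') auto
        then show "decay x powr q x \<le> decay x" using decay_pos[of x] by simp
      qed auto
      also have "\<dots> \<le> (A powr \<sigma> * E) powr \<tau> * (t powr r x + decay x)"
        by (intro mult_left_mono) auto
      finally show ?thesis .
    qed
  qed
  then show ?thesis by (simp add: E_def \<kappa>_def n_def)
qed

lemma log_hoelder_with_divide:
  assumes "log_hoelder_with C sinf s" "1 \<le> c"
  shows "log_hoelder_with C (sinf / c) (\<lambda>x. s x / c)"
proof -
  have *: "\<bar>a / c - b / c\<bar> \<le> \<bar>a - b\<bar>" for a b
  proof -
    have "\<bar>a / c - b / c\<bar> = \<bar>a - b\<bar> / c"
      using assms(2) by (simp add: diff_divide_distrib[symmetric])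
    also have "\<dots> \<le> \<bar>a - b\<bar> / 1" using assms(2) by (intro divide_left_mono) auto
    finally show ?thesis by simp
  qed
  show ?thesis using assms(1) unfolding log_hoelder_with_def by (auto intro: order_trans[OF *])
qed

text \<open>The supremum over balls is replaced by one measurable \<open>W\<close>, so that modulars
  in both exponents are controlled by its integral. The bound with 1/r will make the sharp maximal
  function of f finite; the bound with 1/q and the factor \<rho>^(-\<delta>(x)) will estimate the
  commutator.\<close>

lemma fractional_maximal_majorant:
  fixes r q \<delta> :: "real^'n \<Rightarrow> real"
  assumes r: "log_hoelder_with C rinf r" "r \<in> borel_measurable lebesgue" "\<And>y. c \<le> r y" "\<And>y. r y \<le> \<sigma>" and c: "1 < c"
    and q: "\<And>x. 1 \<le> q x" "\<And>x. q x \<le> \<tau>" and \<delta>: "\<And>x. 0 < \<delta> x" "\<And>x. \<delta> x \<le> \<Delta>" "\<And>x. \<delta> x \<le> real CARD('n)"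
    and rq: "\<And>x. 1 / r x - 1 / q x = \<delta> x / real CARD('n)" and \<epsilon>: "rinf * \<Delta> < real CARD('n)"
  obtains K where "1 \<le> K"
    "\<And>f. f \<in> borel_measurable lebesgue \<Longrightarrow> (\<And>y. 0 \<le> f y) \<Longrightarrow> (\<integral>\<^sup>+y. ennreal (f y powr r y) \<partial>lebesgue) \<le> 1 \<Longrightarrow>
      \<exists>W. W \<in> borel_measurable lebesgue \<and> (\<forall>x. 0 \<le> W x) \<and> (\<integral>\<^sup>+y. ennreal (W y) \<partial>lebesgue) \<le> ennreal K \<and>
        (AE x in lebesgue. \<forall>a \<rho>. 0 < \<rho> \<and> x \<in> ball a \<rho> \<longrightarrow>
          (\<integral>\<^sup>+y\<in>ball a \<rho>. ennreal (f y) \<partial>lebesgue) \<le> ennreal (\<rho> ^ CARD('n) * W x powr (1 / r x)) \<and>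
          (\<integral>\<^sup>+y\<in>ball a \<rho>. ennreal (f y) \<partial>lebesgue) \<le> ennreal (\<rho> ^ CARD('n) * (\<rho> powr - \<delta> x * W x powr (1 / q x))))"
proof -
  define n where "n = real CARD('n)"
  have n: "0 < n" by (simp add: n_def)
  define V where "V = unit_ball_vol n"
  have V: "0 < V" by (simp add: V_def n_def)
  have r1: "1 \<le> r y" for y using r(3)[of y] c by linarith
  have rinf: "1 \<le> rinf" using log_hoelder_with_infinity_ge[OF r(1) r1] .
  obtain D where D: "0 < D" "(\<integral>\<^sup>+x. ennreal (decay (x::real^'n)) \<partial>lebesgue) \<le> ennreal D"
    using nn_integral_decay_finite by blast
  \<comment> \<open>Dividing r by its lower bound c > 1 leaves an exponent at least 1 and reserves
    the power c for the strong type inequality, as (f^s)^c = f^r.\<close>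
  define s where "s y = r y / c" for y
  have s: "log_hoelder_with C (rinf / c) s" unfolding s_def using log_hoelder_with_divide[OF r(1), of c] c by simp
  have s_meas[measurable]: "s \<in> borel_measurable lebesgue" unfolding s_def using r(2) by measurable
  have s1: "1 \<le> s y" for y using r(3)[of y] c by (simp add: s_def)
  have sr: "s y \<le> r y" for y
    using r1[of y] c unfolding s_def by (simp add: divide_le_eq mult_le_cancel_left1)
  have s\<sigma>: "s y \<le> \<sigma>" for y using sr[of y] r(4)[of y] by linarith
  \<comment> \<open>From f^s \<le> 1 + f^r and decay \<le> 1, the integral of \<open>F\<close> over
    a ball of volume v is at most 2 v + 1. Division by v = V \<rho>^n leads to this k.\<close>
  define k where "k = 2 + 1 / V"
  have k: "0 \<le> k" using V by (simp add: k_def)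
  define P0 where "P0 = 2 + exp ((n + 1) * C) ^ 2 + exp (\<sigma> * ln (2 * k + 1) + n * (C * (1 + ln 2)))"
  define P where "P = max 1 (P0 * V)"
  define \<epsilon>' where "\<epsilon>' = n / rinf - \<Delta>"
  have \<epsilon>': "0 < \<epsilon>'" using \<epsilon> rinf by (simp add: \<epsilon>'_def n_def pos_less_divide_eq mult.commute)
  define \<kappa> where "\<kappa> = max 2 V"
  define A where "A = max (\<kappa> + exp (n * (C * (1 + ln \<kappa>)))) (\<kappa> + D + exp ((n + 1) * C))"
  have A: "1 \<le> A" unfolding A_def \<kappa>_def by (simp add: add_increasing2 le_max_iff_disj)
  define H where "H = (A powr \<sigma> * exp (n * ((n + 1) / \<epsilon>' * C))) powr \<tau>"
  have H: "0 \<le> H" by (simp add: H_def)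
  \<comment> \<open>Large enough for both bounds: the first entry serves t^r, the other two serve
    the two parts of the estimate for (\<rho>^\<delta> t)^q.\<close>
  define Q where "Q = max (P powr \<sigma>) (max (H * P powr \<sigma>) H)"
  have Q: "0 \<le> Q" "P powr \<sigma> \<le> Q" "H * P powr \<sigma> \<le> Q" "H \<le> Q" by (auto simp: Q_def le_max_iff_disj)
  define M1 where "M1 = 5 ^ CARD('n) * 4 powr c / (1 - 2 powr (1 - c))"
  have "0 < 1 - 2 powr (1 - c)" using c by (simp add: powr_less_one)
  then have M1: "0 \<le> M1" unfolding M1_def by (intro divide_nonneg_pos) auto
  define K where "K = max 1 (Q * (2 powr c * (M1 * (2 powr c * (1 + D)) + D) + D))"
  show ?thesis
  proof (rule that[of K])
    show "1 \<le> K" by (simp add: K_def)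
    fix f :: "real^'n \<Rightarrow> real"
    assume f: "f \<in> borel_measurable lebesgue" "\<And>y. 0 \<le> f y" and mod: "(\<integral>\<^sup>+y. ennreal (f y powr r y) \<partial>lebesgue) \<le> 1"
    note f(1)[measurable] r(2)[measurable]
    define F where "F y = f y powr s y + decay y" for y
    have F0: "0 \<le> F y" for y using decay_pos[of y] by (simp add: F_def)
    have F_meas[measurable]: "F \<in> borel_measurable lebesgue" unfolding F_def by measurable
    have Fc: "(\<integral>\<^sup>+y. ennreal (F y powr c) \<partial>lebesgue) \<le> ennreal (2 powr c * (1 + D))"
    proof -
      have "(\<integral>\<^sup>+y. ennreal (F y powr c) \<partial>lebesgue) \<le>
          (\<integral>\<^sup>+y. ennreal (2 powr c) * (ennreal (f y powr r y) + ennreal (decay y)) \<partial>lebesgue)"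
      proof (intro nn_integral_mono)
        fix y
        have "F y powr c \<le> 2 powr c * ((f y powr s y) powr c + decay y powr c)"
          unfolding F_def using decay_pos[of y] c by (intro powr_add_le) auto
        also have "(f y powr s y) powr c = f y powr r y" using c by (simp add: powr_powr s_def)
        also have "decay y powr c \<le> decay y powr 1"
          using decay_pos[of y] decay_le_1[of y] c by (intro powr_mono') auto
        also have "decay y powr 1 = decay y" using decay_pos[of y] by simp
        finally have "F y powr c \<le> 2 powr c * (f y powr r y + decay y)" by simp
        then show "ennreal (F y powr c) \<le> ennreal (2 powr c) * (ennreal (f y powr r y) + ennreal (decay y))"
          using decay_pos[of y] by (simp add: ennreal_mult[symmetric] ennreal_plus[symmetric] ennreal_leI del: ennreal_plus)
      qed
      also have "\<dots> = ennreal (2 powr c) * ((\<integral>\<^sup>+y. ennreal (f y powr r y) \<partial>lebesgue) + (\<integral>\<^sup>+y. ennreal (decay (y::real^'n)) \<partial>lebesgue))"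
        by (subst nn_integral_cmult) (auto simp: nn_integral_add)
      also have "\<dots> \<le> ennreal (2 powr c) * (1 + ennreal D)"
        by (intro mult_left_mono add_mono mod D) auto
      also have "\<dots> = ennreal (2 powr c * (1 + D))"
        using D by (simp add: ennreal_mult[symmetric] ennreal_1[symmetric] ennreal_plus[symmetric] del: ennreal_plus ennreal_1)
      finally show ?thesis .
    qed
    have Fc_fin: "(\<integral>\<^sup>+y. ennreal (F y powr c) \<partial>lebesgue) < \<infinity>"
      using Fc by (rule le_less_trans) simp
    define M where "M = hl_maximal (\<lambda>y. ennreal (F y))"
    have M_meas[measurable]: "M \<in> borel_measurable lebesgue" unfolding M_def by (rule hl_maximal_measurable)
    define w where "w y = enn2real (M y)" for y
    have w_meas[measurable]: "w \<in> borel_measurable lebesgue" unfolding w_def by measurable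
    have w0: "0 \<le> w y" for y by (simp add: w_def)
    have wc: "(\<integral>\<^sup>+y. ennreal (w y powr c) \<partial>lebesgue) \<le> ennreal (M1 * (2 powr c * (1 + D)))"
    proof -
      have "(\<integral>\<^sup>+y. ennreal (w y powr c) \<partial>lebesgue) \<le> ennreal M1 * (\<integral>\<^sup>+y. ennreal (F y powr c) \<partial>lebesgue)"
        unfolding w_def M_def M1_def using hl_maximal_strong_type(2)[OF c F_meas F0 Fc_fin] .
      also have "\<dots> \<le> ennreal M1 * ennreal (2 powr c * (1 + D))"
        by (intro mult_left_mono Fc) auto
      also have "\<dots> = ennreal (M1 * (2 powr c * (1 + D)))"
        using M1 D by (intro ennreal_mult[symmetric]) auto
      finally show ?thesis .
    qed
    define W where "W y = Q * ((w y + decay y) powr c + decay y)" for y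
    have W0: "0 \<le> W y" for y using Q decay_pos[of y] by (simp add: W_def)
    have W_meas: "W \<in> borel_measurable lebesgue" unfolding W_def by measurable
    have "(\<integral>\<^sup>+y. ennreal (W y) \<partial>lebesgue) \<le> ennreal K"
    proof -
      have "(\<integral>\<^sup>+y. ennreal (W y) \<partial>lebesgue) \<le>
          (\<integral>\<^sup>+y. ennreal Q * (ennreal (2 powr c) * (ennreal (w y powr c) + ennreal (decay y)) + ennreal (decay y)) \<partial>lebesgue)"
      proof (intro nn_integral_mono)
        fix y
        have "(w y + decay y) powr c \<le> 2 powr c * (w y powr c + decay y powr c)"
          using decay_pos[of y] c w0 by (intro powr_add_le) auto
        also have "decay y powr c \<le> decay y powr 1"
          using decay_pos[of y] decay_le_1[of y] c by (intro powr_mono') auto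
        also have "decay y powr 1 = decay y" using decay_pos[of y] by simp
        finally have "W y \<le> Q * (2 powr c * (w y powr c + decay y) + decay y)"
          unfolding W_def using Q by (intro mult_left_mono add_mono) auto
        then show "ennreal (W y) \<le> ennreal Q * (ennreal (2 powr c) * (ennreal (w y powr c) + ennreal (decay y)) + ennreal (decay y))"
          using decay_pos[of y] Q by (simp add: ennreal_mult[symmetric] ennreal_plus[symmetric] ennreal_leI del: ennreal_plus)
      qed
      also have "\<dots> = ennreal Q * (ennreal (2 powr c) * ((\<integral>\<^sup>+y. ennreal (w y powr c) \<partial>lebesgue)
          + (\<integral>\<^sup>+y. ennreal (decay (y::real^'n)) \<partial>lebesgue)) + (\<integral>\<^sup>+y. ennreal (decay (y::real^'n)) \<partial>lebesgue))"
        by (simp add: nn_integral_cmult nn_integral_add)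
      also have "\<dots> \<le> ennreal Q * (ennreal (2 powr c) * (ennreal (M1 * (2 powr c * (1 + D))) + ennreal D) + ennreal D)"
        by (intro mult_left_mono add_mono wc D) auto
      also have "\<dots> = ennreal (Q * (2 powr c * (M1 * (2 powr c * (1 + D)) + D) + D))"
        using D M1 Q by (simp add: ennreal_mult[symmetric] ennreal_plus[symmetric] del: ennreal_plus)
      also have "\<dots> \<le> ennreal K" by (intro ennreal_leI) (simp add: K_def)
      finally show ?thesis .
    qed
    moreover have "AE x in lebesgue. \<forall>a \<rho>. 0 < \<rho> \<and> x \<in> ball a \<rho> \<longrightarrow>
          (\<integral>\<^sup>+y\<in>ball a \<rho>. ennreal (f y) \<partial>lebesgue) \<le> ennreal (\<rho> ^ CARD('n) * W x powr (1 / r x)) \<and>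
          (\<integral>\<^sup>+y\<in>ball a \<rho>. ennreal (f y) \<partial>lebesgue) \<le> ennreal (\<rho> ^ CARD('n) * (\<rho> powr - \<delta> x * W x powr (1 / q x)))"
      using hl_maximal_strong_type(1)[OF c F_meas F0 Fc_fin]
    proof (rule AE_mp, intro AE_I2 impI allI)
      fix x a and \<rho> :: real
      assume fin: "hl_maximal (\<lambda>y. ennreal (F y)) x < \<infinity>" and "0 < \<rho> \<and> x \<in> ball a \<rho>"
      then have \<rho>: "0 < \<rho>" and x: "x \<in> ball a \<rho>" by auto
      let ?B = "ball a \<rho>"
      define v where "v = V * \<rho> ^ CARD('n)"
      have v: "0 < v" using V \<rho> by (simp add: v_def)
      have vol: "emeasure lebesgue ?B = ennreal v"
        using emeasure_ball_lebesgue[of \<rho> a] \<rho> by (simp add: v_def V_def n_def)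
      have le_M: "ball_average (\<lambda>y. ennreal (F y)) a \<rho> \<le> M x"
        unfolding M_def by (rule ball_average_le_hl_maximal[OF \<rho> x])
      define \<alpha> where "\<alpha> = enn2real (ball_average (\<lambda>y. ennreal (F y)) a \<rho>)"
      have "ball_average (\<lambda>y. ennreal (F y)) a \<rho> < top"
        using le_M fin by (auto simp: M_def intro: le_less_trans)
      then have \<alpha>: "ball_average (\<lambda>y. ennreal (F y)) a \<rho> = ennreal \<alpha>" "0 \<le> \<alpha>"
        by (auto simp: \<alpha>_def)
      have \<alpha>w: "\<alpha> \<le> w x"
        using le_M fin unfolding \<alpha>_def w_def M_def by (intro enn2real_mono) auto
      have IF: "(\<integral>\<^sup>+y\<in>?B. ennreal (F y) \<partial>lebesgue) = ennreal (\<alpha> * v)"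
      proof -
        have "(\<integral>\<^sup>+y\<in>?B. ennreal (F y) \<partial>lebesgue) = ball_average (\<lambda>y. ennreal (F y)) a \<rho> * ennreal v"
          unfolding ball_average_def vol using v
          by (simp add: ennreal_divide_times ennreal_times_divide[symmetric] divide_ennreal mult_divide_eq_ennreal)
        then show ?thesis using \<alpha> v by (simp add: ennreal_mult)
      qed
      have \<alpha>_le: "\<alpha> \<le> k * (1 + 1 / \<rho> ^ CARD('n))"
      proof -
        have "ennreal (\<alpha> * v) \<le> (\<integral>\<^sup>+y. ennreal 2 * indicator ?B y + ennreal (f y powr r y) \<partial>lebesgue)"
          unfolding IF[symmetric]
        proof (intro nn_integral_mono)
          fix y
          have "f y powr s y \<le> 1 + f y powr r y"
          proof (cases "f y \<le> 1")
            case True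
            then have "f y powr s y \<le> 1" using f s1[of y] by (intro powr_le1) auto
            then show ?thesis by (simp add: add_increasing2)
          next
            case False
            then have "f y powr s y \<le> f y powr r y" using sr[of y] by (intro powr_mono) auto
            then show ?thesis by simp
          qed
          then have "F y \<le> 2 + f y powr r y" using decay_le_1[of y] by (simp add: F_def)
          then show "ennreal (F y) * indicator ?B y \<le> ennreal 2 * indicator ?B y + ennreal (f y powr r y)"
            by (auto simp: indicator_def ennreal_plus[symmetric] simp del: ennreal_plus ennreal_numeral intro!: ennreal_leI)
        qed
        also have "\<dots> = ennreal 2 * emeasure lebesgue ?B + (\<integral>\<^sup>+y. ennreal (f y powr r y) \<partial>lebesgue)"
          by (subst nn_integral_add) (auto simp: nn_integral_cmult_indicator
              intro!: borel_measurable_times_ennreal borel_measurable_indicator)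
        also have "\<dots> \<le> ennreal 2 * ennreal v + 1" using mod vol by (intro add_mono) auto
        also have "\<dots> = ennreal (2 * v + 1)"
          using v by (simp add: ennreal_mult[symmetric] ennreal_1[symmetric] ennreal_plus[symmetric] del: ennreal_plus ennreal_1 ennreal_numeral)
        finally have "\<alpha> * v \<le> 2 * v + 1" using v by (subst (asm) ennreal_le_iff) auto
        then have "\<alpha> \<le> 2 + 1 / v" using v by (simp add: field_simps)
        also have "\<dots> \<le> k * (1 + 1 / \<rho> ^ CARD('n))"
          using V \<rho> by (simp add: k_def v_def field_simps)
        finally show ?thesis .
      qed
      define I where "I = (\<integral>\<^sup>+y\<in>?B. ennreal (f y) \<partial>lebesgue)"
      have I1: "I \<le> ennreal (P0 * v * (\<alpha> + decay x) powr (1 / s x))"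
        unfolding I_def P0_def n_def
        by (rule ball_average_pointwise[OF s s_meas s1 s\<sigma> f \<rho> x])
          (use IF \<alpha> \<alpha>_le k in \<open>auto simp: F_def v_def V_def n_def\<close>)
      \<comment> \<open>Normalised by \<rho>^n and not by the volume, as in the two bounds to be
        shown; the factor V is absorbed into \<open>P\<close>.\<close>
      define t where "t = enn2real I / \<rho> ^ CARD('n)"
      have "I < top" using I1 by (rule le_less_trans) simp
      then have It: "I = ennreal (\<rho> ^ CARD('n) * t)" and t0: "0 \<le> t"
        using \<rho> by (auto simp: t_def)
      have t1: "t \<le> P * (w x + decay x) powr (1 / s x)"
      proof -
        have "\<rho> ^ CARD('n) * t \<le> P0 * v * (\<alpha> + decay x) powr (1 / s x)"
          using I1 It v by (subst (asm) It) (simp add: P0_def add_nonneg_nonneg)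
        then have "\<rho> ^ CARD('n) * t \<le> \<rho> ^ CARD('n) * (P0 * V * (\<alpha> + decay x) powr (1 / s x))"
          by (simp add: v_def mult_ac)
        then have "t \<le> P0 * V * (\<alpha> + decay x) powr (1 / s x)" using \<rho> by simp
        also have "\<dots> \<le> P * (w x + decay x) powr (1 / s x)"
          using \<alpha> \<alpha>w decay_pos[of x] s1[of x] by (intro mult_mono powr_mono2) (auto simp: P_def)
        finally show ?thesis .
      qed
      have tr: "t powr r x \<le> P powr \<sigma> * (w x + decay x) powr c"
      proof -
        have wd: "0 < w x + decay x" using w0[of x] decay_pos[of x] by linarith
        have "t powr r x \<le> (P * (w x + decay x) powr (1 / s x)) powr r x"
          using t1 t0 r1[of x] by (intro powr_mono2) auto
        also have "\<dots> = P powr r x * (w x + decay x) powr (1 / s x * r x)"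
          by (simp add: powr_mult powr_powr P_def)
        also have "1 / s x * r x = c" using r1[of x] c by (simp add: s_def)
        also have "P powr r x \<le> P powr \<sigma>" using r(4)[of x] by (intro powr_mono) (auto simp: P_def)
        finally show ?thesis by (simp add: mult_right_mono)
      qed
      have \<kappa>: "1 \<le> \<kappa>" "V \<le> \<kappa>" by (auto simp: \<kappa>_def)
      have sub: "norm (x - y) \<le> \<kappa> * \<rho>" if "y \<in> ?B" for y
      proof -
        have "norm (x - y) \<le> norm (x - a) + norm (a - y)" using norm_triangle_ineq[of "x - a" "a - y"] by simp
        also have "\<dots> \<le> 2 * \<rho>" using x that by (auto simp: dist_norm norm_minus_commute)
        also have "\<dots> \<le> \<kappa> * \<rho>" using \<rho> by (intro mult_right_mono) (auto simp: \<kappa>_def)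
        finally show ?thesis .
      qed
      have vol_le: "emeasure lebesgue ?B \<le> ennreal (\<kappa> * \<rho> ^ CARD('n))"
        unfolding vol v_def using \<kappa> \<rho> by (intro ennreal_leI mult_right_mono) auto
      have modB: "(\<integral>\<^sup>+y\<in>?B. ennreal (f y powr r y) \<partial>lebesgue) \<le> 1"
        by (rule order_trans[OF nn_integral_mono mod]) (auto simp: indicator_def)
      have from_I: "t \<le> A' * \<rho> powr (- e)" if "I \<le> ennreal (A' * \<rho> powr (n - e))" "0 \<le> A'" for A' e
      proof -
        have "\<rho> ^ CARD('n) * t \<le> A' * \<rho> powr (n - e)"
          using that It by (subst (asm) It) simp
        also have "\<dots> = \<rho> ^ CARD('n) * (A' * \<rho> powr (- e))"
          using \<rho> by (simp add: powr_diff powr_minus n_def powr_realpow divide_inverse)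
        finally show ?thesis using \<rho> by simp
      qed
      have tq: "(\<rho> powr \<delta> x * t) powr q x \<le> H * (t powr r x + decay x)"
        unfolding H_def n_def
      proof (rule fractional_scaling[OF r(1) r1 r(4) q \<delta> rq])
        show "\<epsilon>' = real CARD('n) / rinf - \<Delta>" "0 < \<epsilon>'" using \<epsilon>' by (auto simp: \<epsilon>'_def n_def)
        assume \<rho>1: "\<rho> \<le> 1"
        have "t \<le> (\<kappa> + exp (n * (C * (1 + ln \<kappa>)))) * \<rho> powr (- (n / r x))"
          using nn_integral_unit_modular_small[OF r(1,2) r1 f _ sub vol_le \<kappa>(1) \<rho> \<rho>1 modB] \<kappa>
          by (intro from_I) (auto simp: I_def n_def add_nonneg_nonneg)
        also have "\<dots> \<le> A * \<rho> powr (- (n / r x))" by (intro mult_right_mono) (auto simp: A_def)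
        finally show "t \<le> A * \<rho> powr (- real CARD('n) / r x)" by (simp add: n_def)
      next
        assume \<rho>1: "1 \<le> \<rho>"
        have "t \<le> (\<kappa> + D + exp ((n + 1) * C)) * \<rho> powr (- (n / rinf))"
          using nn_integral_unit_modular_large[OF r(1,2) r1 f _ vol_le \<kappa>(1) \<rho>1 D(2) less_imp_le[OF D(1)] modB] \<kappa> D
          by (intro from_I) (auto simp: I_def n_def add_nonneg_nonneg)
        also have "\<dots> \<le> A * \<rho> powr (- (n / rinf))" by (intro mult_right_mono) (auto simp: A_def)
        finally show "t \<le> A * \<rho> powr (- real CARD('n) / rinf)" by (simp add: n_def)
      qed (use A t0 \<rho> in auto)
      have wc0: "0 \<le> (w x + decay x) powr c" by simp
      have W1: "t powr r x \<le> W x"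
      proof -
        have "t powr r x \<le> Q * (w x + decay x) powr c"
          using tr mult_right_mono[OF Q(2) wc0] by linarith
        also have "\<dots> \<le> W x" unfolding W_def using Q decay_pos[of x] by (intro mult_left_mono) auto
        finally show ?thesis .
      qed
      have W2: "(\<rho> powr \<delta> x * t) powr q x \<le> W x"
      proof -
        have "(\<rho> powr \<delta> x * t) powr q x \<le> H * (P powr \<sigma> * (w x + decay x) powr c + decay x)"
          using tq mult_left_mono[OF tr H] by (simp add: algebra_simps)
        also have "\<dots> \<le> Q * (w x + decay x) powr c + Q * decay x"
        proof -
          have "H * decay x \<le> Q * decay x" using Q(4) decay_pos[of x] by (intro mult_right_mono) auto
          with mult_right_mono[OF Q(3) wc0] show ?thesis by (simp add: distrib_left mult.assoc)
        qed
        also have "\<dots> = W x" by (simp add: W_def algebra_simps)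
        finally show ?thesis .
      qed
      have root: "z \<le> W x powr (1 / e)" if "z powr e \<le> W x" "0 \<le> z" "1 \<le> e" for z e :: real
      proof -
        have "(z powr e) powr (1 / e) \<le> W x powr (1 / e)" using that by (intro powr_mono2) auto
        then show ?thesis using that by (simp add: powr_powr)
      qed
      have "t \<le> W x powr (1 / r x)" using root[OF W1 t0 r1] .
      then have "I \<le> ennreal (\<rho> ^ CARD('n) * W x powr (1 / r x))"
        unfolding It using \<rho> by (intro ennreal_leI mult_left_mono) auto
      moreover have "\<rho> powr \<delta> x * t \<le> W x powr (1 / q x)" using root[OF W2 _ q(1)] t0 by simp
      then have "t \<le> \<rho> powr - \<delta> x * W x powr (1 / q x)"
        using \<rho> by (simp add: powr_minus field_simps)
      then have "I \<le> ennreal (\<rho> ^ CARD('n) * (\<rho> powr - \<delta> x * W x powr (1 / q x)))"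
        unfolding It using \<rho> by (intro ennreal_leI mult_left_mono) auto
      ultimately show "(\<integral>\<^sup>+y\<in>?B. ennreal (f y) \<partial>lebesgue) \<le> ennreal (\<rho> ^ CARD('n) * W x powr (1 / r x)) \<and>
          (\<integral>\<^sup>+y\<in>?B. ennreal (f y) \<partial>lebesgue) \<le> ennreal (\<rho> ^ CARD('n) * (\<rho> powr - \<delta> x * W x powr (1 / q x)))"
        unfolding I_def by blast
    qed
    ultimately show "\<exists>W. W \<in> borel_measurable lebesgue \<and> (\<forall>x. 0 \<le> W x) \<and> (\<integral>\<^sup>+y. ennreal (W y) \<partial>lebesgue) \<le> ennreal K \<and>
        (AE x in lebesgue. \<forall>a \<rho>. 0 < \<rho> \<and> x \<in> ball a \<rho> \<longrightarrow>
          (\<integral>\<^sup>+y\<in>ball a \<rho>. ennreal (f y) \<partial>lebesgue) \<le> ennreal (\<rho> ^ CARD('n) * W x powr (1 / r x)) \<and>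
          (\<integral>\<^sup>+y\<in>ball a \<rho>. ennreal (f y) \<partial>lebesgue) \<le> ennreal (\<rho> ^ CARD('n) * (\<rho> powr - \<delta> x * W x powr (1 / q x))))"
      using W_meas W0 by blast
  qed
qed

subsection \<open>Oscillations over cubes and the sharp maximal function\<close>

abbreviation cube :: "real^'n \<Rightarrow> real \<Rightarrow> (real^'n) set" where
  "cube a s \<equiv> cbox a (\<chi> i. a $ i + s)"

text \<open>The real value of one term of the supremum in \<open>sharp_maximal\<close>; by
  \<open>sharp_maximal_term\<close> the two agree when f is integrable over the cube.\<close>

definition oscillation :: "real^'n \<Rightarrow> real \<Rightarrow> (real^'n \<Rightarrow> real) \<Rightarrow> real" where
  "oscillation a s f = (LINT y:cube a s|lebesgue. \<bar>f y - cube_average (cube a s) f\<bar>) / s ^ CARD('n)"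

lemma cubes_eq: "cubes = {cube a s |a s. 0 < s}"
  by (auto simp: cubes_def)

lemma mem_cube: "x \<in> cube a s \<longleftrightarrow> (\<forall>i. a $ i \<le> x $ i \<and> x $ i \<le> a $ i + s)"
  by (simp add: mem_box_cart)

lemma measure_cube:
  fixes a :: "real^'n" assumes "0 \<le> s"
  shows "measure lebesgue (cube a s) = s ^ CARD('n)"
proof -
  have "a \<in> cube a s" using assms by (simp add: mem_cube)
  then have "cube a s \<noteq> {}" by blast
  then show ?thesis by (simp add: content_cbox_cart)
qed

lemma emeasure_cube:
  fixes a :: "real^'n" assumes "0 \<le> s"
  shows "emeasure lebesgue (cube a s) = ennreal (s ^ CARD('n))"
proof -
  have "emeasure lebesgue (cube a s) = ennreal (measure lebesgue (cube a s))"
    using emeasure_lborel_cbox_finite[of a "\<chi> i. a $ i + s"] by (intro emeasure_eq_ennreal_measure) auto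
  then show ?thesis using measure_cube[OF assms, of a] by (simp only:)
qed

lemma norm_diff_le_cube:
  fixes x y :: "real^'n" assumes "x \<in> cube a s" "y \<in> cube a s"
  shows "norm (x - y) \<le> real CARD('n) * s"
proof -
  have "norm (x - y) \<le> (\<Sum>i\<in>UNIV. \<bar>(x - y) $ i\<bar>)" by (rule norm_le_l1_cart)
  also have "\<dots> \<le> (\<Sum>i\<in>(UNIV :: 'n set). s)"
  proof (rule sum_mono)
    fix i
    show "\<bar>(x - y) $ i\<bar> \<le> s" using assms[unfolded mem_cube, THEN spec, of i] by auto
  qed
  finally show ?thesis by simp
qed

lemma cube_subset_ball:
  fixes a :: "real^'n" assumes "0 < s"
  shows "cube a s \<subseteq> ball a ((real CARD('n) + 1) * s)"
proof
  fix x assume "x \<in> cube a s"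
  moreover have "a \<in> cube a s" using assms by (simp add: mem_cube)
  ultimately have "norm (a - x) \<le> real CARD('n) * s" by (intro norm_diff_le_cube)
  then show "x \<in> ball a ((real CARD('n) + 1) * s)" using assms by (simp add: dist_norm algebra_simps)
qed

lemma set_integrable_cube_const: "set_integrable lebesgue (cube a s) (\<lambda>_. c :: real)"
  using emeasure_lborel_cbox_finite[of a "\<chi> i. a $ i + s"] unfolding set_integrable_def
  by (intro integrable_scaleR_left integrable_real_indicator) auto

lemma set_integral_cube_const:
  fixes a :: "real^'n" assumes "0 \<le> s"
  shows "(LINT y:cube a s|lebesgue. c :: real) = c * s ^ CARD('n)"
  using emeasure_lborel_cbox_finite[of a "\<chi> i. a $ i + s"] measure_cube[OF assms, of a]
  by (subst set_integral_const) auto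

lemma set_integral_eq_cube_average:
  fixes a :: "real^'n" assumes "0 < s"
  shows "(LINT y:cube a s|lebesgue. f y) = cube_average (cube a s) f * s ^ CARD('n)"
  using assms measure_cube[of s a] by (simp add: cube_average_def)

lemma locally_integrable_cube: "locally_integrable f \<Longrightarrow> set_integrable lebesgue (cube a s) f"
  by (simp add: locally_integrable_def compact_cbox)

lemma set_integrable_dev:
  "set_integrable lebesgue (cube a s) f \<Longrightarrow> set_integrable lebesgue (cube a s) (\<lambda>y. \<bar>f y - c\<bar>)"
  for c :: real
  by (intro set_integrable_abs set_integral_diff set_integrable_cube_const)

lemma set_nn_integral_eq_set_integral:
  fixes f :: "'a \<Rightarrow> real"
  assumes "set_integrable M A f" "\<And>x. x \<in> A \<Longrightarrow> 0 \<le> f x"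
  shows "(\<integral>\<^sup>+x\<in>A. ennreal (f x) \<partial>M) = ennreal (LINT x:A|M. f x)"
proof -
  have "(\<integral>\<^sup>+x\<in>A. ennreal (f x) \<partial>M) = (\<integral>\<^sup>+x. ennreal (indicator A x *\<^sub>R f x) \<partial>M)"
    by (intro nn_integral_cong) (auto simp: indicator_def)
  also have "\<dots> = ennreal (LINT x:A|M. f x)"
    using assms unfolding set_lebesgue_integral_def set_integrable_def
    by (intro nn_integral_eq_integral) (auto simp: indicator_def)
  finally show ?thesis .
qed

lemma oscillation_nonneg: "0 < s \<Longrightarrow> 0 \<le> oscillation a s f"
  unfolding oscillation_def set_lebesgue_integral_def
  by (intro divide_nonneg_pos Bochner_Integration.integral_nonneg) auto

lemma sharp_maximal_term:
  fixes a :: "real^'n"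
  assumes "set_integrable lebesgue (cube a s) f" "0 < s"
  shows "(\<integral>\<^sup>+y\<in>cube a s. ennreal \<bar>f y - cube_average (cube a s) f\<bar> \<partial>lebesgue) / emeasure lebesgue (cube a s)
    = ennreal (oscillation a s f)"
proof -
  have "0 \<le> (LINT y:cube a s|lebesgue. \<bar>f y - cube_average (cube a s) f\<bar>)"
    unfolding set_lebesgue_integral_def by (intro Bochner_Integration.integral_nonneg) auto
  then show ?thesis
    using assms(2) set_nn_integral_eq_set_integral[OF set_integrable_dev[OF assms(1), of "cube_average (cube a s) f"]]
      emeasure_cube[of s a]
    by (simp add: oscillation_def divide_ennreal del: emeasure_completion)
qed

lemma sharp_maximal_eq:
  assumes "locally_integrable f"
  shows "sharp_maximal f x = (SUP (a, s)\<in>{(a, s). 0 < s \<and> x \<in> cube a s}. ennreal (oscillation a s f))"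
proof -
  have "{Q \<in> cubes. x \<in> Q} = (\<lambda>(a, s). cube a s) ` {(a, s). 0 < s \<and> x \<in> cube a s}"
    by (auto simp: cubes_eq image_iff)
  then show ?thesis
    unfolding sharp_maximal_def
    by (auto simp: image_image split_beta sharp_maximal_term[OF locally_integrable_cube[OF assms]]
      simp del: emeasure_completion intro!: SUP_cong)
qed

lemma oscillation_le_sharp_maximal:
  assumes "locally_integrable f" "0 < s" "x \<in> cube a s"
  shows "ennreal (oscillation a s f) \<le> sharp_maximal f x"
  unfolding sharp_maximal_eq[OF assms(1)] using assms by (intro SUP_upper2[of "(a, s)"]) auto

lemma sharp_maximal_le:
  assumes "locally_integrable f" "\<And>a s. 0 < s \<Longrightarrow> x \<in> cube a s \<Longrightarrow> oscillation a s f \<le> c"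
  shows "sharp_maximal f x \<le> ennreal c"
  unfolding sharp_maximal_eq[OF assms(1)] using assms(2) by (intro SUP_least) (auto intro!: ennreal_leI)

text \<open>Lets the product b f inside the second maximal function be computed with any measurable
  representative of b.\<close>

lemma sharp_maximal_cong_AE:
  fixes f g :: "real^'n \<Rightarrow> real"
  assumes "f \<in> borel_measurable lebesgue" "g \<in> borel_measurable lebesgue" "AE x in lebesgue. f x = g x"
  shows "sharp_maximal f x = sharp_maximal g x"
  unfolding sharp_maximal_def
proof (intro SUP_cong refl)
  fix Q :: "(real^'n) set" assume Q: "Q \<in> {Q \<in> cubes. x \<in> Q}"
  have "Q \<in> sets lebesgue" using Q by (auto simp: cubes_eq)
  then have "cube_average Q f = cube_average Q g"
    unfolding cube_average_def set_lebesgue_integral_def using assms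
    by (intro arg_cong2[where f="(/)"] integral_cong_AE) (auto intro!: borel_measurable_scaleR)
  then show "(\<integral>\<^sup>+y\<in>Q. ennreal \<bar>f y - cube_average Q f\<bar> \<partial>lebesgue) / emeasure lebesgue Q =
    (\<integral>\<^sup>+y\<in>Q. ennreal \<bar>g y - cube_average Q g\<bar> \<partial>lebesgue) / emeasure lebesgue Q"
    using assms(3) by (intro arg_cong2[where f="(/)"] nn_integral_cong_AE) auto
qed

lemma set_integral_abs_le:
  fixes f :: "'a \<Rightarrow> real"
  assumes "set_integrable M A f"
  shows "\<bar>LINT x:A|M. f x\<bar> \<le> (LINT x:A|M. \<bar>f x\<bar>)"
  using assms integral_abs_bound[of M "\<lambda>x. indicator A x *\<^sub>R f x"]
  unfolding set_lebesgue_integral_def by (simp add: abs_mult)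

text \<open>The factor 2 counts the difference of the functions once and the difference of their
  means once more.\<close>

lemma oscillation_diff_le:
  fixes a :: "real^'n"
  assumes f: "set_integrable lebesgue (cube a s) f" and g: "set_integrable lebesgue (cube a s) g" and s: "0 < s"
  shows "oscillation a s f \<le> oscillation a s g + 2 * (LINT y:cube a s|lebesgue. \<bar>f y - g y\<bar>) / s ^ CARD('n)"
proof -
  let ?Q = "cube a s"
  define \<phi> where "\<phi> = cube_average ?Q f"
  define \<gamma> where "\<gamma> = cube_average ?Q g"
  define I where "I = (LINT y:?Q|lebesgue. \<bar>f y - g y\<bar>)"
  have fg: "set_integrable lebesgue ?Q (\<lambda>y. f y - g y)" using f g by (rule set_integral_diff)
  have "\<phi> * s ^ CARD('n) - \<gamma> * s ^ CARD('n) = (LINT y:?Q|lebesgue. f y - g y)"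
    unfolding \<phi>_def \<gamma>_def set_integral_eq_cube_average[OF s, symmetric] using f g by simp
  then have "\<bar>\<phi> - \<gamma>\<bar> * s ^ CARD('n) \<le> I"
    using set_integral_abs_le[OF fg] s by (simp add: I_def left_diff_distrib[symmetric] abs_mult)
  note avg = this
  have "(LINT y:?Q|lebesgue. \<bar>f y - \<phi>\<bar>) \<le> (LINT y:?Q|lebesgue. \<bar>g y - \<gamma>\<bar> + (\<bar>f y - g y\<bar> + \<bar>\<phi> - \<gamma>\<bar>))"
    using f g fg by (intro set_integral_mono set_integral_add set_integrable_dev set_integrable_abs set_integrable_cube_const) auto
  also have "\<dots> = (LINT y:?Q|lebesgue. \<bar>g y - \<gamma>\<bar>) + (I + \<bar>\<phi> - \<gamma>\<bar> * s ^ CARD('n))"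
  proof -
    have 1: "set_integrable lebesgue ?Q (\<lambda>y. \<bar>g y - \<gamma>\<bar>)" using g by (rule set_integrable_dev)
    have 2: "set_integrable lebesgue ?Q (\<lambda>y. \<bar>f y - g y\<bar>)" using fg by (rule set_integrable_abs)
    have 3: "set_integrable lebesgue ?Q (\<lambda>y. \<bar>\<phi> - \<gamma>\<bar>)" by (rule set_integrable_cube_const)
    show ?thesis
      unfolding I_def set_integral_add(2)[OF 1 set_integral_add(1)[OF 2 3]] set_integral_add(2)[OF 2 3]
      using s by (simp add: set_integral_cube_const)
  qed
  also have "\<dots> \<le> (LINT y:?Q|lebesgue. \<bar>g y - \<gamma>\<bar>) + 2 * I"
    using avg by simp
  finally show ?thesis
    using s unfolding oscillation_def \<phi>_def[symmetric] \<gamma>_def[symmetric] I_def[symmetric]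
    by (simp add: add_divide_distrib[symmetric] divide_right_mono)
qed

lemma oscillation_zero: "oscillation a s (\<lambda>_. 0) = 0"
  by (simp add: oscillation_def cube_average_def)

lemma oscillation_cmult:
  assumes "set_integrable lebesgue (cube a s) f" "0 \<le> c"
  shows "oscillation a s (\<lambda>y. c * f y) = c * oscillation a s f"
proof -
  have "cube_average (cube a s) (\<lambda>y. c * f y) = c * cube_average (cube a s) f"
    by (simp add: cube_average_def)
  then have "\<bar>c * f y - cube_average (cube a s) (\<lambda>y. c * f y)\<bar> = c * \<bar>f y - cube_average (cube a s) f\<bar>" for y
    using assms(2) by (simp add: right_diff_distrib[symmetric] abs_mult)
  then show ?thesis by (simp add: oscillation_def)
qed

text \<open>The cubes are closed, so superlevel sets are not visibly open. But integrals over cubes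
  decreasing to Q converge, hence an oscillation exceeding t on Q also does so on some slightly
  larger cube, whose interior contains Q. This makes superlevel sets open.\<close>

lemma sharp_maximal_measurable:
  fixes f :: "real^'n \<Rightarrow> real"
  assumes f: "locally_integrable f"
  shows "sharp_maximal f \<in> borel_measurable lebesgue"
proof -
  have "sharp_maximal f \<in> borel_measurable borel"
  proof (rule borel_measurableI_greater)
    fix t
    have "open {x. t < sharp_maximal f x}"
    proof (subst open_subopen, rule ballI)
      fix x assume "x \<in> {x. t < sharp_maximal f x}"
      then obtain a s where s: "0 < s" and x: "x \<in> cube a s" and less: "t < ennreal (oscillation a s f)"
        by (auto simp: sharp_maximal_eq[OF f] less_SUP_iff)
      define \<tau> where "\<tau> = enn2real t"
      have "t < top" using less by (rule less_trans) simp
      then have t: "t = ennreal \<tau>" "0 \<le> \<tau>" by (auto simp: \<tau>_def)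
      have less': "\<tau> < oscillation a s f" using less t by (simp add: ennreal_less_iff)
      let ?Q = "cube a s"
      \<comment> \<open>Q enlarged by 1/(k+1) on every side; these cubes decrease to Q.\<close>
      define a' where "a' k = (\<chi> i. a $ i - inverse (real (Suc k)))" for k
      define s' where "s' k = s + 2 * inverse (real (Suc k))" for k
      define A where "A k = cube (a' k) (s' k)" for k
      have e0: "0 < inverse (real (Suc k))" for k by simp
      have s': "0 < s' k" for k using s e0[of k] by (simp add: s'_def add_pos_pos del: of_nat_Suc)
      have mem_A: "y \<in> A k \<longleftrightarrow> (\<forall>i. a $ i - inverse (real (Suc k)) \<le> y $ i \<and> y $ i \<le> a $ i + s + inverse (real (Suc k)))" for y k
        unfolding A_def mem_cube a'_def s'_def by (simp add: algebra_simps del: of_nat_Suc)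
      have QA: "?Q \<subseteq> A k" for k
      proof
        fix y assume "y \<in> ?Q"
        then show "y \<in> A k" unfolding mem_cube mem_A using e0[of k] by (metis add_increasing2 diff_left_mono diff_zero less_eq_real_def order_trans)
      qed
      have inv_le: "inverse (real (Suc l)) \<le> inverse (real (Suc k))" if "k \<le> l" for k l
        using that by (intro le_imp_inverse_le) auto
      have dec: "decseq A"
        unfolding decseq_def
      proof (intro allI impI subsetI)
        fix k l y assume "k \<le> l" "y \<in> A l"
        then show "y \<in> A k" unfolding mem_A using inv_le[OF \<open>k \<le> l\<close>] by (smt (verit))
      qed
      have Int: "(\<Inter>k. A k) = ?Q"
      proof
        show "?Q \<subseteq> (\<Inter>k. A k)" using QA by blast
        show "(\<Inter>k. A k) \<subseteq> ?Q"
        proof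
          fix y assume y: "y \<in> (\<Inter>k. A k)"
          have lim: "(\<lambda>k. inverse (real (Suc k))) \<longlonglongrightarrow> 0" by (rule LIMSEQ_inverse_real_of_nat)
          show "y \<in> ?Q" unfolding mem_cube
          proof (intro allI conjI)
            fix i
            have "(\<lambda>k. a $ i - inverse (real (Suc k))) \<longlonglongrightarrow> a $ i - 0" by (intro tendsto_diff tendsto_const lim)
            then show "a $ i \<le> y $ i"
              using y by (intro LIMSEQ_le_const2[of _ "a $ i"]) (auto simp: mem_A simp del: of_nat_Suc)
            have "(\<lambda>k. a $ i + s + inverse (real (Suc k))) \<longlonglongrightarrow> a $ i + s + 0" by (intro tendsto_add tendsto_const lim)
            then show "y $ i \<le> a $ i + s"
              using y by (intro LIMSEQ_le_const[of _ "a $ i + s"]) (auto simp: mem_A simp del: of_nat_Suc)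
          qed
        qed
      qed
      have int_lim: "(\<lambda>k. LINT y:A k|lebesgue. f y) \<longlonglongrightarrow> (LINT y:?Q|lebesgue. f y)"
        unfolding Int[symmetric]
        by (rule set_integral_cont_down[OF _ dec]) (auto simp: A_def locally_integrable_cube[OF f])
      have s'_lim: "s' \<longlonglongrightarrow> s"
      proof -
        have "(\<lambda>k. s + 2 * inverse (real (Suc k))) \<longlonglongrightarrow> s + 2 * 0"
          by (intro tendsto_intros LIMSEQ_inverse_real_of_nat)
        then show ?thesis unfolding s'_def[abs_def] by (simp only: mult_zero_right add_0_right)
      qed
      define \<phi> where "\<phi> = cube_average ?Q f"
      define \<phi>' where "\<phi>' k = cube_average (A k) f" for k
      have "(\<lambda>k. (LINT y:A k|lebesgue. f y) / s' k ^ CARD('n)) \<longlonglongrightarrow> (LINT y:?Q|lebesgue. f y) / s ^ CARD('n)"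
        using s by (intro tendsto_divide int_lim tendsto_power s'_lim) auto
      moreover have "(LINT y:A k|lebesgue. f y) / s' k ^ CARD('n) = \<phi>' k" for k
        using s'[of k] by (simp add: \<phi>'_def A_def set_integral_eq_cube_average)
      moreover have "(LINT y:?Q|lebesgue. f y) / s ^ CARD('n) = \<phi>"
        using s by (simp add: \<phi>_def set_integral_eq_cube_average)
      ultimately have \<phi>'_lim: "\<phi>' \<longlonglongrightarrow> \<phi>" by simp
      define J where "J = (LINT y:?Q|lebesgue. \<bar>f y - \<phi>\<bar>)"
      \<comment> \<open>A lower bound suffices: discarding the part outside Q and correcting the
        mean leaves an expression that converges to the oscillation over Q.\<close>
      have lower: "(J - \<bar>\<phi>' k - \<phi>\<bar> * s ^ CARD('n)) / s' k ^ CARD('n) \<le> oscillation (a' k) (s' k) f" for k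
      proof -
        have "J \<le> (LINT y:?Q|lebesgue. \<bar>f y - \<phi>' k\<bar> + \<bar>\<phi>' k - \<phi>\<bar>)"
          unfolding J_def by (intro set_integral_mono set_integral_add set_integrable_dev set_integrable_cube_const
              locally_integrable_cube[OF f]) auto
        also have "\<dots> = (LINT y:?Q|lebesgue. \<bar>f y - \<phi>' k\<bar>) + \<bar>\<phi>' k - \<phi>\<bar> * s ^ CARD('n)"
          using s by (subst set_integral_add(2)) (auto simp: set_integral_cube_const set_integrable_cube_const
              intro!: set_integrable_dev locally_integrable_cube[OF f])
        also have "(LINT y:?Q|lebesgue. \<bar>f y - \<phi>' k\<bar>) \<le> (LINT y:A k|lebesgue. \<bar>f y - \<phi>' k\<bar>)"
          unfolding set_lebesgue_integral_def
        proof (rule integral_mono)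
          show "integrable lebesgue (\<lambda>y. indicator ?Q y *\<^sub>R \<bar>f y - \<phi>' k\<bar>)"
            using set_integrable_dev[OF locally_integrable_cube[OF f]] unfolding set_integrable_def .
          show "integrable lebesgue (\<lambda>y. indicator (A k) y *\<^sub>R \<bar>f y - \<phi>' k\<bar>)"
            unfolding A_def using set_integrable_dev[OF locally_integrable_cube[OF f]] unfolding set_integrable_def .
        qed (use QA[of k] in \<open>auto simp: indicator_def\<close>)
        finally have "J - \<bar>\<phi>' k - \<phi>\<bar> * s ^ CARD('n) \<le> (LINT y:A k|lebesgue. \<bar>f y - \<phi>' k\<bar>)" by simp
        then show ?thesis
          using s'[of k] unfolding oscillation_def A_def[symmetric] \<phi>'_def[symmetric] by (intro divide_right_mono) auto
      qed
      have "(\<lambda>k. (J - \<bar>\<phi>' k - \<phi>\<bar> * s ^ CARD('n)) / s' k ^ CARD('n)) \<longlonglongrightarrow> (J - \<bar>\<phi> - \<phi>\<bar> * s ^ CARD('n)) / s ^ CARD('n)"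
        using s by (intro tendsto_divide tendsto_diff tendsto_mult tendsto_rabs tendsto_const tendsto_power \<phi>'_lim s'_lim) auto
      moreover have "(J - \<bar>\<phi> - \<phi>\<bar> * s ^ CARD('n)) / s ^ CARD('n) = oscillation a s f"
        by (simp add: oscillation_def J_def \<phi>_def)
      ultimately have "\<forall>\<^sub>F k in sequentially. \<tau> < (J - \<bar>\<phi>' k - \<phi>\<bar> * s ^ CARD('n)) / s' k ^ CARD('n)"
        using less' by (intro order_tendstoD(1)) auto
      then obtain k where "\<tau> < (J - \<bar>\<phi>' k - \<phi>\<bar> * s ^ CARD('n)) / s' k ^ CARD('n)"
        using eventually_happens by force
      then have k: "\<tau> < oscillation (a' k) (s' k) f" using lower[of k] by linarith
      define U where "U = box (a' k) (\<chi> i. a' k $ i + s' k)"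
      have "x \<in> U"
        unfolding U_def mem_box_cart
      proof (intro allI)
        fix i
        have "a $ i \<le> x $ i" "x $ i \<le> a $ i + s" using x by (auto simp: mem_cube)
        with e0[of k] show "a' k $ i < x $ i \<and> x $ i < (\<chi> i. a' k $ i + s' k) $ i"
          unfolding a'_def s'_def vec_lambda_beta by linarith
      qed
      moreover have "U \<subseteq> {x. t < sharp_maximal f x}"
      proof
        fix y assume "y \<in> U"
        then have "y \<in> cube (a' k) (s' k)" unfolding U_def using box_subset_cbox by blast
        have "ennreal \<tau> < ennreal (oscillation (a' k) (s' k) f)" using k t by (simp add: ennreal_less_iff)
        also have "\<dots> \<le> sharp_maximal f y"
          by (rule oscillation_le_sharp_maximal[OF f s' \<open>y \<in> cube (a' k) (s' k)\<close>])
        finally show "y \<in> {x. t < sharp_maximal f x}" by (simp add: t)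
      qed
      ultimately show "\<exists>T. open T \<and> x \<in> T \<and> T \<subseteq> {x. t < sharp_maximal f x}"
        using open_box[of "a' k" "\<chi> i. a' k $ i + s' k"] unfolding U_def by blast
    qed
    then show "{x \<in> space borel. t < sharp_maximal f x} \<in> sets borel" by simp
  qed
  then show ?thesis by (intro measurable_completion) simp
qed

text \<open>Because b(x) \<ge> 0, the factor b(x) can be moved inside the sharp maximal function of
  f. On each cube the oscillations of b(x) f and of b f then differ by at most 2 G in both
  directions, and so do the suprema.\<close>

lemma sharp_commutator_pointwise:
  fixes b f :: "real^'n \<Rightarrow> real"
  assumes f: "locally_integrable f" and bf: "locally_integrable (\<lambda>y. b y * f y)" and bx: "0 \<le> b x"
    and fin: "sharp_maximal f x < \<infinity>" and G: "0 \<le> G"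
      "\<And>a s. 0 < s \<Longrightarrow> x \<in> cube a s \<Longrightarrow> (LINT y:cube a s|lebesgue. \<bar>b x * f y - b y * f y\<bar>) \<le> G * s ^ CARD('n)"
  shows "sharp_commutator_defined b f x" "\<bar>sharp_commutator b f x\<bar> \<le> 2 * G"
proof -
  define m where "m = enn2real (sharp_maximal f x)"
  have m: "sharp_maximal f x = ennreal m" "0 \<le> m" using fin by (auto simp: m_def)
  have osc: "oscillation a s (\<lambda>y. b y * f y) \<le> b x * oscillation a s f + 2 * G"
    "b x * oscillation a s f \<le> oscillation a s (\<lambda>y. b y * f y) + 2 * G" if s: "0 < s" and x: "x \<in> cube a s" for a s
  proof -
    have int: "set_integrable lebesgue (cube a s) f" "set_integrable lebesgue (cube a s) (\<lambda>y. b x * f y)"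
      "set_integrable lebesgue (cube a s) (\<lambda>y. b y * f y)"
      using f bf by (auto intro!: locally_integrable_cube set_integrable_mult_right)
    have le: "2 * (LINT y:cube a s|lebesgue. \<bar>b x * f y - b y * f y\<bar>) / s ^ CARD('n) \<le> 2 * G"
      using G(2)[OF s x] s by (simp add: pos_divide_le_eq)
    show "oscillation a s (\<lambda>y. b y * f y) \<le> b x * oscillation a s f + 2 * G"
      using oscillation_diff_le[OF int(3,2) s] le oscillation_cmult[OF int(1) bx]
      by (simp add: abs_minus_commute)
    show "b x * oscillation a s f \<le> oscillation a s (\<lambda>y. b y * f y) + 2 * G"
      using oscillation_diff_le[OF int(2,3) s] le oscillation_cmult[OF int(1) bx] by simp
  qed
  have osc_m: "oscillation a s f \<le> m" if "0 < s" "x \<in> cube a s" for a s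
    using oscillation_le_sharp_maximal[OF f that] m by simp
  have up: "sharp_maximal (\<lambda>y. b y * f y) x \<le> ennreal (b x * m + 2 * G)"
    by (rule sharp_maximal_le[OF bf]) (use osc(1) osc_m bx in \<open>force intro: order_trans mult_left_mono\<close>)
  define m' where "m' = enn2real (sharp_maximal (\<lambda>y. b y * f y) x)"
  have "sharp_maximal (\<lambda>y. b y * f y) x < top" using up by (rule le_less_trans) simp
  then have m': "sharp_maximal (\<lambda>y. b y * f y) x = ennreal m'" "0 \<le> m'" by (auto simp: m'_def)
  show "sharp_commutator_defined b f x"
    using m m' f bf by (auto simp: sharp_commutator_defined_def sharp_maximal_defined_def cubes_eq intro!: locally_integrable_cube)
  have 1: "m' \<le> b x * m + 2 * G"
    using up bx m(2) G(1) unfolding m'(1) by (subst (asm) ennreal_le_iff) auto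
  have osc_m': "oscillation a s (\<lambda>y. b y * f y) \<le> m'" if "0 < s" "x \<in> cube a s" for a s
    using oscillation_le_sharp_maximal[OF bf that] m' by simp
  have 2: "b x * m \<le> m' + 2 * G"
  proof (cases "b x = 0")
    case True
    then show ?thesis using m' G by simp
  next
    case False
    then have b: "0 < b x" using bx by simp
    have "sharp_maximal f x \<le> ennreal ((m' + 2 * G) / b x)"
    proof (rule sharp_maximal_le[OF f])
      fix a s assume as: "0 < s" "x \<in> cube a s"
      show "oscillation a s f \<le> (m' + 2 * G) / b x"
        using osc(2)[OF as] osc_m'[OF as] b by (simp add: pos_le_divide_eq mult.commute)
    qed
    then have "m \<le> (m' + 2 * G) / b x" using m m' G b by (simp add: ennreal_le_iff)
    then show ?thesis using b by (simp add: pos_le_divide_eq mult.commute)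
  qed
  show "\<bar>sharp_commutator b f x\<bar> \<le> 2 * G"
    unfolding sharp_commutator_def m_def[symmetric] m'_def[symmetric] using 1 2 by linarith
qed

subsection \<open>Boundedness of the commutator\<close>

lemma locally_integrable_measurable:
  fixes f :: "real^'n \<Rightarrow> real"
  assumes "locally_integrable f"
  shows "f \<in> borel_measurable lebesgue"
proof (rule borel_measurable_LIMSEQ_real)
  show "(\<lambda>k. indicator (cball 0 (real k)) x * f x) \<longlonglongrightarrow> f x" for x
  proof (rule tendsto_eventually)
    obtain N where "norm x \<le> real N" using real_arch_simple by blast
    then show "\<forall>\<^sub>F k in sequentially. indicator (cball 0 (real k)) x * f x = f x"
      by (intro eventually_sequentiallyI[of N]) (auto simp: indicator_def)
  qed
  have "integrable lebesgue (\<lambda>x. indicator (cball 0 (real k)) x *\<^sub>R f x)" for k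
    using assms compact_cball[of 0 "real k"] unfolding locally_integrable_def set_integrable_def by blast
  then show "(\<lambda>x. indicator (cball 0 (real k)) x * f x) \<in> borel_measurable lebesgue" for k
    using borel_measurable_integrable by fastforce
qed

lemma locally_integrable_cong_AE:
  fixes f g :: "real^'n \<Rightarrow> real"
  assumes f: "locally_integrable f" and g: "g \<in> borel_measurable lebesgue" and eq: "AE x in lebesgue. f x = g x"
  shows "locally_integrable g"
  unfolding locally_integrable_def
proof (intro allI impI)
  fix K :: "(real^'n) set" assume K: "compact K"
  then have "K \<in> sets lebesgue" using lmeasurable_compact by blast
  have AE_K: "AE x\<in>K in lebesgue. f x = g x" using eq by eventually_elim simp
  have "set_integrable lebesgue K f" using f K by (simp add: locally_integrable_def)
  then show "set_integrable lebesgue K g"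
    using set_integrable_cong_AE[OF locally_integrable_measurable[OF f] g AE_K \<open>K \<in> sets lebesgue\<close>] by simp
qed

text \<open>As r \<ge> 1, |f|/l is at most 1 + (|f|/l)^r, and both summands have finite integral
  over a compact set.\<close>

lemma locally_integrable_var_Lp:
  fixes r f :: "real^'n \<Rightarrow> real"
  assumes r: "\<And>x. 1 \<le> r x" and r_meas[measurable]: "r \<in> borel_measurable lebesgue" and f: "f \<in> var_Lp r"
  shows "locally_integrable f"
  unfolding locally_integrable_def
proof (intro allI impI)
  fix K :: "(real^'n) set" assume "compact K"
  then have K: "K \<in> lmeasurable" by (rule lmeasurable_compact)
  obtain l where l: "0 < l" and fin: "var_modular r (\<lambda>x. \<bar>f x\<bar> / l) < \<infinity>"
    and f_meas[measurable]: "f \<in> borel_measurable lebesgue"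
    using f by (auto simp: var_Lp_def)
  have K'[measurable]: "K \<in> sets lebesgue" using K by blast
  show "set_integrable lebesgue K f"
    unfolding set_integrable_def
  proof (rule integrableI_bounded)
    show "(\<lambda>x. indicator K x *\<^sub>R f x) \<in> borel_measurable lebesgue" by measurable
    have "(\<integral>\<^sup>+x. ennreal (norm (indicator K x *\<^sub>R f x)) \<partial>lebesgue) \<le>
        (\<integral>\<^sup>+x. ennreal l * (indicator K x + ennreal (\<bar>\<bar>f x\<bar> / l\<bar> powr r x)) \<partial>lebesgue)"
    proof (intro nn_integral_mono)
      fix x
      have "\<bar>f x\<bar> / l \<le> 1 + \<bar>\<bar>f x\<bar> / l\<bar> powr r x"
        using le_plus_powr[of "\<bar>f x\<bar> / l" 1 "r x"] r[of x] l by simp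
      then have "\<bar>f x\<bar> \<le> l * (1 + \<bar>\<bar>f x\<bar> / l\<bar> powr r x)"
        using l by (simp add: pos_divide_le_eq mult.commute)
      then have "ennreal \<bar>f x\<bar> \<le> ennreal l * (1 + ennreal (\<bar>\<bar>f x\<bar> / l\<bar> powr r x))"
        using l by (simp add: ennreal_mult[symmetric] ennreal_1[symmetric] ennreal_plus[symmetric] ennreal_leI
            del: ennreal_plus ennreal_1)
      then show "ennreal (norm (indicator K x *\<^sub>R f x)) \<le> ennreal l * (indicator K x + ennreal (\<bar>\<bar>f x\<bar> / l\<bar> powr r x))"
        by (auto simp: indicator_def)
    qed
    also have "\<dots> = ennreal l * (emeasure lebesgue K + var_modular r (\<lambda>x. \<bar>f x\<bar> / l))"
      unfolding var_modular_def by (subst nn_integral_cmult) (auto simp: nn_integral_add simp del: emeasure_completion)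
    also have "\<dots> < \<infinity>"
      using fin K by (auto simp: ennreal_mult_less_top fmeasurable_def simp del: emeasure_completion)
    finally show "(\<integral>\<^sup>+x. ennreal (norm (indicator K x *\<^sub>R f x)) \<partial>lebesgue) < \<infinity>" .
  qed
qed

lemma var_lipschitz_constant:
  assumes "b \<in> var_lipschitz \<delta>"
  obtains C where "0 \<le> C" "\<And>x y. \<bar>b x - b y\<bar> \<le> C * norm (x - y) powr \<delta> x"
proof -
  obtain C where C: "\<And>x y. \<bar>b x - b y\<bar> \<le> C * norm (x - y) powr \<delta> x"
    using assms by (auto simp: var_lipschitz_def)
  have "\<bar>b x - b y\<bar> \<le> max 0 C * norm (x - y) powr \<delta> x" for x y
    by (rule order_trans[OF C]) (simp add: mult_right_mono)
  then show ?thesis by (intro that[of "max 0 C"]) auto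
qed

lemma var_lipschitz_continuous:
  assumes "b \<in> var_lipschitz \<delta>" "\<And>x. 0 < \<delta> x"
  shows "continuous_on UNIV b"
proof -
  obtain C where C: "0 \<le> C" "\<And>x y. \<bar>b x - b y\<bar> \<le> C * norm (x - y) powr \<delta> x"
    by (rule var_lipschitz_constant[OF assms(1)]) (rule that, assumption, blast)
  have "(b \<longlongrightarrow> b x) (at x)" for x
  proof (rule Lim_null[THEN iffD2], rule Lim_null_comparison)
    show "\<forall>\<^sub>F y in at x. norm (b y - b x) \<le> C * norm (x - y) powr \<delta> x"
      using C(2)[of x] by (auto simp: abs_minus_commute)
    have "((\<lambda>y. C * norm (x - y) powr \<delta> x) \<longlongrightarrow> C * norm (x - x) powr \<delta> x) (at x)"
      using assms(2)[of x] by (intro tendsto_mult tendsto_const tendsto_powr' tendsto_norm tendsto_diff tendsto_ident_at) auto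
    then show "((\<lambda>y. C * norm (x - y) powr \<delta> x) \<longlongrightarrow> 0) (at x)" by simp
  qed
  then show ?thesis by (auto simp: continuous_on_def)
qed

lemma continuous_on_measurable_lebesgue:
  fixes b :: "real^'n \<Rightarrow> real"
  assumes "continuous_on UNIV b" shows "b \<in> borel_measurable lebesgue"
  using borel_measurable_continuous_onI[OF assms] by (intro measurable_completion) simp

lemma locally_integrable_continuous_mult:
  fixes b f :: "real^'n \<Rightarrow> real"
  assumes b: "continuous_on UNIV b" and f: "locally_integrable f"
  shows "locally_integrable (\<lambda>y. b y * f y)"
  unfolding locally_integrable_def
proof (intro allI impI)
  fix K :: "(real^'n) set" assume K: "compact K"
  have K': "K \<in> sets lebesgue" using K lmeasurable_compact by blast
  have "bounded (b ` K)"
    using K b by (intro compact_imp_bounded compact_continuous_image) (auto intro: continuous_on_subset)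
  then obtain B where B: "\<And>y. y \<in> K \<Longrightarrow> \<bar>b y\<bar> \<le> B" by (auto simp: bounded_iff)
  have fK: "set_integrable lebesgue K f" using f K by (simp add: locally_integrable_def)
  show "set_integrable lebesgue K (\<lambda>y. b y * f y)"
  proof (rule set_integrable_bound)
    show "set_integrable lebesgue K (\<lambda>y. B * f y)" using fK by (rule set_integrable_mult_right)
    show "set_borel_measurable lebesgue K (\<lambda>y. b y * f y)"
      using K' continuous_on_measurable_lebesgue[OF b] locally_integrable_measurable[OF f]
      unfolding set_borel_measurable_def by measurable
    show "AE y in lebesgue. y \<in> K \<longrightarrow> norm (b y * f y) \<le> norm (B * f y)"
    proof (intro AE_I2 impI)
      fix y assume "y \<in> K"
      then have "\<bar>b y\<bar> \<le> \<bar>B\<bar>" using B[of y] by linarith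
      then show "norm (b y * f y) \<le> norm (B * f y)" by (simp add: abs_mult mult_right_mono)
    qed
  qed
qed

lemma var_modular_scale_le:
  assumes r: "\<And>x. 1 \<le> r x" and c: "1 \<le> c" and l: "0 < l" and meas[measurable]: "r \<in> borel_measurable lebesgue" "f \<in> borel_measurable lebesgue"
  shows "var_modular r (\<lambda>x. \<bar>f x\<bar> / (c * l)) \<le> ennreal (1 / c) * var_modular r (\<lambda>x. \<bar>f x\<bar> / l)"
proof -
  have "var_modular r (\<lambda>x. \<bar>f x\<bar> / (c * l)) \<le> (\<integral>\<^sup>+x. ennreal (1 / c) * ennreal (\<bar>\<bar>f x\<bar> / l\<bar> powr r x) \<partial>lebesgue)"
    unfolding var_modular_def
  proof (intro nn_integral_mono)
    fix x
    have "\<bar>\<bar>f x\<bar> / (c * l)\<bar> powr r x = (1 / c) powr r x * \<bar>\<bar>f x\<bar> / l\<bar> powr r x"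
      using c l by (subst powr_mult[symmetric]) auto
    also have "(1 / c) powr r x \<le> (1 / c) powr 1"
      using c r[of x] by (intro powr_mono') auto
    finally have "\<bar>\<bar>f x\<bar> / (c * l)\<bar> powr r x \<le> 1 / c * \<bar>\<bar>f x\<bar> / l\<bar> powr r x"
      using c by (simp add: mult_right_mono)
    then show "ennreal (\<bar>\<bar>f x\<bar> / (c * l)\<bar> powr r x) \<le> ennreal (1 / c) * ennreal (\<bar>\<bar>f x\<bar> / l\<bar> powr r x)"
      using c by (simp add: ennreal_mult[symmetric] ennreal_leI)
  qed
  also have "\<dots> = ennreal (1 / c) * var_modular r (\<lambda>x. \<bar>f x\<bar> / l)"
    unfolding var_modular_def by (intro nn_integral_cmult) measurable
  finally show ?thesis .
qed

text \<open>Ensures that the infimum in \<open>var_Lp_norm\<close> is not over the empty set. As r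
  \<ge> 1, enlarging the scale by c = max 1 m brings a finite modular m down to at most m /
  c.\<close>

lemma var_Lp_unit_scale_exists:
  assumes r: "\<And>x. 1 \<le> r x" "r \<in> borel_measurable lebesgue" and f: "f \<in> var_Lp r"
  shows "\<exists>l. 0 < l \<and> var_modular r (\<lambda>x. \<bar>f x\<bar> / l) \<le> 1"
proof -
  obtain l where l: "0 < l" and fin: "var_modular r (\<lambda>x. \<bar>f x\<bar> / l) < \<infinity>" and meas: "f \<in> borel_measurable lebesgue"
    using f by (auto simp: var_Lp_def)
  define m where "m = enn2real (var_modular r (\<lambda>x. \<bar>f x\<bar> / l))"
  have m: "var_modular r (\<lambda>x. \<bar>f x\<bar> / l) = ennreal m" "0 \<le> m" using fin by (auto simp: m_def)
  define c where "c = max 1 m"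
  have c: "1 \<le> c" "m \<le> c" by (auto simp: c_def)
  have "var_modular r (\<lambda>x. \<bar>f x\<bar> / (c * l)) \<le> ennreal (1 / c) * ennreal m"
    using var_modular_scale_le[OF r(1) c(1) l r(2) meas] m by simp
  also have "\<dots> = ennreal (m / c)" using c m by (simp add: ennreal_mult[symmetric])
  also have "\<dots> \<le> 1" using c by (simp add: ennreal_le_1)
  finally show ?thesis using l c by (intro exI[of _ "c * l"]) auto
qed

text \<open>Each scale l admissible for f makes L K l admissible for the commutator, so the norm
  inequality follows by taking infima. The representative b' replaces b inside the maximal function
  up to a null set, and as the outer factor at almost every x.\<close>

lemma sharp_commutator_bounded:
  fixes r q \<delta> b :: "real^'n \<Rightarrow> real"
  assumes r: "log_hoelder_with C rinf r" "r \<in> borel_measurable lebesgue" "\<And>y. c \<le> r y" "\<And>y. r y \<le> \<sigma>" and c: "1 < c"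
    and q: "\<And>x. 1 \<le> q x" "\<And>x. q x \<le> \<tau>" "q \<in> borel_measurable lebesgue"
    and \<delta>: "\<And>x. 0 < \<delta> x" "\<And>x. \<delta> x \<le> \<Delta>" "\<And>x. \<delta> x \<le> real CARD('n)"
    and rq: "\<And>x. 1 / r x - 1 / q x = \<delta> x / real CARD('n)" and \<Delta>: "rinf * \<Delta> < real CARD('n)"
    and b: "locally_integrable b" and b': "AE x in lebesgue. b' x = b x" "b' \<in> var_lipschitz \<delta>" "\<And>x. 0 \<le> b' x"
  shows "bounded_operator (sharp_commutator_defined b) (sharp_commutator b) r q"
proof -
  define n where "n = real CARD('n)"
  obtain K where K: "1 \<le> K" and majorant:
    "\<And>f. f \<in> borel_measurable lebesgue \<Longrightarrow> (\<And>y. 0 \<le> f y) \<Longrightarrow> (\<integral>\<^sup>+y. ennreal (f y powr r y) \<partial>lebesgue) \<le> 1 \<Longrightarrow>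
      \<exists>W. W \<in> borel_measurable lebesgue \<and> (\<forall>x. 0 \<le> W x) \<and> (\<integral>\<^sup>+y. ennreal (W y) \<partial>lebesgue) \<le> ennreal K \<and>
        (AE x in lebesgue. \<forall>a \<rho>. 0 < \<rho> \<and> x \<in> ball a \<rho> \<longrightarrow>
          (\<integral>\<^sup>+y\<in>ball a \<rho>. ennreal (f y) \<partial>lebesgue) \<le> ennreal (\<rho> ^ CARD('n) * W x powr (1 / r x)) \<and>
          (\<integral>\<^sup>+y\<in>ball a \<rho>. ennreal (f y) \<partial>lebesgue) \<le> ennreal (\<rho> ^ CARD('n) * (\<rho> powr - \<delta> x * W x powr (1 / q x))))"
    by (rule fractional_maximal_majorant[OF r c q(1,2) \<delta> rq \<Delta>]) (rule that, assumption, blast)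
  obtain B where B: "0 \<le> B" "\<And>x y. \<bar>b' x - b' y\<bar> \<le> B * norm (x - y) powr \<delta> x"
    by (rule var_lipschitz_constant[OF b'(2)]) (rule that, assumption, blast)
  have b'_cont: "continuous_on UNIV b'" using var_lipschitz_continuous[OF b'(2) \<delta>(1)] .
  have r1: "1 \<le> r y" for y using r(3)[of y] c by linarith
  \<comment> \<open>A cube of side s lies in a ball of radius (n + 1) s; N is the ratio of the n-th
    powers of these two lengths.\<close>
  define N where "N = (n + 1) ^ CARD('n)"
  have N: "0 < N" by (simp add: N_def n_def add_nonneg_pos)
  \<comment> \<open>The part 2 B N comes from \<open>sharp_commutator_pointwise\<close>; the summand
    1 keeps L positive also when B = 0, since L is divided by below.\<close>
  define L where "L = 2 * (B * N) + 1"
  have L: "0 < L" using B N by (simp add: L_def add_nonneg_pos)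
  have main: "(AE x in lebesgue. sharp_commutator_defined b f x) \<and> sharp_commutator b f \<in> borel_measurable lebesgue \<and>
      var_modular q (\<lambda>x. \<bar>sharp_commutator b f x\<bar> / (L * K * l)) \<le> 1"
    if f: "f \<in> var_Lp r" and l: "0 < l" "var_modular r (\<lambda>x. \<bar>f x\<bar> / l) \<le> 1" for f l
  proof -
    have f_meas[measurable]: "f \<in> borel_measurable lebesgue" using f by (auto simp: var_Lp_def)
    have f_loc: "locally_integrable f" using locally_integrable_var_Lp[OF r1 r(2) f] .
    have b'f: "locally_integrable (\<lambda>y. b' y * f y)"
      using locally_integrable_continuous_mult[OF b'_cont f_loc] .
    have bf_eq: "AE y in lebesgue. b' y * f y = b y * f y" using b'(1) by eventually_elim simp
    have b_meas[measurable]: "b \<in> borel_measurable lebesgue" using locally_integrable_measurable[OF b] .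
    have bf_meas: "(\<lambda>y. b y * f y) \<in> borel_measurable lebesgue" by measurable
    have bf: "locally_integrable (\<lambda>y. b y * f y)"
      using locally_integrable_cong_AE[OF b'f bf_meas bf_eq] .
    have bf_sharp: "sharp_maximal (\<lambda>y. b y * f y) = sharp_maximal (\<lambda>y. b' y * f y)"
      using sharp_maximal_cong_AE[OF locally_integrable_measurable[OF b'f] bf_meas bf_eq] by (simp add: fun_eq_iff)
    have "\<exists>W. W \<in> borel_measurable lebesgue \<and> (\<forall>x. 0 \<le> W x) \<and> (\<integral>\<^sup>+y. ennreal (W y) \<partial>lebesgue) \<le> ennreal K \<and>
        (AE x in lebesgue. \<forall>a \<rho>. 0 < \<rho> \<and> x \<in> ball a \<rho> \<longrightarrow>
          (\<integral>\<^sup>+y\<in>ball a \<rho>. ennreal (\<bar>f y\<bar> / l) \<partial>lebesgue) \<le> ennreal (\<rho> ^ CARD('n) * W x powr (1 / r x)) \<and>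
          (\<integral>\<^sup>+y\<in>ball a \<rho>. ennreal (\<bar>f y\<bar> / l) \<partial>lebesgue) \<le> ennreal (\<rho> ^ CARD('n) * (\<rho> powr - \<delta> x * W x powr (1 / q x))))"
    proof (rule majorant)
      show "(\<integral>\<^sup>+y. ennreal ((\<bar>f y\<bar> / l) powr r y) \<partial>lebesgue) \<le> 1"
        using l by (simp add: var_modular_def)
    qed (use l in auto)
    then obtain W where W: "W \<in> borel_measurable lebesgue" "\<And>x. 0 \<le> W x" "(\<integral>\<^sup>+y. ennreal (W y) \<partial>lebesgue) \<le> ennreal K"
      and W_AE: "AE x in lebesgue. \<forall>a \<rho>. 0 < \<rho> \<and> x \<in> ball a \<rho> \<longrightarrow>
          (\<integral>\<^sup>+y\<in>ball a \<rho>. ennreal (\<bar>f y\<bar> / l) \<partial>lebesgue) \<le> ennreal (\<rho> ^ CARD('n) * W x powr (1 / r x)) \<and>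
          (\<integral>\<^sup>+y\<in>ball a \<rho>. ennreal (\<bar>f y\<bar> / l) \<partial>lebesgue) \<le> ennreal (\<rho> ^ CARD('n) * (\<rho> powr - \<delta> x * W x powr (1 / q x)))"
      by blast
    have pointwise: "AE x in lebesgue. sharp_commutator_defined b f x \<and>
        \<bar>sharp_commutator b f x\<bar> \<le> L * l * W x powr (1 / q x)"
      using W_AE b'(1)
    proof eventually_elim
      fix x
      assume balls: "\<forall>a \<rho>. 0 < \<rho> \<and> x \<in> ball a \<rho> \<longrightarrow>
          (\<integral>\<^sup>+y\<in>ball a \<rho>. ennreal (\<bar>f y\<bar> / l) \<partial>lebesgue) \<le> ennreal (\<rho> ^ CARD('n) * W x powr (1 / r x)) \<and>
          (\<integral>\<^sup>+y\<in>ball a \<rho>. ennreal (\<bar>f y\<bar> / l) \<partial>lebesgue) \<le> ennreal (\<rho> ^ CARD('n) * (\<rho> powr - \<delta> x * W x powr (1 / q x)))"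
        and bx: "b' x = b x"
      have avg: "(LINT y:cube a s|lebesgue. \<bar>f y\<bar>) \<le> l * (N * s ^ CARD('n) * W x powr (1 / r x))"
        "(LINT y:cube a s|lebesgue. \<bar>f y\<bar>) \<le> l * (N * s ^ CARD('n) * (((n + 1) * s) powr - \<delta> x * W x powr (1 / q x)))"
        if s: "0 < s" and x: "x \<in> cube a s" for a s
      proof -
        define \<rho> where "\<rho> = (n + 1) * s"
        have \<rho>: "0 < \<rho>" using s by (simp add: \<rho>_def n_def)
        have sub: "cube a s \<subseteq> ball a \<rho>" using cube_subset_ball[OF s, of a] by (simp add: \<rho>_def n_def)
        have int: "set_integrable lebesgue (cube a s) (\<lambda>y. \<bar>f y\<bar> / l)"
          using f_loc by (intro set_integrable_divide set_integrable_abs locally_integrable_cube)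
        have le: "ennreal ((LINT y:cube a s|lebesgue. \<bar>f y\<bar>) / l) \<le> (\<integral>\<^sup>+y\<in>ball a \<rho>. ennreal (\<bar>f y\<bar> / l) \<partial>lebesgue)"
        proof -
          have "ennreal ((LINT y:cube a s|lebesgue. \<bar>f y\<bar>) / l) = (\<integral>\<^sup>+y\<in>cube a s. ennreal (\<bar>f y\<bar> / l) \<partial>lebesgue)"
            using set_nn_integral_eq_set_integral[OF int] l by simp
          also have "\<dots> \<le> (\<integral>\<^sup>+y\<in>ball a \<rho>. ennreal (\<bar>f y\<bar> / l) \<partial>lebesgue)"
            using sub by (intro nn_integral_mono) (auto simp: indicator_def)
          finally show ?thesis .
        qed
        have real_le: "(LINT y:cube a s|lebesgue. \<bar>f y\<bar>) \<le> l * z"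
          if "(\<integral>\<^sup>+y\<in>ball a \<rho>. ennreal (\<bar>f y\<bar> / l) \<partial>lebesgue) \<le> ennreal z" "0 \<le> z" for z
        proof -
          have "ennreal ((LINT y:cube a s|lebesgue. \<bar>f y\<bar>) / l) \<le> ennreal z" using le that(1) by (rule order_trans)
          then have "(LINT y:cube a s|lebesgue. \<bar>f y\<bar>) / l \<le> z" using that(2) by (simp add: ennreal_le_iff)
          then show ?thesis using l by (simp add: pos_divide_le_eq mult.commute)
        qed
        have \<rho>n: "\<rho> ^ CARD('n) = N * s ^ CARD('n)" by (simp add: \<rho>_def N_def power_mult_distrib)
        have xB: "x \<in> ball a \<rho>" using x sub by blast
        show "(LINT y:cube a s|lebesgue. \<bar>f y\<bar>) \<le> l * (N * s ^ CARD('n) * W x powr (1 / r x))"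
          using real_le balls \<rho> xB N s unfolding \<rho>n[symmetric] by (auto intro!: real_le)
        show "(LINT y:cube a s|lebesgue. \<bar>f y\<bar>) \<le> l * (N * s ^ CARD('n) * (((n + 1) * s) powr - \<delta> x * W x powr (1 / q x)))"
          using balls \<rho> xB unfolding \<rho>n[symmetric] \<rho>_def[symmetric] by (auto intro!: real_le)
      qed
      have fin: "sharp_maximal f x < \<infinity>"
      proof (rule le_less_trans)
        show "sharp_maximal f x \<le> ennreal (2 * (l * (N * W x powr (1 / r x))))"
        proof (rule sharp_maximal_le[OF f_loc])
          fix a s assume s: "0 < s" and x: "x \<in> cube a s"
          have "oscillation a s f \<le> oscillation a s (\<lambda>_. 0) + 2 * (LINT y:cube a s|lebesgue. \<bar>f y - 0\<bar>) / s ^ CARD('n)"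
            by (rule oscillation_diff_le[OF locally_integrable_cube[OF f_loc] set_integrable_cube_const s])
          also have "\<dots> \<le> 2 * (l * (N * W x powr (1 / r x)))"
            using avg(1)[OF s x] s by (simp add: oscillation_zero pos_divide_le_eq mult_ac)
          finally show "oscillation a s f \<le> 2 * (l * (N * W x powr (1 / r x)))" .
        qed
      qed simp
      have "(LINT y:cube a s|lebesgue. \<bar>b' x * f y - b' y * f y\<bar>) \<le> (B * N * l * W x powr (1 / q x)) * s ^ CARD('n)"
        if s: "0 < s" and x: "x \<in> cube a s" for a s
      proof -
        define \<rho> where "\<rho> = (n + 1) * s"
        have \<rho>: "0 < \<rho>" using s by (simp add: \<rho>_def n_def)
        \<comment> \<open>On the cube |x - y| \<le> \<rho>, so the Lipschitz bound contributes
          \<rho>^\<delta>(x), exactly the power that the second bound of the majorant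
          compensates.\<close>
        have "(LINT y:cube a s|lebesgue. \<bar>b' x * f y - b' y * f y\<bar>) \<le> (LINT y:cube a s|lebesgue. B * \<rho> powr \<delta> x * \<bar>f y\<bar>)"
        proof (rule set_integral_mono)
          show "set_integrable lebesgue (cube a s) (\<lambda>y. \<bar>b' x * f y - b' y * f y\<bar>)"
            using f_loc b'f by (intro set_integrable_abs set_integral_diff set_integrable_mult_right locally_integrable_cube)
          show "set_integrable lebesgue (cube a s) (\<lambda>y. B * \<rho> powr \<delta> x * \<bar>f y\<bar>)"
            using f_loc by (intro set_integrable_abs set_integrable_mult_right locally_integrable_cube)
          fix y assume "y \<in> cube a s"
          then have "norm (x - y) \<le> \<rho>" using norm_diff_le_cube[OF x, of y] s by (simp add: \<rho>_def n_def algebra_simps)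
          then have "norm (x - y) powr \<delta> x \<le> \<rho> powr \<delta> x" using \<delta>(1)[of x] by (intro powr_mono2) auto
          then have "\<bar>b' x - b' y\<bar> \<le> B * \<rho> powr \<delta> x" using B mult_left_mono by (meson order_trans)
          then show "\<bar>b' x * f y - b' y * f y\<bar> \<le> B * \<rho> powr \<delta> x * \<bar>f y\<bar>"
            unfolding left_diff_distrib[symmetric] abs_mult by (rule mult_right_mono) simp
        qed
        also have "\<dots> = B * \<rho> powr \<delta> x * (LINT y:cube a s|lebesgue. \<bar>f y\<bar>)" by simp
        also have "\<dots> \<le> B * \<rho> powr \<delta> x * (l * (N * s ^ CARD('n) * (\<rho> powr - \<delta> x * W x powr (1 / q x))))"
          using avg(2)[OF s x] B unfolding \<rho>_def by (intro mult_left_mono) auto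
        also have "\<dots> = (B * N * l * W x powr (1 / q x)) * s ^ CARD('n)"
          using \<rho> by (simp add: powr_minus)
        finally show ?thesis .
      qed
      moreover have "0 \<le> B * N * l * W x powr (1 / q x)" using B N l by simp
      ultimately have *: "sharp_commutator_defined b' f x" "\<bar>sharp_commutator b' f x\<bar> \<le> 2 * (B * N * l * W x powr (1 / q x))"
        using sharp_commutator_pointwise[OF f_loc b'f b'(3) fin] by blast+
      have "sharp_commutator_defined b f x"
        using *(1) bf bf_sharp by (auto simp: sharp_commutator_defined_def sharp_maximal_defined_def cubes_eq intro: locally_integrable_cube)
      moreover have "\<bar>sharp_commutator b f x\<bar> \<le> L * l * W x powr (1 / q x)"
      proof -
        have "\<bar>sharp_commutator b f x\<bar> \<le> 2 * (B * N * l * W x powr (1 / q x))"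
          using *(2) bx bf_sharp by (simp add: sharp_commutator_def)
        also have "\<dots> \<le> L * l * W x powr (1 / q x)" using l by (simp add: L_def algebra_simps)
        finally show ?thesis .
      qed
      ultimately show "sharp_commutator_defined b f x \<and> \<bar>sharp_commutator b f x\<bar> \<le> L * l * W x powr (1 / q x)" by blast
    qed
    have meas: "sharp_commutator b f \<in> borel_measurable lebesgue"
    proof -
      have [measurable]: "sharp_maximal f \<in> borel_measurable lebesgue" "sharp_maximal (\<lambda>y. b y * f y) \<in> borel_measurable lebesgue"
        using sharp_maximal_measurable f_loc bf by auto
      show ?thesis unfolding sharp_commutator_def[abs_def] by measurable
    qed
    have "var_modular q (\<lambda>x. \<bar>sharp_commutator b f x\<bar> / (L * K * l)) \<le> (\<integral>\<^sup>+x. ennreal (1 / K) * ennreal (W x) \<partial>lebesgue)"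
      unfolding var_modular_def
    proof (rule nn_integral_mono_AE, rule AE_mp[OF pointwise], intro AE_I2 impI)
      fix x assume "sharp_commutator_defined b f x \<and> \<bar>sharp_commutator b f x\<bar> \<le> L * l * W x powr (1 / q x)"
      then have le: "\<bar>sharp_commutator b f x\<bar> \<le> L * l * W x powr (1 / q x)" by blast
      have "\<bar>sharp_commutator b f x\<bar> / (L * K * l) \<le> W x powr (1 / q x) / K"
        using le L l K by (simp add: field_simps)
      then have "(\<bar>sharp_commutator b f x\<bar> / (L * K * l)) powr q x \<le> (W x powr (1 / q x) / K) powr q x"
        using L l K q(1)[of x] by (intro powr_mono2) auto
      also have "\<dots> = (1 / K) powr q x * W x"
        using K q(1)[of x] W(2)[of x] by (simp add: powr_divide powr_powr)
      \<comment> \<open>Since q \<ge> 1 and K \<ge> 1, the power (1/K)^q still gains the factor 1/K,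
        which brings the integral of \<open>W\<close> down to at most 1.\<close>
      also have "\<dots> \<le> (1 / K) powr 1 * W x"
        using K q(1)[of x] W(2)[of x] by (intro mult_right_mono powr_mono') auto
      finally have "\<bar>\<bar>sharp_commutator b f x\<bar> / (L * K * l)\<bar> powr q x \<le> 1 / K * W x"
        using L l K by simp
      then show "ennreal (\<bar>\<bar>sharp_commutator b f x\<bar> / (L * K * l)\<bar> powr q x) \<le> ennreal (1 / K) * ennreal (W x)"
        using K W(2)[of x] by (simp add: ennreal_mult[symmetric] ennreal_leI)
    qed
    also have "\<dots> = ennreal (1 / K) * (\<integral>\<^sup>+x. ennreal (W x) \<partial>lebesgue)"
      using W(1) by (intro nn_integral_cmult) measurable
    also have "\<dots> \<le> ennreal (1 / K) * ennreal K" by (intro mult_left_mono W) auto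
    also have "\<dots> = 1" using K by (simp add: ennreal_mult[symmetric])
    finally show ?thesis using pointwise meas by (auto elim: eventually_mono)
  qed
  show ?thesis
    unfolding bounded_operator_def
  proof (intro exI[of _ "L * K"] ballI conjI)
    fix f assume f: "f \<in> var_Lp r"
    obtain l where l: "0 < l" "var_modular r (\<lambda>x. \<bar>f x\<bar> / l) \<le> 1"
      using var_Lp_unit_scale_exists[OF r1 r(2) f] by blast
    have LK: "0 < L * K" using L K by simp
    note m = main[OF f l]
    show "AE x in lebesgue. sharp_commutator_defined b f x" using m by blast
    have "0 < L * K * l" using LK l by simp
    then show "sharp_commutator b f \<in> var_Lp q"
      using m by (auto simp: var_Lp_def intro!: exI[of _ "L * K * l"] elim: le_less_trans)
    let ?S = "{l. 0 < l \<and> var_modular r (\<lambda>x. \<bar>f x\<bar> / l) \<le> 1}"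
    have "var_Lp_norm q (sharp_commutator b f) / (L * K) \<le> Inf ?S"
    proof (rule cInf_greatest)
      show "?S \<noteq> {}" using l by blast
      fix l' assume l': "l' \<in> ?S"
      then have "var_modular q (\<lambda>x. \<bar>sharp_commutator b f x\<bar> / (L * K * l')) \<le> 1" "0 < L * K * l'"
        using main[OF f, of l'] LK by auto
      then have "var_Lp_norm q (sharp_commutator b f) \<le> L * K * l'"
        unfolding var_Lp_norm_def by (intro cInf_lower) (auto intro!: bdd_belowI[of _ 0])
      then show "var_Lp_norm q (sharp_commutator b f) / (L * K) \<le> l'"
        using LK by (simp add: pos_divide_le_eq mult.commute)
    qed
    then show "var_Lp_norm q (sharp_commutator b f) \<le> L * K * var_Lp_norm r f"
      using LK by (simp add: var_Lp_norm_def[of r] pos_divide_le_eq mult.commute)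
  qed
qed

subsection \<open>Campanato estimates\<close>

lemma set_integral_mono_set:
  fixes f :: "'a \<Rightarrow> real"
  assumes "set_integrable M A f" "B \<in> sets M" "B \<subseteq> A" "\<And>x. x \<in> A \<Longrightarrow> 0 \<le> f x"
  shows "(LINT x:B|M. f x) \<le> (LINT x:A|M. f x)"
proof -
  have B: "set_integrable M B f" using set_integrable_subset[OF assms(1-3)] .
  show ?thesis
    using assms B unfolding set_lebesgue_integral_def set_integrable_def
    by (intro integral_mono) (auto simp: indicator_def)
qed

text \<open>Averaging the deviation from the mean over the smaller cube and then enlarging the
  domain of integration costs the ratio of the volumes.\<close>

lemma cube_average_diff_le:
  fixes b :: "real^'n \<Rightarrow> real"
  assumes b: "locally_integrable b" and sub: "cube a' s' \<subseteq> cube a s" and s: "0 < s'" "0 < s"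
  shows "\<bar>cube_average (cube a' s') b - cube_average (cube a s) b\<bar> \<le> (s / s') ^ CARD('n) * oscillation a s b"
proof -
  define c where "c = cube_average (cube a s) b"
  have int: "set_integrable lebesgue (cube a' s') (\<lambda>y. b y - c)"
    by (intro set_integral_diff locally_integrable_cube b set_integrable_cube_const)
  have "(cube_average (cube a' s') b - c) * s' ^ CARD('n) = (LINT y:cube a' s'|lebesgue. b y - c)"
    unfolding set_integral_diff(2)[OF locally_integrable_cube[OF b] set_integrable_cube_const]
    using set_integral_cube_const[where s=s' and a=a' and c=c] set_integral_eq_cube_average[OF s(1), of a' b] s
    by (simp only: left_diff_distrib less_imp_le)
  then have "\<bar>cube_average (cube a' s') b - c\<bar> * s' ^ CARD('n) = \<bar>LINT y:cube a' s'|lebesgue. b y - c\<bar>"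
    using s by (metis abs_mult abs_of_pos zero_less_power)
  also have "\<dots> \<le> (LINT y:cube a' s'|lebesgue. \<bar>b y - c\<bar>)" by (rule set_integral_abs_le[OF int])
  also have "\<dots> \<le> (LINT y:cube a s|lebesgue. \<bar>b y - c\<bar>)"
    by (rule set_integral_mono_set[OF set_integrable_dev[OF locally_integrable_cube[OF b]] _ sub]) auto
  also have "\<dots> = oscillation a s b * s ^ CARD('n)" using s by (simp add: oscillation_def c_def)
  finally have "\<bar>cube_average (cube a' s') b - c\<bar> \<le> oscillation a s b * s ^ CARD('n) / s' ^ CARD('n)"
    using s by (simp add: pos_le_divide_eq)
  then show ?thesis by (simp add: c_def power_divide mult.commute)
qed

lemma cube_grid_cover:
  fixes a :: "real^'n" and N :: nat
  assumes N: "0 < N" and L: "0 < L"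
  shows "cube a L \<subseteq> (\<Union>i\<in>(UNIV :: 'n set) \<rightarrow>\<^sub>E {..<N}. cube (\<chi> j. a $ j + real (i j) * (L / N)) (L / N))"
proof
  fix x assume x: "x \<in> cube a L"
  define h where "h = L / real N"
  have h: "0 < h" "real N * h = L" using N L by (auto simp: h_def)
  \<comment> \<open>The cap N - 1 puts the points of the far face, where the floor equals N, into
    the last cell.\<close>
  define i where "i j = min (N - 1) (nat \<lfloor>(x $ j - a $ j) / h\<rfloor>)" for j
  have i: "i j < N" for j using N by (auto simp: i_def)
  have mem: "a $ j + real (i j) * h \<le> x $ j \<and> x $ j \<le> a $ j + real (i j) * h + h" for j
  proof -
    define z where "z = (x $ j - a $ j) / h"
    have "a $ j \<le> x $ j" "x $ j - a $ j \<le> real N * h"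
      using x[unfolded mem_cube, THEN spec, of j] h(2) by auto
    then have z: "0 \<le> z" "z \<le> real N" using h by (simp_all add: z_def pos_divide_le_eq)
    have xz: "x $ j = a $ j + z * h" using h by (simp add: z_def)
    have 1: "real (i j) \<le> z"
    proof -
      have "real (i j) \<le> real (nat \<lfloor>z\<rfloor>)" by (simp add: i_def z_def)
      also have "\<dots> \<le> z" using z by (simp add: of_nat_nat)
      finally show ?thesis .
    qed
    have 2: "z \<le> real (i j) + 1"
    proof (cases "nat \<lfloor>z\<rfloor> \<le> N - 1")
      case True
      then have "i j = nat \<lfloor>z\<rfloor>" by (simp add: i_def z_def)
      then have "real (i j) = of_int \<lfloor>z\<rfloor>" using z by (simp add: of_nat_nat)
      then show ?thesis by linarith
    next
      case False
      then have "i j = N - 1" by (simp add: i_def z_def)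
      then show ?thesis using z N by (simp add: of_nat_diff)
    qed
    show ?thesis unfolding xz using mult_right_mono[OF 1, of h] mult_right_mono[OF 2, of h] h by (simp add: algebra_simps)
  qed
  show "x \<in> (\<Union>i\<in>UNIV \<rightarrow>\<^sub>E {..<N}. cube (\<chi> j. a $ j + real (i j) * (L / N)) (L / N))"
    unfolding h_def[symmetric]
  proof (rule UN_I[of i])
    show "i \<in> UNIV \<rightarrow>\<^sub>E {..<N}" using i by auto
    show "x \<in> cube (\<chi> j. a $ j + real (i j) * h) h" unfolding mem_cube using mem by simp
  qed
qed

text \<open>Cut a cube of side L into N^n cells: the volume factors add up to L^n, while the extra
  power leaves (L/N)^d, which tends to 0. This takes the place of Lebesgue's differentiation theorem
  in identifying b with the limit of its averages.\<close>

lemma AE_eq_of_cube_integral_le: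
  fixes g :: "real^'n \<Rightarrow> real"
  assumes g: "g \<in> borel_measurable lebesgue" and d: "0 < d" and C: "0 \<le> C"
    and le: "\<And>a s. 0 < s \<Longrightarrow> s \<le> 1 \<Longrightarrow> (\<integral>\<^sup>+y\<in>cube a s. ennreal \<bar>g y\<bar> \<partial>lebesgue) \<le> ennreal (C * s ^ CARD('n) * s powr d)"
  shows "AE x in lebesgue. g x = 0"
proof -
  note g[measurable]
  have zero: "(\<integral>\<^sup>+y\<in>cube a L. ennreal \<bar>g y\<bar> \<partial>lebesgue) = 0" if L: "0 < L" for a L
  proof -
    have bound: "(\<integral>\<^sup>+y\<in>cube a L. ennreal \<bar>g y\<bar> \<partial>lebesgue) \<le> ennreal (C * L ^ CARD('n) * (L / real N) powr d)"
      if N: "0 < N" "L \<le> real N" for N :: nat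
    proof -
      let ?I = "(UNIV :: 'n set) \<rightarrow>\<^sub>E {..<N}"
      let ?Q = "\<lambda>i. cube (\<chi> j. a $ j + real (i j) * (L / N)) (L / N)"
      have fin: "finite ?I" by (intro finite_PiE) auto
      have card: "card ?I = N ^ CARD('n)" by (subst card_PiE) auto
      have "(\<integral>\<^sup>+y\<in>cube a L. ennreal \<bar>g y\<bar> \<partial>lebesgue) \<le> (\<integral>\<^sup>+y. (\<Sum>i\<in>?I. ennreal \<bar>g y\<bar> * indicator (?Q i) y) \<partial>lebesgue)"
      proof (intro nn_integral_mono)
        fix y
        show "ennreal \<bar>g y\<bar> * indicator (cube a L) y \<le> (\<Sum>i\<in>?I. ennreal \<bar>g y\<bar> * indicator (?Q i) y)"
        proof (cases "y \<in> cube a L")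
          case True
          then obtain i where "i \<in> ?I" "y \<in> ?Q i" using cube_grid_cover[OF N(1) L, of a] by blast
          then have "ennreal \<bar>g y\<bar> \<le> ennreal \<bar>g y\<bar> * indicator (?Q i) y" by simp
          also have "\<dots> \<le> (\<Sum>i\<in>?I. ennreal \<bar>g y\<bar> * indicator (?Q i) y)"
            using \<open>i \<in> ?I\<close> fin by (intro member_le_sum) auto
          finally show ?thesis using True by simp
        qed simp
      qed
      also have "\<dots> = (\<Sum>i\<in>?I. \<integral>\<^sup>+y\<in>?Q i. ennreal \<bar>g y\<bar> \<partial>lebesgue)"
        by (intro nn_integral_sum borel_measurable_times_ennreal borel_measurable_indicator) auto
      also have "\<dots> \<le> (\<Sum>i\<in>?I. ennreal (C * (L / N) ^ CARD('n) * (L / N) powr d))"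
        using N L by (intro sum_mono le) auto
      also have "\<dots> = ennreal (real (N ^ CARD('n)) * (C * (L / N) ^ CARD('n) * (L / N) powr d))"
        by (simp add: card ennreal_mult' ennreal_of_nat_eq_real_of_nat)
      also have "real (N ^ CARD('n)) * (C * (L / N) ^ CARD('n) * (L / N) powr d) = C * L ^ CARD('n) * (L / N) powr d"
        using N by (simp add: power_divide)
      finally show ?thesis .
    qed
    have "(\<lambda>N. (L / real N) powr d) \<longlonglongrightarrow> 0 powr d"
    proof (rule tendsto_powr'[OF lim_const_over_n tendsto_const])
      have "\<forall>\<^sub>F N in sequentially. 0 \<le> L / real N" using L by (intro always_eventually allI) simp
      then show "(0::real) \<noteq> 0 \<or> 0 < d \<and> (\<forall>\<^sub>F N in sequentially. 0 \<le> L / real N)" using d by blast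
    qed
    then have "(\<lambda>N. ennreal (C * L ^ CARD('n) * (L / real N) powr d)) \<longlonglongrightarrow> ennreal (C * L ^ CARD('n) * 0)"
      by (intro tendsto_ennrealI tendsto_mult tendsto_const) simp
    moreover have "\<exists>M. \<forall>N\<ge>M. (\<integral>\<^sup>+y\<in>cube a L. ennreal \<bar>g y\<bar> \<partial>lebesgue) \<le> ennreal (C * L ^ CARD('n) * (L / real N) powr d)"
    proof -
      obtain M where M: "L \<le> real M" using real_arch_simple by blast
      show ?thesis
      proof (intro exI[of _ "M + 1"] allI impI)
        fix N assume "M + 1 \<le> N"
        then have "0 < N" "L \<le> real N" using M by auto
        then show "(\<integral>\<^sup>+y\<in>cube a L. ennreal \<bar>g y\<bar> \<partial>lebesgue) \<le> ennreal (C * L ^ CARD('n) * (L / real N) powr d)"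
          by (rule bound)
      qed
    qed
    ultimately have "(\<integral>\<^sup>+y\<in>cube a L. ennreal \<bar>g y\<bar> \<partial>lebesgue) \<le> ennreal (C * L ^ CARD('n) * 0)"
      by (rule LIMSEQ_le_const)
    then show ?thesis by simp
  qed
  have "AE x in lebesgue. \<forall>k::nat. ennreal \<bar>g x\<bar> * indicator (cube (\<chi> i. - real (Suc k)) (2 * real (Suc k))) x = 0"
    unfolding AE_all_countable
  proof
    fix k
    let ?Q = "cube (\<chi> i. - real (Suc k)) (2 * real (Suc k)) :: (real^'n) set"
    have "(\<lambda>x. ennreal \<bar>g x\<bar> * indicator ?Q x) \<in> borel_measurable lebesgue"
      by (intro borel_measurable_times_ennreal borel_measurable_indicator) auto
    from nn_integral_0_iff_AE[OF this] zero[of "2 * real (Suc k)" "\<chi> i. - real (Suc k)"]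
    show "AE x in lebesgue. ennreal \<bar>g x\<bar> * indicator ?Q x = 0"
      by (simp only: of_nat_0_less_iff zero_less_mult_iff zero_less_numeral zero_less_Suc simp_thms)
  qed
  then show ?thesis
  proof eventually_elim
    fix x assume all: "\<forall>k::nat. ennreal \<bar>g x\<bar> * indicator (cube (\<chi> i. - real (Suc k)) (2 * real (Suc k))) x = 0"
    obtain k :: nat where k: "norm x \<le> real k" using real_arch_simple by blast
    have "x \<in> cube (\<chi> i. - real (Suc k)) (2 * real (Suc k))"
      unfolding mem_cube
    proof
      fix i
      have "\<bar>x $ i\<bar> \<le> real k" using component_le_norm_cart[of x i] k by linarith
      then show "(\<chi> i. - real (Suc k)) $ i \<le> x $ i \<and> x $ i \<le> (\<chi> i. - real (Suc k)) $ i + 2 * real (Suc k)"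
        by (simp add: abs_le_iff)
    qed
    then show "g x = 0" using all[THEN spec, of k] by simp
  qed
qed

text \<open>Campanato's argument for a gauge \<phi> that depends on the point. The premise
  \<open>shrink\<close> makes the telescoping differences of averages summable, and
  \<open>double\<close> pays for passing from cubes with corner x to arbitrary cubes containing x.
  The representative is the limit of the averages over cubes with lowest corner x.\<close>

lemma campanato_representative:
  fixes b :: "real^'n \<Rightarrow> real" and \<phi> :: "real^'n \<Rightarrow> real \<Rightarrow> real"
  assumes b: "locally_integrable b" and C: "0 \<le> C" and d: "0 < d"
    and osc: "\<And>a s x. 0 < s \<Longrightarrow> x \<in> cube a s \<Longrightarrow> oscillation a s b \<le> C * \<phi> x s"
    and \<phi>0: "\<And>x s. 0 < s \<Longrightarrow> 0 \<le> \<phi> x s"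
    and shrink: "\<And>x s \<theta>. 0 < s \<Longrightarrow> 0 < \<theta> \<Longrightarrow> \<theta> \<le> 1 \<Longrightarrow> \<phi> x (\<theta> * s) \<le> \<theta> powr d * \<phi> x s"
    and double: "\<And>x s. 0 < s \<Longrightarrow> \<phi> x (2 * s) \<le> M * \<phi> x s" and M: "0 \<le> M"
    and one: "\<And>x. \<phi> x 1 \<le> 1"
  obtains b' C' where "AE x in lebesgue. b' x = b x" "0 \<le> C'"
    "\<forall>x a s. 0 < s \<longrightarrow> x \<in> cube a s \<longrightarrow> \<bar>b' x - cube_average (cube a s) b\<bar> \<le> C' * \<phi> x s"
    "\<forall>x y. x \<noteq> y \<longrightarrow> \<bar>b' x - b' y\<bar> \<le> C' * (\<phi> x (norm (x - y)) + \<phi> y (norm (x - y)))"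
proof -
  define n2 :: real where "n2 = 2 ^ CARD('n)"
  define A where "A x t = cube_average (cube x t) b" for x t
  \<comment> \<open>The sum of the geometric series with first term n2 C and ratio 2^(-d); the fixed
    point equation S 2^(-d) + n2 C = S is the induction step of \<open>chain\<close>.\<close>
  define S where "S = n2 * C / (1 - 2 powr - d)"
  have q: "0 < 1 - 2 powr - d" "2 powr - d < 1" using d by (auto simp: powr_less_one)
  have S: "0 \<le> S" "n2 * C \<le> S" "S * 2 powr - d + n2 * C = S"
  proof -
    show "0 \<le> S" using q C by (simp add: S_def n2_def)
    have "S * (1 - 2 powr - d) = n2 * C" using q d by (simp add: S_def)
    then show eq: "S * 2 powr - d + n2 * C = S" by (simp add: right_diff_distrib)
    have "0 \<le> S * 2 powr - d" using \<open>0 \<le> S\<close> by simp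
    then show "n2 * C \<le> S" using eq by linarith
  qed
  have self: "x \<in> cube x t" if "0 \<le> t" for x :: "real^'n" and t using that by (simp add: mem_cube)
  have half: "\<bar>A x u - A x t\<bar> \<le> n2 * C * \<phi> x t" if "0 < u" "u \<le> t" "t \<le> 2 * u" for x u t
  proof -
    have t: "0 < t" using that by linarith
    have "cube x u \<subseteq> cube x t" using that by (auto simp: mem_cube) (smt (verit))
    then have "\<bar>A x u - A x t\<bar> \<le> (t / u) ^ CARD('n) * oscillation x t b"
      unfolding A_def using that t by (intro cube_average_diff_le b) auto
    also have "\<dots> \<le> 2 ^ CARD('n) * (C * \<phi> x t)"
      using that t osc[OF t self] oscillation_nonneg[OF t, of x b]
      by (intro mult_mono power_mono) (auto simp: pos_divide_le_eq)
    finally show ?thesis by (simp add: n2_def)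
  qed
  have chain: "\<bar>A x u - A x t\<bar> \<le> S * \<phi> x t" if "0 < u" "u \<le> t" "t \<le> 2 ^ k * u" for x u t k
    using that
  proof (induction k arbitrary: t)
    case 0
    then have "u = t" by simp
    then show ?case using S \<phi>0[of t x] 0 by simp
  next
    case (Suc k)
    have t: "0 < t" using Suc.prems by linarith
    show ?case
    proof (cases "t \<le> 2 * u")
      case True
      then have "\<bar>A x u - A x t\<bar> \<le> n2 * C * \<phi> x t" using half Suc.prems by blast
      also have "\<dots> \<le> S * \<phi> x t" using S \<phi>0[OF t] by (intro mult_right_mono) auto
      finally show ?thesis .
    next
      case False
      have "\<bar>A x u - A x (t / 2)\<bar> \<le> S * \<phi> x (t / 2)" using Suc False by auto
      also have "\<dots> \<le> S * (2 powr - d * \<phi> x t)"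
        using shrink[OF t, of "1/2" x] S(1) by (intro mult_left_mono) (auto simp: powr_minus powr_divide inverse_eq_divide)
      finally have "\<bar>A x u - A x t\<bar> \<le> S * 2 powr - d * \<phi> x t + n2 * C * \<phi> x t"
        using half[of "t / 2" t x] t by simp
      also have "\<dots> = (S * 2 powr - d + n2 * C) * \<phi> x t" by (simp add: distrib_right)
      finally show ?thesis unfolding S(3) .
    qed
  qed
  have A_diff: "\<bar>A x u - A x t\<bar> \<le> S * \<phi> x t" if "0 < u" "u \<le> t" for x u t
  proof -
    obtain k where "t / u < 2 ^ k" using real_arch_pow[of 2 "t / u"] by auto
    then have "t \<le> 2 ^ k * u" using that by (simp add: pos_divide_less_eq less_imp_le)
    then show ?thesis using chain that by blast
  qed
  define e where "e k = inverse (real (Suc k))" for k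
  have e: "0 < e k" "e k \<le> 1" for k by (auto simp: e_def inverse_le_1_iff simp del: of_nat_Suc)
  have e_lim: "e \<longlonglongrightarrow> 0" unfolding e_def[abs_def] by (rule LIMSEQ_inverse_real_of_nat)
  have \<phi>_small: "\<phi> x s \<le> s powr d" if "0 < s" "s \<le> 1" for x s
  proof -
    have "\<phi> x s \<le> s powr d * \<phi> x 1" using shrink[of 1 s x] that by simp
    also have "\<dots> \<le> s powr d * 1" by (intro mult_left_mono one) auto
    finally show ?thesis by simp
  qed
  have ed_lim: "(\<lambda>k. e k powr d) \<longlonglongrightarrow> 0"
    using tendsto_powr'[OF e_lim tendsto_const[of d]] d e by (auto simp: less_imp_le)
  define b' where "b' x = lim (\<lambda>k. A x (e k))" for x
  have conv: "(\<lambda>k. A x (e k)) \<longlonglongrightarrow> b' x" for x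
  proof -
    have "Cauchy (\<lambda>k. A x (e k))"
    proof (rule metric_CauchyI)
      fix \<epsilon> :: real assume \<epsilon>: "0 < \<epsilon>"
      have "(\<lambda>k. S * e k powr d) \<longlonglongrightarrow> S * 0" by (intro tendsto_mult tendsto_const ed_lim)
      then have "\<forall>\<^sub>F k in sequentially. S * e k powr d < \<epsilon> / 2" using \<epsilon> by (intro order_tendstoD(2)) auto
      then obtain K where K: "S * e K powr d < \<epsilon> / 2" using eventually_happens by force
      have near: "\<bar>A x (e k) - A x (e K)\<bar> < \<epsilon> / 2" if "K \<le> k" for k
      proof -
        have "e k \<le> e K" unfolding e_def using that by (intro le_imp_inverse_le) auto
        then have "\<bar>A x (e k) - A x (e K)\<bar> \<le> S * \<phi> x (e K)" using A_diff e by blast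
        also have "\<dots> \<le> S * e K powr d" using S \<phi>_small[OF e] by (intro mult_left_mono) auto
        finally show ?thesis using K by linarith
      qed
      show "\<exists>M. \<forall>m\<ge>M. \<forall>n\<ge>M. dist (A x (e m)) (A x (e n)) < \<epsilon>"
      proof (intro exI[of _ K] allI impI)
        fix m n assume "K \<le> m" "K \<le> n"
        then show "dist (A x (e m)) (A x (e n)) < \<epsilon>" using near[of m] near[of n] unfolding dist_real_def by linarith
      qed
    qed
    then show ?thesis unfolding b'_def by (simp add: Cauchy_convergent convergent_LIMSEQ_iff[symmetric])
  qed
  have b'_A: "\<bar>b' x - A x t\<bar> \<le> S * \<phi> x t" if t: "0 < t" for x t
  proof (rule LIMSEQ_le_const2)
    show "(\<lambda>k. \<bar>A x (e k) - A x t\<bar>) \<longlonglongrightarrow> \<bar>b' x - A x t\<bar>"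
      by (intro tendsto_rabs tendsto_diff tendsto_const conv)
    have "\<forall>\<^sub>F k in sequentially. e k < t" using e_lim t by (intro order_tendstoD(2)) auto
    then obtain N where "\<And>k. N \<le> k \<Longrightarrow> e k < t" unfolding eventually_sequentially by blast
    then show "\<exists>N. \<forall>k\<ge>N. \<bar>A x (e k) - A x t\<bar> \<le> S * \<phi> x t" using A_diff e by (meson less_imp_le)
  qed
  define C' where "C' = S + 2 * (n2 * (C * M))"
  have n2: "0 \<le> n2" by (simp add: n2_def)
  have C': "0 \<le> C'" using S n2 C M by (simp add: C'_def)
  have approx: "\<bar>b' x - cube_average (cube a s) b\<bar> \<le> C' * \<phi> x s" if s: "0 < s" and x: "x \<in> cube a s" for x a s
  proof -
    have s2: "0 < 2 * s" using s by simp
    \<comment> \<open>The doubled cube contains both the given cube and the cube of side s with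
      corner x, so the two averages can be compared through its average.\<close>
    have sub: "cube a s \<subseteq> cube a (2 * s)" "cube x s \<subseteq> cube a (2 * s)"
      using x s unfolding mem_cube subset_iff by (smt (verit))+
    have x2: "x \<in> cube a (2 * s)" using sub x by blast
    have "n2 * oscillation a (2 * s) b \<le> n2 * (C * (M * \<phi> x s))"
      using order_trans[OF osc[OF s2 x2] mult_left_mono[OF double[OF s] C]] n2 by (intro mult_left_mono) auto
    moreover have "\<bar>A x s - cube_average (cube a (2 * s)) b\<bar> \<le> n2 * oscillation a (2 * s) b"
      "\<bar>cube_average (cube a s) b - cube_average (cube a (2 * s)) b\<bar> \<le> n2 * oscillation a (2 * s) b"
      using cube_average_diff_le[OF b sub(1) s s2] cube_average_diff_le[OF b sub(2) s s2] s by (simp_all add: A_def n2_def)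
    ultimately have "\<bar>b' x - cube_average (cube a s) b\<bar> \<le> S * \<phi> x s + 2 * (n2 * (C * (M * \<phi> x s)))"
      using b'_A[OF s, of x] by linarith
    also have "\<dots> = C' * \<phi> x s" by (simp add: C'_def algebra_simps)
    finally show ?thesis .
  qed
  have two: "\<bar>b' x - b' y\<bar> \<le> C' * (\<phi> x (norm (x - y)) + \<phi> y (norm (x - y)))" if "x \<noteq> y" for x y
  proof -
    define t where "t = norm (x - y)"
    have t: "0 < t" using that by (simp add: t_def)
    \<comment> \<open>The coordinatewise minimum: the cube of side |x - y| with this corner contains
      both points.\<close>
    define a :: "real^'n" where "a = (\<chi> i. min (x $ i) (y $ i))"
    have comp: "\<bar>x $ i - y $ i\<bar> \<le> t" for i using component_le_norm_cart[of "x - y" i] by (simp add: t_def)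
    have "x \<in> cube a t" "y \<in> cube a t" unfolding mem_cube a_def using comp t by (auto simp: min_def) (smt (verit))+
    then have "\<bar>b' x - cube_average (cube a t) b\<bar> \<le> C' * \<phi> x t" "\<bar>b' y - cube_average (cube a t) b\<bar> \<le> C' * \<phi> y t"
      using approx[OF t] by auto
    then show ?thesis unfolding t_def[symmetric] distrib_left by linarith
  qed
  have cont: "continuous_on UNIV b'"
  proof -
    have "(b' \<longlongrightarrow> b' x) (at x)" for x
    proof (rule Lim_null[THEN iffD2], rule Lim_null_comparison)
      have "\<forall>\<^sub>F y in at x. dist y x < 1" by (auto simp: eventually_at intro!: exI[of _ 1])
      moreover have "\<forall>\<^sub>F y in at x. y \<noteq> x" by (simp add: eventually_at_filter)
      ultimately show "\<forall>\<^sub>F y in at x. norm (b' y - b' x) \<le> C' * (norm (x - y) powr d + norm (x - y) powr d)"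
      proof eventually_elim
        case (elim y)
        then have t: "0 < norm (x - y)" "norm (x - y) \<le> 1" by (auto simp: dist_norm norm_minus_commute)
        have "norm (b' y - b' x) \<le> C' * (\<phi> x (norm (x - y)) + \<phi> y (norm (x - y)))"
          using two[of x y] elim by (simp add: abs_minus_commute)
        also have "\<dots> \<le> C' * (norm (x - y) powr d + norm (x - y) powr d)"
          by (intro mult_left_mono add_mono \<phi>_small t C')
        finally show ?case .
      qed
      have "((\<lambda>y. C' * (norm (x - y) powr d + norm (x - y) powr d)) \<longlongrightarrow> C' * (norm (x - x) powr d + norm (x - x) powr d)) (at x)"
        using d by (intro tendsto_mult tendsto_add tendsto_const tendsto_powr' tendsto_norm tendsto_diff tendsto_ident_at) auto
      then show "((\<lambda>y. C' * (norm (x - y) powr d + norm (x - y) powr d)) \<longlongrightarrow> 0) (at x)" by simp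
    qed
    then show ?thesis by (auto simp: continuous_on_def)
  qed
  have meas: "b' \<in> borel_measurable lebesgue" using continuous_on_measurable_lebesgue[OF cont] .
  have b_meas: "b \<in> borel_measurable lebesgue" using locally_integrable_measurable[OF b] .
  \<comment> \<open>On a cube of side s \<le> 1 with mean c of b, both |b' - c| and the mean of |b -
    c| are of order s^d, so the mean of |b' - b| is too.\<close>
  have "AE x in lebesgue. b' x - b x = 0"
  proof (rule AE_eq_of_cube_integral_le[where d=d and C="C' + C"])
    show "(\<lambda>x. b' x - b x) \<in> borel_measurable lebesgue" using meas b_meas by measurable
    fix a :: "real^'n" and s :: real assume s: "0 < s" "s \<le> 1"
    define c where "c = cube_average (cube a s) b"
    have int: "set_integrable lebesgue (cube a s) (\<lambda>y. C' * s powr d + \<bar>b y - c\<bar>)"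
      by (intro set_integral_add set_integrable_cube_const set_integrable_dev locally_integrable_cube b)
    have "(\<integral>\<^sup>+y\<in>cube a s. ennreal \<bar>b' y - b y\<bar> \<partial>lebesgue) \<le> (\<integral>\<^sup>+y\<in>cube a s. ennreal (C' * s powr d + \<bar>b y - c\<bar>) \<partial>lebesgue)"
    proof (intro nn_integral_mono)
      fix y
      have "\<bar>b' y - b y\<bar> \<le> C' * s powr d + \<bar>b y - c\<bar>" if "y \<in> cube a s"
      proof -
        have "\<bar>b' y - c\<bar> \<le> C' * \<phi> y s" using approx[OF s(1) that] by (simp add: c_def)
        also have "\<dots> \<le> C' * s powr d" using C' \<phi>_small[OF s] by (intro mult_left_mono) auto
        finally show ?thesis by linarith
      qed
      then show "ennreal \<bar>b' y - b y\<bar> * indicator (cube a s) y \<le> ennreal (C' * s powr d + \<bar>b y - c\<bar>) * indicator (cube a s) y"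
        by (auto simp: indicator_def intro: ennreal_leI simp del: ennreal_plus)
    qed
    also have "\<dots> = ennreal (LINT y:cube a s|lebesgue. C' * s powr d + \<bar>b y - c\<bar>)"
      using C' by (intro set_nn_integral_eq_set_integral int) auto
    also have "(LINT y:cube a s|lebesgue. C' * s powr d + \<bar>b y - c\<bar>) = C' * s powr d * s ^ CARD('n) + oscillation a s b * s ^ CARD('n)"
      unfolding set_integral_add(2)[OF set_integrable_cube_const set_integrable_dev[OF locally_integrable_cube[OF b]]]
      using s by (simp add: set_integral_cube_const oscillation_def c_def)
    also have "\<dots> \<le> C' * s powr d * s ^ CARD('n) + (C * s powr d) * s ^ CARD('n)"
      using order_trans[OF osc[OF s(1) self] mult_left_mono[OF \<phi>_small[OF s] C]] s
      by (intro add_left_mono mult_right_mono) auto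
    also have "\<dots> = (C' + C) * s ^ CARD('n) * s powr d" by (simp add: algebra_simps)
    finally show "(\<integral>\<^sup>+y\<in>cube a s. ennreal \<bar>b' y - b y\<bar> \<partial>lebesgue) \<le> ennreal ((C' + C) * s ^ CARD('n) * s powr d)"
      by (simp add: ennreal_leI)
  qed (use d C C' in auto)
  then have "AE x in lebesgue. b' x = b x" by eventually_elim simp
  then show ?thesis using that[of b' C'] C' approx two by blast
qed

subsection \<open>Testing on characteristic functions of cubes\<close>

lemma locally_integrable_mult_indicator:
  fixes f :: "real^'n \<Rightarrow> real"
  assumes "locally_integrable f" "S \<in> sets lebesgue"
  shows "locally_integrable (\<lambda>y. f y * indicator S y)"
  unfolding locally_integrable_def
proof (intro allI impI)
  fix K :: "(real^'n) set" assume "compact K"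
  then have "integrable lebesgue (\<lambda>y. indicator K y *\<^sub>R f y)"
    using assms(1) by (simp add: locally_integrable_def set_integrable_def)
  from integrable_mult_indicator[OF assms(2) this]
  show "set_integrable lebesgue K (\<lambda>y. f y * indicator S y)"
    unfolding set_integrable_def by (simp add: mult_ac)
qed

lemma locally_integrable_one: "locally_integrable (\<lambda>_. 1)"
  unfolding locally_integrable_def set_integrable_def
  using lmeasurable_compact by (auto intro!: integrable_real_indicator simp: fmeasurable_def simp del: emeasure_completion)

lemma set_integral_mult_indicator_subset:
  fixes f :: "'a \<Rightarrow> real"
  assumes "A \<subseteq> B"
  shows "(LINT y:B|M. f y * indicator A y) = (LINT y:A|M. f y)"
  unfolding set_lebesgue_integral_def
  by (intro Bochner_Integration.integral_cong) (use assms in \<open>auto simp: indicator_def\<close>)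

lemma double_cube:
  fixes a :: "real^'n"
  assumes s: "0 < s"
  obtains t where "0 < t" "t ^ CARD('n) = 2 * s ^ CARD('n)" "cube a s \<subseteq> cube a t"
proof -
  define t where "t = root CARD('n) 2 * s"
  have n: "0 < CARD('n)" by simp
  have "1 \<le> root CARD('n) 2" using n by simp
  then have st: "s \<le> t" using s by (simp add: t_def mult_le_cancel_right1)
  have "t ^ CARD('n) = 2 * s ^ CARD('n)" by (simp add: t_def power_mult_distrib)
  moreover have "cube a s \<subseteq> cube a t" using st by (auto simp: mem_cube) (smt (verit))
  ultimately show ?thesis using that[of t] st s by linarith
qed

text \<open>If \<open>S\<close> occupies the fraction c of the cube, the oscillation is exactly 2 c
  (1 - c), which is largest at c = 1/2.\<close>

lemma oscillation_indicator_le: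
  fixes S :: "(real^'n) set"
  assumes S: "S \<in> sets lebesgue" and s: "0 < s"
  shows "oscillation a s (indicator S) \<le> 1 / 2"
proof -
  let ?Q = "cube a s" and ?f = "indicator S :: real^'n \<Rightarrow> real"
  have f: "set_integrable lebesgue ?Q ?f"
    using locally_integrable_cube[OF locally_integrable_mult_indicator[OF locally_integrable_one S]] by simp
  define c where "c = cube_average ?Q ?f"
  have c: "(LINT y:?Q|lebesgue. ?f y) = c * s ^ CARD('n)"
    unfolding c_def by (rule set_integral_eq_cube_average[OF s])
  have const: "(LINT y:?Q|lebesgue. d) = d * s ^ CARD('n)" for d :: real
    using s by (intro set_integral_cube_const) auto
  have c0: "0 \<le> c" "c \<le> 1"
  proof -
    have "0 \<le> (LINT y:?Q|lebesgue. ?f y)"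
      unfolding set_lebesgue_integral_def by (intro Bochner_Integration.integral_nonneg) auto
    then show "0 \<le> c" using mult_le_cancel_right_pos[of "s ^ CARD('n)" 0 c] s unfolding c by simp
    have "(LINT y:?Q|lebesgue. ?f y) \<le> (LINT y:?Q|lebesgue. 1)"
      by (intro set_integral_mono f set_integrable_cube_const) (auto simp: indicator_def)
    then show "c \<le> 1" using s unfolding c const by simp
  qed
  have "\<bar>?f y - c\<bar> = (1 - 2 * c) * ?f y + c" for y
    using c0 by (auto simp: indicator_def)
  then have "(LINT y:?Q|lebesgue. \<bar>?f y - c\<bar>) = (LINT y:?Q|lebesgue. (1 - 2 * c) * ?f y + c)" by simp
  also have "\<dots> = (1 - 2 * c) * (c * s ^ CARD('n)) + c * s ^ CARD('n)"
    unfolding set_integral_add(2)[OF set_integrable_mult_right[OF f] set_integrable_cube_const]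
    by (simp add: c const)
  finally have "oscillation a s ?f = 2 * c * (1 - c)"
    using s unfolding oscillation_def c_def[symmetric] by (simp add: field_simps)
  moreover have "2 * c * (1 - c) \<le> 1 / 2"
    using zero_le_power2[of "2 * c - 1"] by (simp add: power2_eq_square algebra_simps)
  ultimately show ?thesis by simp
qed

text \<open>On a cube \<open>Q' \<supseteq> Q\<close> of twice the volume, integrating \<open>b \<chi>\<^sub>Q - c\<close>, with \<open>c\<close> its mean over \<open>Q'\<close>,
  against the sign \<open>2 \<chi>\<^sub>Q - 1\<close> gives exactly \<open>\<integral>\<^sub>Q b\<close>.\<close>

lemma average_le_sharp_maximal:
  fixes b :: "real^'n \<Rightarrow> real"
  assumes b: "locally_integrable b" and s: "0 < s" and x: "x \<in> cube a s"
  shows "ennreal (\<bar>cube_average (cube a s) b\<bar> / 2) \<le> sharp_maximal (\<lambda>y. b y * indicator (cube a s) y) x"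
proof -
  let ?Q = "cube a s"
  obtain t where t: "0 < t" "t ^ CARD('n) = 2 * s ^ CARD('n)" "?Q \<subseteq> cube a t"
    using double_cube[OF s, of a] by metis
  define g where "g y = b y * indicator ?Q y" for y
  have g: "locally_integrable g" unfolding g_def by (intro locally_integrable_mult_indicator b) auto
  define c where "c = cube_average (cube a t) g"
  have int_g: "(LINT y:cube a t|lebesgue. g y) = (LINT y:?Q|lebesgue. b y)"
    unfolding g_def by (rule set_integral_mult_indicator_subset[OF t(3)])
  have int_b: "(LINT y:?Q|lebesgue. b y) = cube_average ?Q b * s ^ CARD('n)"
    by (rule set_integral_eq_cube_average[OF s])
  \<comment> \<open>This is g - c times the sign, since g vanishes off the small cube. So |h| = |g -
    c|, and the terms with c cancel in the integral because t^n = 2 s^n.\<close>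
  define h where "h y = g y - (2 * c * (1 * indicator ?Q y) - c)" for y
  have ind: "set_integrable lebesgue (cube a t) (\<lambda>y. 1 * indicator ?Q y :: real)"
    by (intro locally_integrable_cube locally_integrable_mult_indicator locally_integrable_one) auto
  have h_int: "set_integrable lebesgue (cube a t) h"
    unfolding h_def
    by (rule set_integral_diff(1)[OF locally_integrable_cube[OF g] set_integral_diff(1)[OF set_integrable_mult_right[OF ind] set_integrable_cube_const]])
  have ind_eq: "(LINT y:cube a t|lebesgue. 1 * indicator ?Q y) = s ^ CARD('n)"
    using s by (subst set_integral_mult_indicator_subset[OF t(3)]) (simp add: set_integral_cube_const)
  have "(LINT y:cube a t|lebesgue. h y) = (LINT y:?Q|lebesgue. b y) - (2 * c * s ^ CARD('n) - c * t ^ CARD('n))"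
    unfolding h_def set_integral_diff(2)[OF locally_integrable_cube[OF g] set_integral_diff(1)[OF set_integrable_mult_right[OF ind] set_integrable_cube_const]]
      set_integral_diff(2)[OF set_integrable_mult_right[OF ind] set_integrable_cube_const] int_g
      set_integral_mult_right[of lebesgue "cube a t" "2 * c"] ind_eq
    using t(1) by (simp only: set_integral_cube_const less_imp_le)
  then have h_eq: "(LINT y:cube a t|lebesgue. h y) = (LINT y:?Q|lebesgue. b y)" by (simp add: t(2))
  have "\<bar>h y\<bar> = \<bar>g y - c\<bar>" for y by (auto simp: h_def g_def indicator_def)
  then have "\<bar>LINT y:?Q|lebesgue. b y\<bar> \<le> (LINT y:cube a t|lebesgue. \<bar>g y - c\<bar>)"
    using set_integral_abs_le[OF h_int] by (simp add: h_eq)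
  also have "\<dots> = oscillation a t g * (2 * s ^ CARD('n))"
    using t(1) by (simp add: oscillation_def c_def t(2)[symmetric])
  finally have "\<bar>cube_average ?Q b\<bar> / 2 \<le> oscillation a t g"
    using s by (simp add: int_b abs_mult)
  then have "ennreal (\<bar>cube_average ?Q b\<bar> / 2) \<le> ennreal (oscillation a t g)" by (rule ennreal_leI)
  also have "\<dots> \<le> sharp_maximal g x" using t x by (intro oscillation_le_sharp_maximal g) auto
  finally show ?thesis by (simp add: g_def[abs_def])
qed

text \<open>Makes the first term of the commutator at the indicator of a cube equal to b/2 on that
  cube. The lower bound is \<open>average_le_sharp_maximal\<close> for the constant function
  1.\<close>

lemma sharp_maximal_indicator:
  fixes a :: "real^'n"
  assumes s: "0 < s" and x: "x \<in> cube a s"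
  shows "sharp_maximal (indicator (cube a s)) x = ennreal (1 / 2)"
proof (rule antisym)
  have loc: "locally_integrable (indicator (cube a s) :: real^'n \<Rightarrow> real)"
    using locally_integrable_mult_indicator[OF locally_integrable_one, of "cube a s"] by simp
  show "sharp_maximal (indicator (cube a s)) x \<le> ennreal (1 / 2)"
    by (rule sharp_maximal_le[OF loc]) (rule oscillation_indicator_le, auto)
  have "cube_average (cube a s) (\<lambda>_. 1) = 1"
    using s measure_cube[of s a] by (simp add: cube_average_def set_integral_cube_const)
  then show "ennreal (1 / 2) \<le> sharp_maximal (indicator (cube a s)) x"
    using average_le_sharp_maximal[OF locally_integrable_one s x] by simp
qed

text \<open>Bounds on the norms of the test functions, stated through modulars. On small cubes s^(-n
  r(y)/r(x)) is comparable to s^(-n) by local continuity; on large cubes s^(-n r(y)/rinf) is at most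
  a multiple of s^(-n) plus the integrable decay.\<close>

lemma indicator_cube_modular_le:
  fixes r :: "real^'n \<Rightarrow> real"
  assumes r: "log_hoelder_with C rinf r" "\<And>y. 1 \<le> r y"
  obtains A where "1 \<le> A"
    "\<forall>a s x. 0 < s \<longrightarrow> s \<le> 1 \<longrightarrow> x \<in> cube a s \<longrightarrow>
      var_modular r (\<lambda>y. \<bar>indicator (cube a s) y\<bar> / (A * s powr (real CARD('n) / r x))) \<le> 1"
    "\<forall>a s. 1 \<le> s \<longrightarrow>
      var_modular r (\<lambda>y. \<bar>indicator (cube a s) y\<bar> / (A * s powr (real CARD('n) / rinf))) \<le> 1"
proof -
  define n where "n = real CARD('n)"
  have n: "1 \<le> n" by (simp add: n_def Suc_leI)
  have C: "0 \<le> C" using r(1) by (simp add: log_hoelder_with_def)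
  have rinf: "1 \<le> rinf" using log_hoelder_with_infinity_ge[OF r(1,2)] .
  obtain D where D: "0 < D" "(\<integral>\<^sup>+x. ennreal (decay (x::real^'n)) \<partial>lebesgue) \<le> ennreal D"
    using nn_integral_decay_finite by blast
  define E where "E = exp (n * (C * (1 + ln n)))"
  define E' where "E' = exp ((n + 1) * C)"
  \<comment> \<open>The modular comes out as at most E / A on small cubes and (E' + D) / A on large
    ones.\<close>
  define A where "A = max 1 (max E (E' + D))"
  have A: "1 \<le> A" "E \<le> A" "E' + D \<le> A" by (auto simp: A_def)
  have modular: "var_modular r (\<lambda>y. \<bar>indicator (cube a s) y\<bar> / (A * s powr e)) \<le>
      (\<integral>\<^sup>+y\<in>cube a s. ennreal (1 / A * s powr (- e * r y)) \<partial>lebesgue)" if "0 < s" for a :: "real^'n" and s e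
    unfolding var_modular_def
  proof (intro nn_integral_mono)
    fix y
    have "\<bar>1 / (A * s powr e)\<bar> = 1 / A * s powr - e"
      using A by (simp add: powr_minus divide_inverse)
    then have "\<bar>1 / (A * s powr e)\<bar> powr r y = (1 / A) powr r y * s powr (- e * r y)"
      using A by (simp only: powr_mult powr_powr)
    also have "\<dots> \<le> (1 / A) powr 1 * s powr (- e * r y)"
      using A r(2)[of y] by (intro mult_right_mono powr_mono') auto
    finally have le: "\<bar>1 / (A * s powr e)\<bar> powr r y \<le> 1 / A * s powr (- e * r y)" using A by simp
    then show "ennreal (\<bar>\<bar>indicator (cube a s) y\<bar> / (A * s powr e)\<bar> powr r y) \<le>
        ennreal (1 / A * s powr (- e * r y)) * indicator (cube a s) y"
      by (auto simp: indicator_def intro: ennreal_leI)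
  qed
  show ?thesis
  proof (rule that[OF A(1)]; intro allI impI)
    fix a x :: "real^'n" and s :: real assume s: "0 < s" "s \<le> 1" and x: "x \<in> cube a s"
    have rx: "1 \<le> r x" using r(2) .
    have "(\<integral>\<^sup>+y\<in>cube a s. ennreal (1 / A * s powr (- (n / r x) * r y)) \<partial>lebesgue) \<le>
        (\<integral>\<^sup>+y\<in>cube a s. ennreal (1 / s ^ CARD('n)) \<partial>lebesgue)"
    proof (intro nn_integral_mono)
      fix y
      have "1 / A * s powr (- (n / r x) * r y) \<le> 1 / s ^ CARD('n)" if y: "y \<in> cube a s"
      proof -
        have "\<bar>- (n / r x) * r y - - n\<bar> = \<bar>r x - r y\<bar> * (n / r x)"
        proof -
          have "- (n / r x) * r y - - n = (r x - r y) * (n / r x)" using rx by (simp add: field_simps)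
          then show ?thesis using n rx by (simp only: abs_mult) simp
        qed
        moreover have "\<bar>ln s\<bar> = ln (1 / s)" using s by (simp add: ln_div)
        ultimately have "\<bar>- (n / r x) * r y - - n\<bar> * \<bar>ln s\<bar> = (\<bar>r x - r y\<bar> * ln (1 / s)) * (n / r x)" by simp
        also have "\<dots> \<le> (C * (1 + ln n)) * (n / 1)"
        proof (rule mult_mono)
          show "\<bar>r x - r y\<bar> * ln (1 / s) \<le> C * (1 + ln n)"
            using norm_diff_le_cube[OF x y] n by (intro log_hoelder_with_local[OF r(1) s]) (auto simp: n_def)
          show "n / r x \<le> n / 1" using n rx by (intro divide_left_mono) auto
        qed (use C n rx in auto)
        also have "\<dots> = n * (C * (1 + ln n))" by simp
        finally have "s powr (- (n / r x) * r y) \<le> E * s powr - n"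
          unfolding E_def using s by (intro powr_le_exp_mult_powr) auto
        also have "\<dots> \<le> A * s powr - n" using A by (intro mult_right_mono) auto
        finally show ?thesis using A s by (simp add: powr_minus powr_realpow n_def field_simps)
      qed
      then show "ennreal (1 / A * s powr (- (n / r x) * r y)) * indicator (cube a s) y \<le>
          ennreal (1 / s ^ CARD('n)) * indicator (cube a s) y"
        by (auto simp: indicator_def intro: ennreal_leI)
    qed
    also have "\<dots> = ennreal (1 / s ^ CARD('n)) * emeasure lebesgue (cube a s)"
      by (intro nn_integral_cmult_indicator) auto
    also have "\<dots> = 1"
      using s by (simp add: emeasure_cube ennreal_mult[symmetric] del: emeasure_completion)
    finally show "var_modular r (\<lambda>y. \<bar>indicator (cube a s) y\<bar> / (A * s powr (real CARD('n) / r x))) \<le> 1"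
      using order_trans[OF modular[OF s(1)]] by (simp add: n_def)
  next
    fix a :: "real^'n" and s :: real assume s: "1 \<le> s"
    define t where "t = s powr (- (n / rinf))"
    have t: "0 \<le> t" "t \<le> 1" using s rinf n powr_mono[of "- (n / rinf)" 0 s] by (auto simp: t_def)
    have "(\<integral>\<^sup>+y\<in>cube a s. ennreal (1 / A * s powr (- (n / rinf) * r y)) \<partial>lebesgue) \<le>
        (\<integral>\<^sup>+y. ennreal (1 / A) * (ennreal (E' / s ^ CARD('n)) * indicator (cube a s) y + ennreal (decay y)) \<partial>lebesgue)"
    proof (intro nn_integral_mono)
      fix y
      have "s powr (- (n / rinf) * r y) = t powr r y" by (simp add: t_def powr_powr)
      also have "\<dots> \<le> E' * t powr rinf + decay y"
        unfolding E'_def n_def by (rule powr_exponent_infinity(1)[OF r(1) t r(2) rinf])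
      also have "t powr rinf = 1 / s ^ CARD('n)"
      proof -
        have "- (n / rinf) * rinf = - n" using rinf by simp
        then have "t powr rinf = s powr - n" by (simp only: t_def powr_powr)
        then show ?thesis using s by (simp add: powr_minus powr_realpow n_def inverse_eq_divide)
      qed
      finally have "1 / A * s powr (- (n / rinf) * r y) \<le> 1 / A * (E' / s ^ CARD('n) + decay y)"
        using A by (intro mult_left_mono) auto
      then have "ennreal (1 / A * s powr (- (n / rinf) * r y)) \<le> ennreal (1 / A) * (ennreal (E' / s ^ CARD('n)) + ennreal (decay y))"
        using A s decay_pos[of y] by (simp add: E'_def ennreal_mult[symmetric] ennreal_plus[symmetric] ennreal_leI del: ennreal_plus)
      then show "ennreal (1 / A * s powr (- (n / rinf) * r y)) * indicator (cube a s) y \<le>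
          ennreal (1 / A) * (ennreal (E' / s ^ CARD('n)) * indicator (cube a s) y + ennreal (decay y))"
        by (auto simp: indicator_def)
    qed
    also have "\<dots> = ennreal (1 / A) * (ennreal (E' / s ^ CARD('n)) * emeasure lebesgue (cube a s) + (\<integral>\<^sup>+y. ennreal (decay (y::real^'n)) \<partial>lebesgue))"
    proof -
      have m1: "(\<lambda>y. ennreal (E' / s ^ CARD('n)) * indicator (cube a s) y) \<in> borel_measurable lebesgue"
        by (intro borel_measurable_times_ennreal borel_measurable_indicator) auto
      have m2: "(\<lambda>y::real^'n. ennreal (decay y)) \<in> borel_measurable lebesgue" by measurable
      have "(\<integral>\<^sup>+y. ennreal (E' / s ^ CARD('n)) * indicator (cube a s) y \<partial>lebesgue) =
          ennreal (E' / s ^ CARD('n)) * emeasure lebesgue (cube a s)"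
        by (intro nn_integral_cmult_indicator) auto
      then show ?thesis
        unfolding nn_integral_cmult[OF borel_measurable_add[OF m1 m2]] nn_integral_add[OF m1 m2] by (simp only:)
    qed
    also have "\<dots> \<le> ennreal (1 / A) * (ennreal E' + ennreal D)"
      using s D by (intro mult_left_mono add_mono)
        (auto simp: emeasure_cube E'_def ennreal_mult[symmetric] simp del: emeasure_completion)
    also have "\<dots> = ennreal ((E' + D) / A)"
      using A D by (simp add: E'_def ennreal_mult[symmetric] ennreal_plus[symmetric] del: ennreal_plus)
    also have "\<dots> \<le> 1" using A by (simp add: ennreal_le_1)
    finally show "var_modular r (\<lambda>y. \<bar>indicator (cube a s) y\<bar> / (A * s powr (real CARD('n) / rinf))) \<le> 1"
      using order_trans[OF modular[of s]] s by (simp add: n_def)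
  qed
qed

subsection \<open>The characterization\<close>

text \<open>With T the commutator at the indicator of Q, the inequality |c| \<le> b - 2 T on Q, c
  the mean of b, reduces both conclusions to the integral of |T| over Q. The norm of the indicator
  contributes s^(n/r), the unit modular estimate in q contributes s^(n-n/q), and the product is s^n
  times s^\<delta> because \<delta> = n (1/r - 1/q); the exponents are taken at x or at infinity
  according to the scale.\<close>

lemma oscillation_of_bounded_sharp_commutator:
  fixes r q \<delta> b :: "real^'n \<Rightarrow> real"
  assumes r: "log_hoelder_with Cr rinf r" "\<And>y. 1 \<le> r y" "r \<in> borel_measurable lebesgue"
    and q: "log_hoelder_with Cq qinf q" "\<And>y. 1 \<le> q y" "q \<in> borel_measurable lebesgue"
    and rq: "\<And>x. 1 / r x - 1 / q x = \<delta> x / real CARD('n)"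
    and \<delta>inf: "1 / rinf - 1 / qinf = \<delta>inf / real CARD('n)"
    and b: "locally_integrable b"
    and bounded: "bounded_operator (sharp_commutator_defined b) (sharp_commutator b) r q"
  obtains C where "0 \<le> C"
    "\<forall>a s x. 0 < s \<longrightarrow> x \<in> cube a s \<longrightarrow>
      oscillation a s b \<le> C * (if s \<le> 1 then s powr \<delta> x else s powr \<delta>inf) \<and>
      \<bar>cube_average (cube a s) b\<bar> \<le> cube_average (cube a s) b + C * (if s \<le> 1 then s powr \<delta> x else s powr \<delta>inf)"
proof -
  define n where "n = real CARD('n)"
  have n: "1 \<le> n" by (simp add: n_def Suc_leI)
  obtain C0 where C0: "\<And>f. f \<in> var_Lp r \<Longrightarrow> (AE x in lebesgue. sharp_commutator_defined b f x) \<and>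
      sharp_commutator b f \<in> var_Lp q \<and> var_Lp_norm q (sharp_commutator b f) \<le> C0 * var_Lp_norm r f"
    using bounded unfolding bounded_operator_def by blast
  \<comment> \<open>Strictly larger than |C0|, so that the infimum defining the norm lies strictly
    below B l and some admissible m < B l exists, whether or not the infimum is attained.\<close>
  define B where "B = \<bar>C0\<bar> + 1"
  have B: "0 < B" by (simp add: B_def)
  obtain A where A: "1 \<le> A"
    "\<forall>a s x. 0 < s \<longrightarrow> s \<le> 1 \<longrightarrow> x \<in> cube a s \<longrightarrow>
      var_modular r (\<lambda>y. \<bar>indicator (cube a s) y\<bar> / (A * s powr (real CARD('n) / r x))) \<le> 1"
    "\<forall>a s. 1 \<le> s \<longrightarrow>
      var_modular r (\<lambda>y. \<bar>indicator (cube a s) y\<bar> / (A * s powr (real CARD('n) / rinf))) \<le> 1"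
    by (rule indicator_cube_modular_le[OF r(1,2)]) (rule that, assumption+)
  obtain D where D: "0 < D" "(\<integral>\<^sup>+x. ennreal (decay (x::real^'n)) \<partial>lebesgue) \<le> ennreal D"
    using nn_integral_decay_finite by blast
  define A2 where "A2 = max (n + exp (n * (Cq * (1 + ln n)))) (n + D + exp ((n + 1) * Cq))"
  have A2: "0 < A2" using n D unfolding A2_def by (simp add: less_max_iff_disj add_pos_pos)
  define T where "T a s = sharp_commutator b (indicator (cube a s))" for a s
  have T: "T a s \<in> borel_measurable lebesgue \<and>
      (AE y in lebesgue. y \<in> cube a s \<longrightarrow> \<bar>cube_average (cube a s) b\<bar> \<le> b y - 2 * T a s y) \<and>
      var_modular q (\<lambda>y. \<bar>T a s y\<bar> / (B * l)) \<le> 1"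
    if s: "0 < s" and l: "0 < l" "var_modular r (\<lambda>y. \<bar>indicator (cube a s) y\<bar> / l) \<le> 1" for a s l
  proof -
    let ?\<chi> = "indicator (cube a s) :: real^'n \<Rightarrow> real"
    have \<chi>: "?\<chi> \<in> var_Lp r"
      using l unfolding var_Lp_def by (auto intro!: exI[of _ l] borel_measurable_indicator elim: le_less_trans)
    note C0 = C0[OF \<chi>]
    have Tq: "T a s \<in> var_Lp q" using C0 by (simp add: T_def)
    have "AE y in lebesgue. y \<in> cube a s \<longrightarrow> \<bar>cube_average (cube a s) b\<bar> \<le> b y - 2 * T a s y"
      using C0[THEN conjunct1]
    proof eventually_elim
      fix y assume "sharp_commutator_defined b ?\<chi> y"
      then have fin: "sharp_maximal (\<lambda>z. b z * ?\<chi> z) y < \<infinity>"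
        by (simp add: sharp_commutator_defined_def sharp_maximal_defined_def)
      show "y \<in> cube a s \<longrightarrow> \<bar>cube_average (cube a s) b\<bar> \<le> b y - 2 * T a s y"
      proof
        assume y: "y \<in> cube a s"
        define m where "m = enn2real (sharp_maximal (\<lambda>z. b z * ?\<chi> z) y)"
        have "sharp_maximal (\<lambda>z. b z * ?\<chi> z) y = ennreal m" "0 \<le> m" using fin by (auto simp: m_def)
        then have "\<bar>cube_average (cube a s) b\<bar> / 2 \<le> m"
          using average_le_sharp_maximal[OF b s y] by (simp add: ennreal_le_iff)
        moreover have "T a s y = b y / 2 - m"
        proof -
          have "enn2real (sharp_maximal ?\<chi> y) = 1 / 2"
            unfolding sharp_maximal_indicator[OF s y] by (rule enn2real_ennreal) simp
          then show ?thesis by (simp add: T_def sharp_commutator_def m_def)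
        qed
        ultimately show "\<bar>cube_average (cube a s) b\<bar> \<le> b y - 2 * T a s y" by simp
      qed
    qed
    moreover have "var_modular q (\<lambda>y. \<bar>T a s y\<bar> / (B * l)) \<le> 1"
    proof -
      have norm_\<chi>: "0 \<le> var_Lp_norm r ?\<chi>" "var_Lp_norm r ?\<chi> \<le> l"
        unfolding var_Lp_norm_def using l by (auto intro!: cInf_greatest cInf_lower bdd_belowI[of _ 0])
      have "var_Lp_norm q (T a s) \<le> C0 * var_Lp_norm r ?\<chi>" using C0 by (simp add: T_def)
      also have "\<dots> \<le> \<bar>C0\<bar> * var_Lp_norm r ?\<chi>" using norm_\<chi> by (intro mult_right_mono) auto
      also have "\<dots> \<le> \<bar>C0\<bar> * l" using norm_\<chi> by (intro mult_left_mono) auto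
      also have "\<dots> < B * l" using l by (simp add: B_def distrib_right)
      finally have "Inf {m. 0 < m \<and> var_modular q (\<lambda>y. \<bar>T a s y\<bar> / m) \<le> 1} < B * l"
        by (simp add: var_Lp_norm_def)
      note less = this
      have "{m. 0 < m \<and> var_modular q (\<lambda>y. \<bar>T a s y\<bar> / m) \<le> 1} \<noteq> {}"
        using var_Lp_unit_scale_exists[OF q(2,3) Tq] by simp
      from cInf_lessD[OF this less]
      obtain m where m: "0 < m" "var_modular q (\<lambda>y. \<bar>T a s y\<bar> / m) \<le> 1" "m < B * l"
        by auto
      have "var_modular q (\<lambda>y. \<bar>T a s y\<bar> / (B * l)) \<le> var_modular q (\<lambda>y. \<bar>T a s y\<bar> / m)"
        unfolding var_modular_def
      proof (intro nn_integral_mono ennreal_leI powr_mono2)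
        fix y
        show "0 \<le> q y" using q(2)[of y] by simp
        have "\<bar>T a s y\<bar> / (B * l) \<le> \<bar>T a s y\<bar> / m" using m by (intro divide_left_mono) auto
        then show "\<bar>\<bar>T a s y\<bar> / (B * l)\<bar> \<le> \<bar>\<bar>T a s y\<bar> / m\<bar>" using m B l by simp
      qed simp
      then show ?thesis using m(2) by (rule order_trans)
    qed
    ultimately show ?thesis using Tq by (auto simp: var_Lp_def)
  qed
  define C1 where "C1 = B * A * A2"
  have C1: "0 < C1" using A A2 B by (simp add: C1_def)
  define \<phi> where "\<phi> x s = (if s \<le> 1 then s powr \<delta> x else s powr \<delta>inf)" for x s
  have T_int: "set_integrable lebesgue (cube a s) (\<lambda>y. \<bar>T a s y\<bar>) \<and>
      (LINT y:cube a s|lebesgue. \<bar>T a s y\<bar>) \<le> C1 * s ^ CARD('n) * \<phi> x s \<and> T a s \<in> borel_measurable lebesgue \<and>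
      (AE y in lebesgue. y \<in> cube a s \<longrightarrow> \<bar>cube_average (cube a s) b\<bar> \<le> b y - 2 * T a s y)"
    if s: "0 < s" and x: "x \<in> cube a s" for a s x
  proof -
    have finish: "set_integrable lebesgue (cube a s) (\<lambda>y. \<bar>T a s y\<bar>) \<and> (LINT y:cube a s|lebesgue. \<bar>T a s y\<bar>) \<le> L * z"
      if L: "0 < L" and z: "0 \<le> z" and meas: "T a s \<in> borel_measurable lebesgue"
        and le: "(\<integral>\<^sup>+y\<in>cube a s. ennreal (\<bar>T a s y\<bar> / L) \<partial>lebesgue) \<le> ennreal z" for L z
    proof -
      have "(\<integral>\<^sup>+y. ennreal (norm (indicator (cube a s) y *\<^sub>R (\<bar>T a s y\<bar> / L))) \<partial>lebesgue) \<le> ennreal z"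
        by (rule order_trans[OF nn_integral_mono le]) (use L in \<open>auto simp: indicator_def\<close>)
      then have int: "set_integrable lebesgue (cube a s) (\<lambda>y. \<bar>T a s y\<bar> / L)"
        using meas unfolding set_integrable_def
        by (intro integrableI_bounded borel_measurable_scaleR borel_measurable_indicator) (auto elim: le_less_trans)
      have "ennreal (LINT y:cube a s|lebesgue. \<bar>T a s y\<bar> / L) \<le> ennreal z"
        using le L by (subst set_nn_integral_eq_set_integral[OF int, symmetric]) auto
      then have "(LINT y:cube a s|lebesgue. \<bar>T a s y\<bar>) / L \<le> z" using z by (simp add: ennreal_le_iff)
      then have "(LINT y:cube a s|lebesgue. \<bar>T a s y\<bar>) \<le> L * z" using L by (simp add: pos_divide_le_eq mult.commute)
      moreover have "set_integrable lebesgue (cube a s) (\<lambda>y. L * (\<bar>T a s y\<bar> / L))"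
        using int by (rule set_integrable_mult_right)
      ultimately show ?thesis using L by simp
    qed
    have sub: "norm (x - y) \<le> n * s" if "y \<in> cube a s" for y
      using norm_diff_le_cube[OF x that] by (simp add: n_def)
    have vol: "emeasure lebesgue (cube a s) \<le> ennreal (n * s ^ CARD('n))"
      unfolding emeasure_cube[OF less_imp_le[OF s]] using n s by (intro ennreal_leI) (simp add: mult_le_cancel_right1)
    have modQ: "(\<integral>\<^sup>+y\<in>cube a s. ennreal ((\<bar>T a s y\<bar> / L) powr q y) \<partial>lebesgue) \<le> 1"
      if "var_modular q (\<lambda>y. \<bar>T a s y\<bar> / L) \<le> 1" "0 < L" for L
      using that unfolding var_modular_def
      by (intro order_trans[OF nn_integral_mono that(1)[unfolded var_modular_def]]) (auto simp: indicator_def)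
    show ?thesis
    proof (cases "s \<le> 1")
      case True
      define l where "l = A * s powr (n / r x)"
      have l: "0 < l" using A s by (simp add: l_def)
      have "var_modular r (\<lambda>y. \<bar>indicator (cube a s) y\<bar> / l) \<le> 1"
        using A(2) s True x unfolding l_def n_def by blast
      note Tl = T[OF s l this]
      have L: "0 < B * l" using B l by simp
      have "(\<integral>\<^sup>+y\<in>cube a s. ennreal (\<bar>T a s y\<bar> / (B * l)) \<partial>lebesgue) \<le> ennreal ((n + exp (n * (Cq * (1 + ln n)))) * s powr (n - n / q x))"
        unfolding n_def
      proof (rule nn_integral_unit_modular_small[OF q(1,3,2)])
        show "(\<lambda>y. \<bar>T a s y\<bar> / (B * l)) \<in> borel_measurable lebesgue"
          using Tl[THEN conjunct1] by (intro borel_measurable_divide borel_measurable_abs borel_measurable_const)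
        show "emeasure lebesgue (cube a s) \<le> ennreal (real CARD('n) * s ^ CARD('n))" using vol by (simp add: n_def)
        show "(\<integral>\<^sup>+y\<in>cube a s. ennreal ((\<bar>T a s y\<bar> / (B * l)) powr q y) \<partial>lebesgue) \<le> 1" using modQ Tl L by blast
      qed (use L sub n s True in \<open>auto simp: n_def\<close>)
      also have "\<dots> \<le> ennreal (A2 * s powr (n - n / q x))"
        by (intro ennreal_leI mult_right_mono) (auto simp: A2_def)
      finally have "set_integrable lebesgue (cube a s) (\<lambda>y. \<bar>T a s y\<bar>) \<and>
          (LINT y:cube a s|lebesgue. \<bar>T a s y\<bar>) \<le> B * l * (A2 * s powr (n - n / q x))"
        using L A2 Tl by (intro finish) auto
      moreover have "B * l * (A2 * s powr (n - n / q x)) = C1 * s ^ CARD('n) * \<phi> x s"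
      proof -
        have "n / r x + (n - n / q x) = n + n * (1 / r x - 1 / q x)" by (simp add: algebra_simps)
        also have "\<dots> = n + \<delta> x" unfolding rq using n by (simp add: n_def)
        finally have "s powr (n / r x) * s powr (n - n / q x) = s powr (n + \<delta> x)"
          by (simp only: powr_add[symmetric])
        then have "s powr (n / r x) * s powr (n - n / q x) = s ^ CARD('n) * s powr \<delta> x"
          using s by (simp add: powr_add powr_realpow n_def)
        then show ?thesis using True by (simp add: l_def C1_def \<phi>_def mult_ac)
      qed
      ultimately show ?thesis using Tl by simp
    next
      case False
      then have s1: "1 \<le> s" by simp
      define l where "l = A * s powr (n / rinf)"
      have l: "0 < l" using A s by (simp add: l_def)
      have "var_modular r (\<lambda>y. \<bar>indicator (cube a s) y\<bar> / l) \<le> 1"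
        using A(3) s1 unfolding l_def n_def by blast
      note Tl = T[OF s l this]
      have L: "0 < B * l" using B l by simp
      have "(\<integral>\<^sup>+y\<in>cube a s. ennreal (\<bar>T a s y\<bar> / (B * l)) \<partial>lebesgue) \<le> ennreal ((n + D + exp ((n + 1) * Cq)) * s powr (n - n / qinf))"
        unfolding n_def
      proof (rule nn_integral_unit_modular_large[OF q(1,3,2)])
        show "(\<lambda>y. \<bar>T a s y\<bar> / (B * l)) \<in> borel_measurable lebesgue"
          using Tl[THEN conjunct1] by (intro borel_measurable_divide borel_measurable_abs borel_measurable_const)
        show "emeasure lebesgue (cube a s) \<le> ennreal (real CARD('n) * s ^ CARD('n))" using vol by (simp add: n_def)
        show "(\<integral>\<^sup>+y\<in>cube a s. ennreal ((\<bar>T a s y\<bar> / (B * l)) powr q y) \<partial>lebesgue) \<le> 1" using modQ Tl L by blast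
      qed (use L n s1 D in \<open>auto simp: n_def\<close>)
      also have "\<dots> \<le> ennreal (A2 * s powr (n - n / qinf))"
        by (intro ennreal_leI mult_right_mono) (auto simp: A2_def)
      finally have "set_integrable lebesgue (cube a s) (\<lambda>y. \<bar>T a s y\<bar>) \<and>
          (LINT y:cube a s|lebesgue. \<bar>T a s y\<bar>) \<le> B * l * (A2 * s powr (n - n / qinf))"
        using L A2 Tl by (intro finish) auto
      moreover have "B * l * (A2 * s powr (n - n / qinf)) = C1 * s ^ CARD('n) * \<phi> x s"
      proof -
        have "n / rinf + (n - n / qinf) = n + n * (1 / rinf - 1 / qinf)" by (simp add: algebra_simps)
        also have "\<dots> = n + \<delta>inf" unfolding \<delta>inf using n by (simp add: n_def)
        finally have "s powr (n / rinf) * s powr (n - n / qinf) = s powr (n + \<delta>inf)"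
          by (simp only: powr_add[symmetric])
        then have "s powr (n / rinf) * s powr (n - n / qinf) = s ^ CARD('n) * s powr \<delta>inf"
          using s by (simp add: powr_add powr_realpow n_def)
        then show ?thesis using False by (simp add: l_def C1_def \<phi>_def mult_ac)
      qed
      ultimately show ?thesis using Tl by simp
    qed
  qed
  show ?thesis
  proof (rule that[of "4 * C1"]; (intro allI impI)?)
    fix a x :: "real^'n" and s :: real assume s: "0 < s" and x: "x \<in> cube a s"
    let ?Q = "cube a s"
    define c where "c = cube_average ?Q b"
    define I where "I = (LINT y:?Q|lebesgue. \<bar>T a s y\<bar>)"
    note Tx = T_int[OF s x]
    have I: "I \<le> C1 * s ^ CARD('n) * \<phi> x s" "0 \<le> I"
      using Tx unfolding I_def by (auto simp: set_lebesgue_integral_def intro!: Bochner_Integration.integral_nonneg)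
    have Tabs: "set_integrable lebesgue ?Q (\<lambda>y. \<bar>T a s y\<bar>)" using Tx by blast
    have AE: "AE y in lebesgue. y \<in> ?Q \<longrightarrow> \<bar>c\<bar> \<le> b y - 2 * T a s y" using Tx by (simp add: c_def)
    have bQ: "set_integrable lebesgue ?Q b" by (rule locally_integrable_cube[OF b])
    have const: "(LINT y:?Q|lebesgue. d) = d * s ^ CARD('n)" for d :: real
      using s by (intro set_integral_cube_const) auto
    have int_b: "(LINT y:?Q|lebesgue. b y) = c * s ^ CARD('n)"
      unfolding c_def by (rule set_integral_eq_cube_average[OF s])
    have "(LINT y:?Q|lebesgue. \<bar>c\<bar>) \<le> (LINT y:?Q|lebesgue. b y + 2 * \<bar>T a s y\<bar>)"
    proof (rule set_integral_mono_AE)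
      show "AE y \<in> ?Q in lebesgue. \<bar>c\<bar> \<le> b y + 2 * \<bar>T a s y\<bar>" using AE by eventually_elim linarith
    qed (intro set_integrable_cube_const set_integral_add bQ set_integrable_mult_right Tabs)+
    also have "\<dots> = c * s ^ CARD('n) + 2 * I"
      unfolding set_integral_add(2)[OF bQ set_integrable_mult_right[OF Tabs]] int_b by (simp add: I_def)
    finally have "\<bar>c\<bar> * s ^ CARD('n) \<le> c * s ^ CARD('n) + 2 * (C1 * s ^ CARD('n) * \<phi> x s)"
      using I unfolding const by linarith
    then have "\<bar>c\<bar> * s ^ CARD('n) \<le> (c + 2 * C1 * \<phi> x s) * s ^ CARD('n)" by (simp add: algebra_simps)
    then have 1: "\<bar>c\<bar> \<le> c + 2 * C1 * \<phi> x s" using s by simp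
    have \<phi>: "0 \<le> \<phi> x s" by (simp add: \<phi>_def)
    \<comment> \<open>Since b - c \<ge> |c| - c + 2 T \<ge> -2 |T|, the negative part of b - c is at
      most 2 |T|. A real number plus twice its negative part is its absolute value, and b - c has
      integral 0 over Q.\<close>
    have "(LINT y:?Q|lebesgue. \<bar>b y - c\<bar>) \<le> (LINT y:?Q|lebesgue. 4 * \<bar>T a s y\<bar> + (b y - c))"
    proof (rule set_integral_mono_AE)
      show "AE y \<in> ?Q in lebesgue. \<bar>b y - c\<bar> \<le> 4 * \<bar>T a s y\<bar> + (b y - c)" using AE by eventually_elim linarith
    qed (intro set_integrable_dev set_integrable_cube_const set_integral_add set_integral_diff bQ set_integrable_mult_right Tabs)+
    also have "\<dots> = 4 * I + (c * s ^ CARD('n) - c * s ^ CARD('n))"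
      unfolding set_integral_add(2)[OF set_integrable_mult_right[OF Tabs] set_integral_diff(1)[OF bQ set_integrable_cube_const]]
        set_integral_diff(2)[OF bQ set_integrable_cube_const] int_b const by (simp add: I_def)
    also have "\<dots> \<le> 4 * (C1 * s ^ CARD('n) * \<phi> x s)" using I by simp
    finally have 2: "oscillation a s b \<le> 4 * C1 * \<phi> x s"
      using s unfolding oscillation_def c_def[symmetric] by (simp add: pos_divide_le_eq mult_ac)
    show "oscillation a s b \<le> 4 * C1 * (if s \<le> 1 then s powr \<delta> x else s powr \<delta>inf) \<and>
      \<bar>cube_average ?Q b\<bar> \<le> cube_average ?Q b + 4 * C1 * (if s \<le> 1 then s powr \<delta> x else s powr \<delta>inf)"
      using 1 2 mult_nonneg_nonneg[OF less_imp_le[OF C1] \<phi>] unfolding \<phi>_def[symmetric] c_def by linarith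
  qed (use C1 in simp)
qed

section \<open>Exponents and gauges in the setting of the theorem\<close>

lemma log_hoelder_exponentsD:
  fixes p :: "real^'n \<Rightarrow> real"
  assumes "p \<in> log_hoelder_exponents"
  obtains C \<sigma> where "log_hoelder_with C (exponent_at_infinity p) p" "p \<in> borel_measurable lebesgue"
    "1 < (INF x. p x)" "\<forall>x. (INF x. p x) \<le> p x" "\<forall>x. p x \<le> \<sigma>"
proof -
  have v: "p \<in> var_exponents" using assms by (simp add: log_hoelder_exponents_def)
  then have p: "p \<in> borel_measurable lebesgue" "\<forall>x. 1 < p x" "1 < (INF x. p x)" "bdd_above (range p)"
    by (auto simp: var_exponents_def)
  obtain C1 C2 pinf where C: "0 < C1" "0 < C2" "\<forall>x y. \<bar>p x - p y\<bar> \<le> C1 / ln (exp 1 + 1 / norm (x - y))"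
    "\<forall>x. \<bar>p x - pinf\<bar> \<le> C2 / ln (exp 1 + norm x)"
    using assms unfolding log_hoelder_exponents_def by blast
  have ln1: "0 \<le> ln (exp 1 + z)" if "0 \<le> z" for z :: real
    using that ln_ge_zero[of "exp 1 + z"] one_le_exp_iff[of 1] by linarith
  have lh: "log_hoelder_with (max C1 C2) pinf p"
    unfolding log_hoelder_with_def
  proof (intro conjI allI)
    show "0 \<le> max C1 C2" using C by simp
    show "\<bar>p x - p y\<bar> \<le> max C1 C2 / ln (exp 1 + 1 / norm (x - y))" for x y
      using C(3)[rule_format, of x y] divide_right_mono[of C1 "max C1 C2" "ln (exp 1 + 1 / norm (x - y))"] ln1[of "1 / norm (x - y)"]
      by simp
    show "\<bar>p x - pinf\<bar> \<le> max C1 C2 / ln (exp 1 + norm x)" for x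
      using C(4)[rule_format, of x] divide_right_mono[of C2 "max C1 C2" "ln (exp 1 + norm x)"] ln1[of "norm x"]
      by simp
  qed
  \<comment> \<open>The constant in the definition of the class is only asserted to exist;
    convergence identifies it with the value of \<open>Lim\<close>.\<close>
  have "exponent_at_infinity p = pinf"
    unfolding exponent_at_infinity_def
    using log_hoelder_with_tendsto[OF lh] by (intro tendsto_Lim) (auto simp: trivial_limit_at_infinity)
  moreover obtain \<sigma> where "\<forall>x. p x \<le> \<sigma>" using p(4) by (auto simp: bdd_above_def)
  moreover have "\<forall>x. (INF x. p x) \<le> p x"
  proof -
    have "bdd_below (range p)" using p(2) by (intro bdd_belowI[of _ 1]) (auto intro: less_imp_le)
    from cINF_lower[OF this UNIV_I] show ?thesis by blast
  qed
  ultimately show ?thesis using that[of "max C1 C2" \<sigma>] lh p by simp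
qed

lemma log_hoelder_with_continuous:
  assumes s: "log_hoelder_with C sinf s"
  shows "continuous_on UNIV s"
proof -
  have "(s \<longlongrightarrow> s x) (at x)" for x
  proof (rule Lim_null[THEN iffD2], rule Lim_null_comparison)
    show "\<forall>\<^sub>F y in at x. norm (s y - s x) \<le> C / ln (exp 1 + 1 / norm (y - x))"
      using s by (auto simp: log_hoelder_with_def)
    have "filterlim (\<lambda>y. norm (y - x)) (at_right 0) (at x)"
      unfolding filterlim_at
      by (auto intro!: tendsto_eq_intros always_eventually simp: eventually_at_filter)
    then have "filterlim (\<lambda>y. inverse (norm (y - x))) at_top (at x)"
      by (rule filterlim_compose[OF filterlim_inverse_at_top_right])
    then have "filterlim (\<lambda>y. exp 1 + inverse (norm (y - x))) at_top (at x)"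
      by (rule filterlim_tendsto_add_at_top[OF tendsto_const])
    then have "filterlim (\<lambda>y. ln (exp 1 + inverse (norm (y - x)))) at_top (at x)"
      by (rule filterlim_compose[OF ln_at_top])
    then show "((\<lambda>y. C / ln (exp 1 + 1 / norm (y - x))) \<longlongrightarrow> 0) (at x)"
      unfolding inverse_eq_divide by (rule real_tendsto_divide_at_top[OF tendsto_const])
  qed
  then show ?thesis by (auto simp: continuous_on_def)
qed

text \<open>A violation would occur on a nonempty open set, which is not null. This turns the almost
  everywhere bound p \<ge> p(\<infinity>) into one at every point, as the Lipschitz estimate is
  claimed at every point.\<close>

lemma AE_ge_imp_ge:
  fixes p :: "real^'n \<Rightarrow> real"
  assumes p: "continuous_on UNIV p" and "AE x in lebesgue. c \<le> p x"
  shows "c \<le> p x"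
proof (rule ccontr)
  assume "\<not> c \<le> p x"
  have op: "open {x. p x < c}"
    using p by (intro open_Collect_less continuous_on_const) auto
  then have "{x. p x < c} \<in> sets lebesgue" by simp
  then have "{x. p x < c} \<in> null_sets lebesgue"
    using assms(2) by (subst AE_iff_null_sets) (auto simp: not_less)
  then have "negligible {x. p x < c}" by (simp add: negligible_iff_null_sets)
  moreover have "x \<in> {x. p x < c}" using \<open>\<not> c \<le> p x\<close> by simp
  ultimately show False using open_not_negligible[OF op] by blast
qed

text \<open>Only the case s > 1 \<ge> \<theta> s mixes the two exponents. There one passes through
  their common lower bound d: lowering an exponent increases powers of numbers below 1 and decreases
  powers of numbers above 1.\<close>

lemma two_regime_power_shrink:
  fixes \<delta> \<delta>inf d s \<theta> :: real
  assumes \<delta>: "0 \<le> d" "d \<le> \<delta>" "d \<le> \<delta>inf" and s: "0 < s" and \<theta>: "0 < \<theta>" "\<theta> \<le> 1"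
  shows "(if \<theta> * s \<le> 1 then (\<theta> * s) powr \<delta> else (\<theta> * s) powr \<delta>inf) \<le> \<theta> powr d * (if s \<le> 1 then s powr \<delta> else s powr \<delta>inf)"
proof -
  have same: "(\<theta> * s) powr e \<le> \<theta> powr d * s powr e" if "d \<le> e" for e
    using \<theta> s that by (simp add: powr_mult mult_right_mono powr_mono')
  consider "s \<le> 1" | "1 < s" "1 < \<theta> * s" | "1 < s" "\<theta> * s \<le> 1" by linarith
  then show ?thesis
  proof cases
    case 1
    then have "\<theta> * s \<le> 1" using \<theta> s mult_le_one[of \<theta> s] by simp
    then show ?thesis using 1 same[OF \<delta>(2)] by simp
  next
    case 2
    then show ?thesis using same[OF \<delta>(3)] by simp
  next
    case 3
    have "(\<theta> * s) powr \<delta> \<le> (\<theta> * s) powr d" using 3 \<theta> s \<delta> by (intro powr_mono') auto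
    also have "\<dots> = \<theta> powr d * s powr d" using \<theta> s by (simp add: powr_mult)
    also have "\<dots> \<le> \<theta> powr d * s powr \<delta>inf" using 3 \<delta> by (intro mult_left_mono powr_mono) auto
    finally show ?thesis using 3 by simp
  qed
qed

text \<open>In the mixed case 1/2 < s \<le> 1 one factor 2^n bounds (2 s)^\<delta>inf and another
  compensates for s^\<delta> \<ge> 2^(-n), hence 4^n.\<close>

lemma two_regime_power_double:
  fixes \<delta> \<delta>inf n s :: real
  assumes \<delta>: "0 \<le> \<delta>" "\<delta> \<le> n" "0 \<le> \<delta>inf" "\<delta>inf \<le> n" and s: "0 < s"
  shows "(if 2 * s \<le> 1 then (2 * s) powr \<delta> else (2 * s) powr \<delta>inf) \<le> 4 powr n * (if s \<le> 1 then s powr \<delta> else s powr \<delta>inf)"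
proof -
  have n: "0 \<le> n" using \<delta> by linarith
  have same: "(2 * s) powr e \<le> 4 powr n * s powr e" if "0 \<le> e" "e \<le> n" for e
  proof -
    have "(2::real) powr e \<le> 2 powr n" using that by (intro powr_mono) auto
    also have "\<dots> \<le> 4 powr n" using n by (intro powr_mono2) auto
    finally show ?thesis using s by (simp add: powr_mult mult_right_mono)
  qed
  consider "2 * s \<le> 1" | "1 < s" | "s \<le> 1" "1 < 2 * s" by linarith
  then show ?thesis
  proof cases
    case 1
    then show ?thesis using same[OF \<delta>(1,2)] s by simp
  next
    case 2
    then show ?thesis using same[OF \<delta>(3,4)] by simp
  next
    case 3
    have "(2 * s) powr \<delta>inf \<le> 2 powr \<delta>inf" using 3 s \<delta> by (intro powr_mono2) auto
    also have "\<dots> \<le> 2 powr n" using \<delta> by (intro powr_mono) auto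
    also have "\<dots> = 4 powr n * (1 / 2) powr n"
      by (subst powr_mult[symmetric]) auto
    also have "\<dots> \<le> 4 powr n * (1 / 2) powr \<delta>" using \<delta> by (intro mult_left_mono powr_mono') auto
    also have "\<dots> \<le> 4 powr n * s powr \<delta>" using 3 \<delta> by (intro mult_left_mono powr_mono2) auto
    finally show ?thesis using 3 by simp
  qed
qed

text \<open>Since b matters only up to a null set, regularity and sign are asserted of a
  representative b', while the commutator is formed with b itself.\<close>

theorem theorem3p1:
  fixes \<delta> p q r b :: "real^'n \<Rightarrow> real" and \<beta> :: real
  assumes \<delta>_range: "\<And>x. 0 < \<delta> x \<and> \<delta> x < real CARD('n)"
    and p: "p \<in> log_hoelder_exponents"
    and q: "q \<in> log_hoelder_exponents"
    and r: "r \<in> log_hoelder_exponents"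
    and \<beta>: "1 < \<beta>" "\<beta> < (INF x. p x)"
    and i: "0 < (INF x. \<delta> x)"
      "(SUP x. r x * \<delta> x) < real CARD('n)"
      "exponent_at_infinity r * (SUP x. \<delta> x) < real CARD('n)"
    and ii: "AE x in lebesgue. exponent_at_infinity p \<le> p x"
      "1 / \<beta> + 1 / (SUP x. conjugate_exponent p x) > 1"
    and iii: "\<And>x. 1 / r x - 1 / q x = \<delta> x / real CARD('n)"
      "\<And>x. \<delta> x / real CARD('n) = 1 / \<beta> - 1 / p x"
    and b: "locally_integrable b"
  shows "(\<exists>b'. (AE x in lebesgue. b' x = b x) \<and> b' \<in> var_lipschitz \<delta> \<and> (\<forall>x. 0 \<le> b' x)) \<longleftrightarrow>
    bounded_operator (sharp_commutator_defined b) (sharp_commutator b) r q"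
proof -
  define n where "n = real CARD('n)"
  have n: "0 < n" by (simp add: n_def)
  obtain Cp \<sigma>p where P: "log_hoelder_with Cp (exponent_at_infinity p) p" "\<forall>x. (INF x. p x) \<le> p x"
    using log_hoelder_exponentsD[OF p] by metis
  obtain Cq \<sigma>q where Q: "log_hoelder_with Cq (exponent_at_infinity q) q" "q \<in> borel_measurable lebesgue"
    "1 < (INF x. q x)" "\<forall>x. (INF x. q x) \<le> q x" "\<forall>x. q x \<le> \<sigma>q"
    using log_hoelder_exponentsD[OF q] by metis
  obtain Cr \<sigma>r where R: "log_hoelder_with Cr (exponent_at_infinity r) r" "r \<in> borel_measurable lebesgue"
    "1 < (INF x. r x)" "\<forall>x. (INF x. r x) \<le> r x" "\<forall>x. r x \<le> \<sigma>r"
    using log_hoelder_exponentsD[OF r] by metis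
  have q1: "1 \<le> q x" for x using Q(3) Q(4)[rule_format, of x] by linarith
  have r1: "1 \<le> r x" for x using R(3) R(4)[rule_format, of x] by linarith
  have p1: "1 \<le> p x" for x using \<beta> P(2)[rule_format, of x] by linarith
  have bdd: "bdd_above (range \<delta>)" "bdd_below (range \<delta>)"
    using \<delta>_range by (auto intro!: bdd_aboveI[of _ "real CARD('n)"] bdd_belowI[of _ 0] less_imp_le)
  have \<Delta>: "\<delta> x \<le> (SUP x. \<delta> x)" for x by (intro cSUP_upper bdd) auto
  define d where "d = (INF x. \<delta> x)"
  have d: "0 < d" "d \<le> \<delta> x" for x using i(1) by (auto simp: d_def intro!: cINF_lower bdd)
  \<comment> \<open>The limit of \<delta>, computed from r and q as the commutator estimate
    requires. Below, \<open>\<delta>inf_p\<close> computes it again from p, the exponent whose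
    comparison with its limit is assumed.\<close>
  define \<delta>inf where "\<delta>inf = n * (1 / exponent_at_infinity r - 1 / exponent_at_infinity q)"
  have \<delta>_lim: "(\<delta> \<longlongrightarrow> \<delta>inf) at_infinity"
  proof -
    have "exponent_at_infinity r \<noteq> 0" "exponent_at_infinity q \<noteq> 0"
      using log_hoelder_with_infinity_ge[OF R(1) r1] log_hoelder_with_infinity_ge[OF Q(1) q1] by auto
    then have "((\<lambda>x. n * (1 / r x - 1 / q x)) \<longlongrightarrow> \<delta>inf) at_infinity"
      unfolding \<delta>inf_def
      by (intro tendsto_mult tendsto_diff tendsto_divide tendsto_const log_hoelder_with_tendsto[OF R(1)] log_hoelder_with_tendsto[OF Q(1)])
    then show ?thesis using n by (simp add: iii(1) n_def)
  qed
  have \<delta>inf_p: "\<delta>inf = n * (1 / \<beta> - 1 / exponent_at_infinity p)"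
  proof (rule tendsto_unique[OF _ \<delta>_lim])
    have "exponent_at_infinity p \<noteq> 0" using log_hoelder_with_infinity_ge[OF P(1) p1] by auto
    then have "((\<lambda>x. n * (1 / \<beta> - 1 / p x)) \<longlongrightarrow> n * (1 / \<beta> - 1 / exponent_at_infinity p)) at_infinity"
      by (intro tendsto_mult tendsto_diff tendsto_divide tendsto_const log_hoelder_with_tendsto[OF P(1)])
    then show "(\<delta> \<longlongrightarrow> n * (1 / \<beta> - 1 / exponent_at_infinity p)) at_infinity"
      using n by (simp add: iii(2)[symmetric] n_def)
  qed (simp add: trivial_limit_at_infinity)
  have \<delta>inf: "d \<le> \<delta>inf" "\<delta>inf \<le> n"
  proof -
    show "d \<le> \<delta>inf"
      by (rule tendsto_lowerbound[OF \<delta>_lim]) (use d(2) in \<open>auto simp: trivial_limit_at_infinity\<close>)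
    show "\<delta>inf \<le> n"
    proof (rule tendsto_upperbound[OF \<delta>_lim])
      have "\<delta> x \<le> n" for x using \<delta>_range[of x] by (simp add: n_def)
      then show "\<forall>\<^sub>F x in at_infinity. \<delta> x \<le> n" by (intro always_eventually allI)
    qed (simp add: trivial_limit_at_infinity)
  qed
  have \<delta>_ge: "\<delta>inf \<le> \<delta> x" for x
  proof -
    have "exponent_at_infinity p \<le> p x"
      using AE_ge_imp_ge[OF log_hoelder_with_continuous[OF P(1)] ii(1)] .
    moreover have "1 \<le> exponent_at_infinity p" using log_hoelder_with_infinity_ge[OF P(1) p1] .
    ultimately have "1 / p x \<le> 1 / exponent_at_infinity p" by (intro divide_left_mono) auto
    then have "n * (1 / \<beta> - 1 / exponent_at_infinity p) \<le> n * (1 / \<beta> - 1 / p x)"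
      using n by (intro mult_left_mono) auto
    then show ?thesis using n by (simp add: \<delta>inf_p iii(2)[symmetric] n_def)
  qed
  show ?thesis
  proof
    assume "\<exists>b'. (AE x in lebesgue. b' x = b x) \<and> b' \<in> var_lipschitz \<delta> \<and> (\<forall>x. 0 \<le> b' x)"
    then obtain b' where b': "AE x in lebesgue. b' x = b x" "b' \<in> var_lipschitz \<delta>" "\<And>x. 0 \<le> b' x" by blast
    show "bounded_operator (sharp_commutator_defined b) (sharp_commutator b) r q"
      by (rule sharp_commutator_bounded[OF R(1,2) R(4)[rule_format] R(5)[rule_format] R(3) q1 Q(5)[rule_format] Q(2) _ \<Delta> _ iii(1) i(3) b b'])
        (use \<delta>_range in \<open>auto intro: less_imp_le\<close>)
  next
    assume bounded: "bounded_operator (sharp_commutator_defined b) (sharp_commutator b) r q"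
    define \<phi> where "\<phi> x s = (if s \<le> 1 then s powr \<delta> x else s powr \<delta>inf)" for x s
    obtain C where C: "0 \<le> C" and osc: "\<forall>a s x. 0 < s \<longrightarrow> x \<in> cube a s \<longrightarrow>
        oscillation a s b \<le> C * (if s \<le> 1 then s powr \<delta> x else s powr \<delta>inf) \<and>
        \<bar>cube_average (cube a s) b\<bar> \<le> cube_average (cube a s) b + C * (if s \<le> 1 then s powr \<delta> x else s powr \<delta>inf)"
    proof (rule oscillation_of_bounded_sharp_commutator[OF R(1) r1 R(2) Q(1) q1 Q(2) iii(1) _ b bounded])
      show "1 / exponent_at_infinity r - 1 / exponent_at_infinity q = \<delta>inf / real CARD('n)"
        using n by (simp add: \<delta>inf_def n_def)
    qed (rule that, assumption+)
    obtain b' C' where b': "AE x in lebesgue. b' x = b x" and C': "0 \<le> C'"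
      and approx: "\<forall>x a s. 0 < s \<longrightarrow> x \<in> cube a s \<longrightarrow> \<bar>b' x - cube_average (cube a s) b\<bar> \<le> C' * \<phi> x s"
      and two: "\<forall>x y. x \<noteq> y \<longrightarrow> \<bar>b' x - b' y\<bar> \<le> C' * (\<phi> x (norm (x - y)) + \<phi> y (norm (x - y)))"
    proof (rule campanato_representative[OF b C d(1)])
      show "oscillation a s b \<le> C * \<phi> x s" if "0 < s" "x \<in> cube a s" for a s x
        using osc that by (simp add: \<phi>_def)
      show "\<phi> x (\<theta> * s) \<le> \<theta> powr d * \<phi> x s" if "0 < s" "0 < \<theta>" "\<theta> \<le> 1" for x s \<theta>
        unfolding \<phi>_def using two_regime_power_shrink[OF less_imp_le[OF d(1)] d(2) \<delta>inf(1) that] .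
      show "\<phi> x (2 * s) \<le> 4 powr n * \<phi> x s" if "0 < s" for x s
        unfolding \<phi>_def using \<delta>_range[of x] \<delta>inf d(1) that by (intro two_regime_power_double) (auto simp: n_def)
    qed (auto simp: \<phi>_def intro: that)
    have "b' \<in> var_lipschitz \<delta>"
    proof -
      \<comment> \<open>Local log-Hoelder continuity of p with \<kappa> = 1. Through \<delta> = n
        (1/\<beta> - 1/p) and p \<ge> 1 it passes to \<delta>, so that \<delta>(y) may be exchanged
        for \<delta>(x) at distances up to 1.\<close>
      define E where "E = exp (n * (Cp * (1 + ln 1)))"
      have "\<bar>b' x - b' y\<bar> \<le> C' * (1 + max 1 E) * norm (x - y) powr \<delta> x" for x y
      proof (cases "x = y")
        case False
        define t where "t = norm (x - y)"
        have t: "0 < t" using False by (simp add: t_def)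
        have \<phi>x: "\<phi> x t \<le> t powr \<delta> x"
          using \<delta>_ge[of x] by (auto simp: \<phi>_def intro!: powr_mono)
        have \<phi>y: "\<phi> y t \<le> max 1 E * t powr \<delta> x"
        proof (cases "t \<le> 1")
          case True
          have "t powr \<delta> y \<le> E * t powr \<delta> x"
            unfolding E_def
          proof (rule powr_le_exp_mult_powr[OF t])
            have "\<delta> y - \<delta> x = n * (1 / p x - 1 / p y)"
              using iii(2)[of x] iii(2)[of y] n by (simp add: n_def field_simps)
            also have "1 / p x - 1 / p y = (p y - p x) / (p x * p y)"
              using p1[of x] p1[of y] by (simp add: field_simps)
            finally have "\<bar>\<delta> y - \<delta> x\<bar> = n * (\<bar>p x - p y\<bar> / (p x * p y))"
              using n p1[of x] p1[of y] by (simp add: abs_mult abs_minus_commute)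
            also have "\<dots> \<le> n * (\<bar>p x - p y\<bar> / 1)"
              using n p1[of x] p1[of y] mult_mono[of 1 "p x" 1 "p y"] by (intro mult_left_mono divide_left_mono) auto
            finally have "\<bar>\<delta> y - \<delta> x\<bar> * \<bar>ln t\<bar> \<le> n * \<bar>p x - p y\<bar> * \<bar>ln t\<bar>"
              by (intro mult_right_mono) auto
            also have "\<dots> = n * (\<bar>p x - p y\<bar> * ln (1 / t))" using t True by (simp add: ln_div)
            also have "\<dots> \<le> n * (Cp * (1 + ln 1))"
              using n t by (intro mult_left_mono log_hoelder_with_local[OF P(1) t True]) (auto simp: t_def)
            finally show "\<bar>\<delta> y - \<delta> x\<bar> * \<bar>ln t\<bar> \<le> n * (Cp * (1 + ln 1))" .
          qed
          also have "\<dots> \<le> max 1 E * t powr \<delta> x" by (intro mult_right_mono) auto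
          finally show ?thesis using True by (simp add: \<phi>_def)
        next
          case False
          \<comment> \<open>Beyond distance 1 the gauge no longer depends on y, and \<delta>inf
            \<le> \<delta>(x) has the favourable direction.\<close>
          have "t powr \<delta>inf \<le> 1 * t powr \<delta> x" using False \<delta>_ge[of x] by (auto intro: powr_mono)
          also have "\<dots> \<le> max 1 E * t powr \<delta> x" by (intro mult_right_mono) auto
          finally show ?thesis using False by (simp add: \<phi>_def)
        qed
        have "\<bar>b' x - b' y\<bar> \<le> C' * (\<phi> x t + \<phi> y t)" using two False by (simp add: t_def)
        also have "\<dots> \<le> C' * (t powr \<delta> x + max 1 E * t powr \<delta> x)"
          by (intro mult_left_mono add_mono \<phi>x \<phi>y C')
        finally show ?thesis by (simp add: t_def algebra_simps)
      qed simp
      then show ?thesis unfolding var_lipschitz_def by blast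
    qed
    moreover have "0 \<le> b' x" for x
    proof -
      \<comment> \<open>On cubes shrinking to x, with mean c of b, |b'(x) - c| and |c| - c are both
        of order s^\<delta>(x). Exchanging b'(x) and c on both sides accounts for 2 C'.\<close>
      have "\<bar>b' x\<bar> \<le> b' x + (C + 2 * C') * inverse (real (Suc k)) powr d" for k
      proof -
        define s where "s = inverse (real (Suc k))"
        have s: "0 < s" "s \<le> 1" by (auto simp: s_def inverse_le_1_iff simp del: of_nat_Suc)
        have x: "x \<in> cube x s" using s by (simp add: mem_cube)
        have \<phi>: "\<phi> x s = s powr \<delta> x" using s by (simp add: \<phi>_def)
        have "\<bar>b' x - cube_average (cube x s) b\<bar> \<le> C' * s powr \<delta> x" using approx s x \<phi> by metis
        moreover have "\<bar>cube_average (cube x s) b\<bar> \<le> cube_average (cube x s) b + C * s powr \<delta> x"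
          using osc[rule_format, OF s(1) x] s(2) by simp
        ultimately have "\<bar>b' x\<bar> \<le> b' x + (C + 2 * C') * s powr \<delta> x"
          unfolding distrib_right by linarith
        also have "\<dots> \<le> b' x + (C + 2 * C') * s powr d"
          using s d(2) C C' by (intro add_left_mono mult_left_mono powr_mono') auto
        finally show ?thesis by (simp add: s_def)
      qed
      moreover have "(\<lambda>k. b' x + (C + 2 * C') * inverse (real (Suc k)) powr d) \<longlonglongrightarrow> b' x + (C + 2 * C') * 0 powr d"
      proof (intro tendsto_add tendsto_mult tendsto_const tendsto_powr' LIMSEQ_inverse_real_of_nat)
        have "\<forall>\<^sub>F k in sequentially. 0 \<le> inverse (real (Suc k))" by (intro always_eventually allI) simp
        then show "(0::real) \<noteq> 0 \<or> 0 < d \<and> (\<forall>\<^sub>F k in sequentially. 0 \<le> inverse (real (Suc k)))" using d by blast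
      qed
      ultimately have "\<bar>b' x\<bar> \<le> b' x + (C + 2 * C') * 0 powr d" by (intro LIMSEQ_le_const) blast+
      then show ?thesis by simp
    qed
    ultimately show "\<exists>b'. (AE x in lebesgue. b' x = b x) \<and> b' \<in> var_lipschitz \<delta> \<and> (\<forall>x. 0 \<le> b' x)"
      using b' by blast
  qed
qed

end
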